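(* Let $d\ge1$ be an integer and let $0<p,q<\infty$. The Haar wavelet system $H^d$ is an unconditional Schauder basis in $B_{p,q,1}^0(I^d)$ if and only if $1<p<\infty$ (and $0<q<\infty$). If $p=1$ and $0<q<\infty$, then $H^d$, with any blockwise ordering, is still a Schauder basis in $B_{1,q,1}^0(I^d)$, but only a conditional one (i.e. not unconditional).
   Context: Notation: $I=[0,1]$, $I^d\subset\mathbb{R}^d$ is the unit cube with Lebesgue measure, functions are real-valued and identified when equal a.e., $L_p=L_p(I^d)$ with the usual (quasi-)norm. Besov spaces with $s=0$: for $y\in\mathbb{R}^d$ let $I^d_y=\{z\in I^d: z+y\in I^d\}$ and $\Delta_y f(x)=f(x+y)-f(x)$ for $x\in I^d_y$. The first-order $L_p$ modulus of smoothness is $\omega(t,f)_p=\sup_{0<|y|\le t}\|\Delta_y f\|_{L_p(I^d_y)}$, $t>0$. For $0<p,q<\infty$, the space $B_{p,q,1}^0(I^d)$ is the set of all $f\in L_p(I^d)$ with finite quasi-norm $$\|f\|_{B_{p,q,1}^0}=\Big(\|f\|_{L_p}^q+\int_0^1 \omega(t,f)_p^q\,\frac{dt}{t}\Big)^{1/q}.$$ It is a quasi-Banach space. Haar wavelet system: for $k\ge 0$ and $i=1,\dots,2^k$ let $\Delta_{k,i}=[(i-1)2^{-k},i2^{-k})$. For $k\ge1$, $i=1,\dots,2^{k-1}$, put $h_{\Delta_{k-1,i}}=\chi_{\Delta_{k,2i-1}}-\chi_{\Delta_{k,2i}}$. Set $H_0^d=\{\chi_{I^d}\}$, and for $k\ge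 1$ let $H_k^d$ be the set of all tensor products $\psi_1\otimes\cdots\otimes\psi_d$ such that, for some $(i_1,\dots,i_d)\in\{1,\dots,2^{k-1}\}^d$, each $\psi_l$ is either $h_{\Delta_{k-1,i_l}}$ or $\chi_{\Delta_{k-1,i_l}}$, with at least one $\psi_l$ equal to $h_{\Delta_{k-1,i_l}}$. Then $H^d=\bigcup_{k\ge0}H_k^d$. A blockwise ordering of $H^d$ is an enumeration in which all elements of $H_k^d$ precede all elements of $H_{k+1}^d$, for every $k\ge0$, the order within each block being arbitrary. Schauder bases: a sequence $(f_m)_{m\in\mathbb{N}}$ in a quasi-Banach space $X$ is a Schauder basis in $X$ if every $f\in X$ has a unique representation $f=\sum_{m=1}^\infty c_mf_m$ converging in $X$. It is an unconditional Schauder basis if every rearrangement of it is a Schauder basis in $X$. *)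

theory Defs
  imports "HOL-Analysis.Analysis"
begin

definition unit_cube :: "(real ^ 'd) set" where
  "unit_cube = cbox 0 1"

text \<open>
  Functions on the unit cube are represented by total functions on \<open>real ^ 'd\<close>; every notion
  below depends only on their values on the cube, up to null sets.
\<close>

definition Lp_quasinorm :: "real \<Rightarrow> (real ^ 'd) set \<Rightarrow> (real ^ 'd \<Rightarrow> real) \<Rightarrow> real" where
  "Lp_quasinorm p S f = (LINT x:S|lebesgue. \<bar>f x\<bar> powr p) powr (1 / p)"

definition Lp_space :: "real \<Rightarrow> (real ^ 'd \<Rightarrow> real) set" where
  "Lp_space p = {f. f \<in> borel_measurable (lebesgue_on unit_cube) \<and>
     integrable (lebesgue_on unit_cube) (\<lambda>x. \<bar>f x\<bar> powr p)}"

definition shift_domain :: "real ^ 'd \<Rightarrow> (real ^ 'd) set" where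
  "shift_domain y = {z \<in> unit_cube. z + y \<in> unit_cube}"

text \<open>
  For \<open>f\<close> in \<open>Lp_space p\<close> and \<open>t > 0\<close> the supremum is over a nonempty set that is bounded by a
  constant multiple of the quasi-norm of \<open>f\<close>, so the real-valued supremum is the intended one.
  It is monotone in \<open>t\<close>, hence measurable.
\<close>

definition modulus :: "real \<Rightarrow> (real ^ 'd \<Rightarrow> real) \<Rightarrow> real \<Rightarrow> real" where
  "modulus p f t =
     (SUP y\<in>{y. 0 < norm y \<and> norm y \<le> t}.
        Lp_quasinorm p (shift_domain y) (\<lambda>x. f (x + y) - f x))"

definition besov_space :: "real \<Rightarrow> real \<Rightarrow> (real ^ 'd \<Rightarrow> real) set" where
  "besov_space p q = {f \<in> Lp_space p.
     set_integrable lborel {0<..1} (\<lambda>t. modulus p f t powr q / t)}"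

definition besov_quasinorm :: "real \<Rightarrow> real \<Rightarrow> (real ^ 'd \<Rightarrow> real) \<Rightarrow> real" where
  "besov_quasinorm p q f =
     (Lp_quasinorm p unit_cube f powr q
        + (LBINT t:{0<..1}. modulus p f t powr q / t)) powr (1 / q)"

definition dyadic_interval :: "nat \<Rightarrow> nat \<Rightarrow> real set" where
  "dyadic_interval k i = {(real i - 1) / 2 ^ k ..< real i / 2 ^ k}"

text \<open>\<open>haar k i\<close> is the Haar function supported on \<open>dyadic_interval k i\<close>, for \<open>i \<ge> 1\<close>.\<close>

definition haar :: "nat \<Rightarrow> nat \<Rightarrow> real \<Rightarrow> real" where
  "haar k i x = indicator (dyadic_interval (Suc k) (2 * i - 1)) x
              - indicator (dyadic_interval (Suc k) (2 * i)) x"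

primrec haar_block :: "nat \<Rightarrow> (real ^ 'd \<Rightarrow> real) set" where
  "haar_block 0 = {indicator unit_cube}"
| "haar_block (Suc k) =
     {(\<lambda>x. \<Prod>l\<in>UNIV. \<psi> l (x $ l)) | \<psi>.
        \<exists>i. (\<forall>l. i l \<in> {1..2 ^ k}) \<and>
            (\<forall>l. \<psi> l = haar k (i l) \<or> \<psi> l = indicator (dyadic_interval k (i l))) \<and>
            (\<exists>l. \<psi> l = haar k (i l))}"

definition haar_system :: "(real ^ 'd \<Rightarrow> real) set" where
  "haar_system = (\<Union>k. haar_block k)"

definition blockwise_ordering :: "(nat \<Rightarrow> real ^ 'd \<Rightarrow> real) \<Rightarrow> bool" where
  "blockwise_ordering h \<longleftrightarrow> bij_betw h UNIV haar_system \<and>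
     (\<forall>k m n. h m \<in> haar_block k \<longrightarrow> h n \<in> haar_block (Suc k) \<longrightarrow> m < n)"

text \<open>
  In the following, \<open>X\<close> is a linear space of real functions and \<open>N\<close> a quasi-norm on \<open>X\<close>
  (after identifying functions at distance 0).
\<close>

definition schauder_basis ::
  "('a \<Rightarrow> real) set \<Rightarrow> (('a \<Rightarrow> real) \<Rightarrow> real) \<Rightarrow> (nat \<Rightarrow> 'a \<Rightarrow> real) \<Rightarrow> bool" where
  "schauder_basis X N f \<longleftrightarrow> range f \<subseteq> X \<and>
     (\<forall>g\<in>X. \<exists>!c::nat \<Rightarrow> real.
        (\<lambda>n. N (\<lambda>x. g x - (\<Sum>m<n. c m * f m x))) \<longlonglongrightarrow> 0)"

definition unconditional_schauder_basis ::
  "('a \<Rightarrow> real) set \<Rightarrow> (('a \<Rightarrow> real) \<Rightarrow> real) \<Rightarrow> (nat \<Rightarrow> 'a \<Rightarrow> real) \<Rightarrow> bool" where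
  "unconditional_schauder_basis X N f \<longleftrightarrow>
     (\<forall>\<pi>::nat \<Rightarrow> nat. bij \<pi> \<longrightarrow> schauder_basis X N (f \<circ> \<pi>))"

text \<open>
  Unconditionality does not depend on the enumeration, so it makes sense for a countably infinite
  system \<open>H\<close>; any two enumerations of \<open>H\<close> are rearrangements of each other.
\<close>

definition unconditional_basis_system ::
  "('a \<Rightarrow> real) set \<Rightarrow> (('a \<Rightarrow> real) \<Rightarrow> real) \<Rightarrow> ('a \<Rightarrow> real) set \<Rightarrow> bool" where
  "unconditional_basis_system X N H \<longleftrightarrow>
     (\<exists>h. bij_betw h (UNIV :: nat set) H \<and> unconditional_schauder_basis X N h)"

end

theory Submission
  imports Defs
begin

text \<open>
  Let \<open>E k\<close> be the \<open>L\<^sub>p\<close> distance of \<open>f\<close> to its averages over dyadic cubes of side \<open>1 / 2 ^ k\<close>.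
  For \<open>p \<ge> 1\<close> a Jackson and a Bernstein inequality together with a discrete Hardy inequality show
  that the Besov norm is equivalent to the norm of \<open>f\<close> in \<open>L\<^sub>p\<close> plus the \<open>\<ell>\<^sub>q\<close> norm of \<open>E\<close>.
  Haar projections commute with the averages, so any ordering whose partial sum operators are
  uniformly bounded on \<open>L\<^sub>p\<close> gives a Schauder basis. For \<open>p > 1\<close> all finite Haar projections are
  uniformly bounded by Burkholder's theorem on martingale transforms; for \<open>p = 1\<close> a blockwise
  partial sum is an average plus part of a single level.

  For \<open>p < 1\<close> the Haar expansion of a Dirac mass converges to \<open>0\<close> and destroys uniqueness. For
  \<open>p = 1\<close> the function \<open>f = \<Sum>n. (b n - b (n + 1)) \<delta>\<^bsub>n+1\<^esub>\<close>, where \<open>\<delta>\<^sub>n\<close> is the \<open>L\<^sub>1\<close>-normalised indicator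
  of the dyadic cube of side \<open>1 / 2 ^ n\<close> at the origin and \<open>b n = (n + 1) powr - (1 / q + 1 / 2)\<close>,
  lies in the Besov space because \<open>E\<close> is of order \<open>b\<close>, but the terms of even level
  in a dyadic range of levels reinforce each other, so that an ordering which sums them first
  makes the expansion of \<open>f\<close> diverge.
\<close>

section \<open>Convexity and Burkholder's function\<close>

text \<open>At smoothness zero the only gain between scales is the factor
  \<open>2 powr (- (1 / p))\<close> per level in the Bernstein inequality for step functions; it is
  below 1, which is all that the Hardy inequality needs, for every q > 0. Bounds on L_p transfer to
  the Besov norm without interpolation, because a partial sum containing all levels up to K leaves a
  residual whose distance at scale j is at most a constant times that of f at scale
  \<open>max j K\<close>. For p > 1 each of the 2^d - 1 types of Haar function (the set of
  directions in which it oscillates) gives a martingale transform of its own, and the types are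
  added at the end. For p < 1 a level-ordered partial sum of the expansion of the Dirac mass is at
  most 2^d times one normalised indicator, whose L_p norm decays geometrically in the level, while
  the passage to the Besov norm costs only a power of the level. For p = 1 consecutive differences
  of the normalised indicators largely cancel. Leaving out every second one removes the
  cancellation, and the L_1 norm becomes comparable with the sum of the \<open>b n\<close>, whereas
  membership of f only needs the q-th powers of the \<open>b n\<close> to be summable.\<close>

lemma supporting_line:
  fixes f g :: "real \<Rightarrow> real"
  assumes cont: "continuous_on UNIV f" and fin: "finite K" and "mono g"
    and deriv: "\<And>x. x \<notin> K \<Longrightarrow> (f has_real_derivative g x) (at x)"
  shows "f x + g x * (y - x) \<le> f y"
proof -
  have int: "(g has_integral f b - f a) {a..b}" if "a \<le> b" for a b
    using that deriv continuous_on_subset[OF cont]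
    by (intro fundamental_theorem_of_calculus_interior_strong[OF fin])
       (auto simp: has_real_derivative_iff_has_vector_derivative)
  have const: "((\<lambda>_. g x) has_integral g x * (b - a)) {a..b}" if "a \<le> b" for a b
    using has_integral_const_real[of "g x" a b] that by (simp add: mult.commute)
  show ?thesis
  proof (cases "x \<le> y")
    case True
    have "g x * (y - x) \<le> f y - f x"
      by (rule has_integral_le[OF const int]) (use True \<open>mono g\<close> in \<open>auto simp: mono_def\<close>)
    then show ?thesis by simp
  next
    case False
    have "f x - f y \<le> g x * (x - y)"
      by (rule has_integral_le[OF int const]) (use False \<open>mono g\<close> in \<open>auto simp: mono_def\<close>)
    then show ?thesis by (simp add: algebra_simps)
  qed
qed

text \<open>Minkowski's and Jensen's inequalities below both come from this tangent line. At the
  kink 0 the slope is 0, which is a subgradient for p = 1 too.\<close>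

lemma abs_powr_supporting_line:
  fixes p x y :: real
  assumes "1 \<le> p"
  shows "\<bar>x\<bar> powr p + (sgn x * (p * \<bar>x\<bar> powr (p - 1))) * (y - x) \<le> \<bar>y\<bar> powr p"
proof (rule supporting_line[where K="{0}"])
  show "continuous_on UNIV (\<lambda>x::real. \<bar>x\<bar> powr p)"
    by (intro continuous_on_powr' continuous_intros) (use assms in auto)
  show "mono (\<lambda>x::real. sgn x * (p * \<bar>x\<bar> powr (p - 1)))"
  proof (rule monoI)
    fix x y :: real assume xy: "x \<le> y"
    consider "0 < x" | "y < 0" | "x \<le> 0" "0 \<le> y" by linarith
    then show "sgn x * (p * \<bar>x\<bar> powr (p - 1)) \<le> sgn y * (p * \<bar>y\<bar> powr (p - 1))"
    proof cases
      case 1 with assms xy show ?thesis by (auto intro!: mult_left_mono powr_mono2)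
    next
      case 2 with assms xy show ?thesis by (auto intro!: mult_left_mono powr_mono2)
    next
      case 3
      then have "sgn x \<le> 0" "0 \<le> sgn y" by (auto simp: sgn_if)
      with assms show ?thesis
        by (meson abs_ge_zero mult_nonneg_nonneg mult_nonpos_nonneg order_trans powr_ge_zero zero_le_one)
    qed
  qed
  fix x :: real assume "x \<notin> {0}"
  then consider "0 < x" | "x < 0" by force
  then show "((\<lambda>x. \<bar>x\<bar> powr p) has_real_derivative sgn x * (p * \<bar>x\<bar> powr (p - 1))) (at x)"
  proof cases
    case 1
    have "((\<lambda>x. x powr p) has_real_derivative p * x powr (p - 1)) (at x)"
      using 1 by (auto intro!: derivative_eq_intros)
    then have "((\<lambda>x. \<bar>x\<bar> powr p) has_real_derivative p * x powr (p - 1)) (at x)"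
      by (rule DERIV_cong_ev[THEN iffD1, rotated 3])
         (use 1 in \<open>auto intro!: eventually_mono[OF eventually_nhds_in_open[of "{0<..}" x]]\<close>)
    with 1 show ?thesis by simp
  next
    case 2
    have "((\<lambda>x. (- x) powr p) has_real_derivative - (p * (- x) powr (p - 1))) (at x)"
      using 2 by (auto intro!: derivative_eq_intros)
    then have "((\<lambda>x. \<bar>x\<bar> powr p) has_real_derivative - (p * (- x) powr (p - 1))) (at x)"
      by (rule DERIV_cong_ev[THEN iffD1, rotated 3])
         (use 2 in \<open>auto intro!: eventually_mono[OF eventually_nhds_in_open[of "{..<0}" x]]\<close>)
    with 2 show ?thesis by simp
  qed
qed simp

lemma abs_powr_convex_comb:
  fixes p u v x y :: real
  assumes "1 \<le> p" "0 \<le> u" "0 \<le> v" "u + v = 1"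
  shows "\<bar>u * x + v * y\<bar> powr p \<le> u * \<bar>x\<bar> powr p + v * \<bar>y\<bar> powr p"
proof -
  define z where "z = u * x + v * y"
  define s where "s = sgn z * (p * \<bar>z\<bar> powr (p - 1))"
  have "u * (\<bar>z\<bar> powr p + s * (x - z)) + v * (\<bar>z\<bar> powr p + s * (y - z))
      \<le> u * \<bar>x\<bar> powr p + v * \<bar>y\<bar> powr p"
    unfolding s_def using assms by (intro add_mono mult_left_mono abs_powr_supporting_line)
  moreover have "u * (\<bar>z\<bar> powr p + s * (x - z)) + v * (\<bar>z\<bar> powr p + s * (y - z))
      = (u + v) * \<bar>z\<bar> powr p + s * ((u * x + v * y) - (u + v) * z)"
    by (simp add: algebra_simps)
  ultimately show ?thesis using assms by (simp add: z_def)
qed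

text \<open>A crude bound through the maximum; unlike convexity it is available for p < 1.\<close>

lemma powr_abs_add_le:
  fixes p x y :: real
  assumes "0 < p"
  shows "\<bar>x + y\<bar> powr p \<le> 2 powr p * (\<bar>x\<bar> powr p + \<bar>y\<bar> powr p)"
proof -
  have "\<bar>x + y\<bar> powr p \<le> (2 * max \<bar>x\<bar> \<bar>y\<bar>) powr p"
    using assms by (intro powr_mono2) auto
  also have "\<dots> = 2 powr p * (max \<bar>x\<bar> \<bar>y\<bar>) powr p"
    by (simp add: powr_mult)
  also have "\<dots> \<le> 2 powr p * (\<bar>x\<bar> powr p + \<bar>y\<bar> powr p)"
    by (intro mult_left_mono) (auto simp: max_def)
  finally show ?thesis .
qed

lemma powr_abs_diff_le:
  fixes p x y :: real
  assumes "0 < p"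
  shows "\<bar>x - y\<bar> powr p \<le> 2 powr p * (\<bar>x\<bar> powr p + \<bar>y\<bar> powr p)"
  using powr_abs_add_le[OF assms, of x "- y"] by simp

text \<open>
  In the coordinates \<open>a = (x + y) / 2\<close>, \<open>b = (x - y) / 2\<close> this is, up to scaling, Burkholder's
  function \<open>(\<bar>y\<bar> - (p\<^sup>* - 1) \<bar>x\<bar>) (\<bar>x\<bar> + \<bar>y\<bar>) powr (p - 1)\<close>; zigzag-concavity of the latter
  becomes concavity in each of the two variables.
\<close>

definition burkholder :: "real \<Rightarrow> real \<Rightarrow> real \<Rightarrow> real" where
  "burkholder p a b = - \<bar>p - 2\<bar> * max \<bar>a\<bar> \<bar>b\<bar> powr p - p * a * b * max \<bar>a\<bar> \<bar>b\<bar> powr (p - 2)"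

lemma burkholder_commute: "burkholder p a b = burkholder p b a"
  by (simp add: burkholder_def max.commute mult_ac)

lemma burkholder_uminus: "burkholder p (- a) (- b) = burkholder p a b"
  by (simp add: burkholder_def)

lemma burkholder_zero_left: "burkholder p 0 b = - \<bar>p - 2\<bar> * \<bar>b\<bar> powr p"
  by (simp add: burkholder_def)

lemma burkholder_zero_right: "burkholder p a 0 = - \<bar>p - 2\<bar> * \<bar>a\<bar> powr p"
  by (simp add: burkholder_def)

text \<open>Concavity in the first variable, checked through the slopes of the negated function,
  which must increase. The coefficient \<bar>p - 2\<bar> is the smallest for which they do: the
  jumps at b and -b require \<bar>p - 2\<bar> + p - 1 \<ge> 1 and p - 1 - \<bar>p - 2\<bar> \<le> 1,
  and beyond them the sign of the second derivative follows from x \<ge> b.\<close>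

lemma burkholder_slope_pos:
  fixes p a b h :: real
  assumes p: "1 < p" and b: "0 < b"
  shows "\<exists>s. \<forall>h. burkholder p (a + h) b \<le> burkholder p a b + h * s"
proof -
  define B where "B = \<bar>p - 2\<bar>"
  \<comment> \<open>Slopes of the negated function: \<open>hi t\<close> for t > b and
    \<open>lo (- t)\<close> for t < -b; between the kinks it is affine.\<close>
  define hi where "hi t = p * (B * t powr (p - 1) + (p - 1) * b * t powr (p - 2))" for t
  define lo where "lo t = p * (- B * t powr (p - 1) + (p - 1) * b * t powr (p - 2))" for t
  define g where "g t = (if t > b then hi t else if t < - b then lo (- t) else p * b powr (p - 1))"
    for t
  define f where "f t = - burkholder p t b" for t
  have pw: "t powr (p - 1) = t * t powr (p - 2)" "t powr p = t * (t * t powr (p - 2))"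
     "t powr (p - 2) = t * t powr (p - 3)" if "t > 0" for t
    using that by (simp_all add: powr_mult_base flip: powr_add)
  have hi_mono: "hi s \<le> hi t" if "b \<le> s" "s \<le> t" for s t
  proof (rule DERIV_nonneg_imp_nondecreasing[OF that(2)])
    fix x assume x: "s \<le> x" "x \<le> t"
    then have "x > 0" using b that by linarith
    have "(hi has_real_derivative p * (B * ((p - 1) * x powr (p - 2)) + (p - 1) * b * ((p - 2) * x powr (p - 3)))) (at x)"
      unfolding hi_def using \<open>x > 0\<close> by (auto intro!: derivative_eq_intros simp: algebra_simps)
    also have "p * (B * ((p - 1) * x powr (p - 2)) + (p - 1) * b * ((p - 2) * x powr (p - 3)))
       = p * (p - 1) * x powr (p - 3) * (B * x + (p - 2) * b)"
      unfolding pw(3)[OF \<open>x > 0\<close>] by (simp add: algebra_simps)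
    finally have D: "(hi has_real_derivative p * (p - 1) * x powr (p - 3) * (B * x + (p - 2) * b)) (at x)" .
    have "B * b \<le> B * x" using x that by (intro mult_left_mono) (auto simp: B_def)
    moreover have "- (p - 2) * b \<le> B * b" using b by (intro mult_right_mono) (auto simp: B_def)
    ultimately have "0 \<le> B * x + (p - 2) * b" by (simp add: algebra_simps)
    with p have "0 \<le> p * (p - 1) * x powr (p - 3) * (B * x + (p - 2) * b)" by auto
    with D show "\<exists>y. (hi has_real_derivative y) (at x) \<and> 0 \<le> y" by blast
  qed
  have lo_mono: "lo t \<le> lo s" if "b \<le> s" "s \<le> t" for s t
  proof (rule DERIV_nonpos_imp_nonincreasing[OF that(2)])
    fix x assume x: "s \<le> x" "x \<le> t"
    then have "x > 0" using b that by linarith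
    have "(lo has_real_derivative p * (- B * ((p - 1) * x powr (p - 2)) + (p - 1) * b * ((p - 2) * x powr (p - 3)))) (at x)"
      unfolding lo_def using \<open>x > 0\<close> by (auto intro!: derivative_eq_intros simp: algebra_simps)
    also have "p * (- B * ((p - 1) * x powr (p - 2)) + (p - 1) * b * ((p - 2) * x powr (p - 3)))
       = p * (p - 1) * x powr (p - 3) * (- B * x + (p - 2) * b)"
      unfolding pw(3)[OF \<open>x > 0\<close>] by (simp add: algebra_simps)
    finally have D: "(lo has_real_derivative p * (p - 1) * x powr (p - 3) * (- B * x + (p - 2) * b)) (at x)" .
    have "B * b \<le> B * x" using x that by (intro mult_left_mono) (auto simp: B_def)
    moreover have "(p - 2) * b \<le> B * b" using b by (intro mult_right_mono) (auto simp: B_def)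
    ultimately have "- B * x + (p - 2) * b \<le> 0" by (simp add: algebra_simps)
    with p have "p * (p - 1) * x powr (p - 3) * (- B * x + (p - 2) * b) \<le> 0"
      by (auto intro!: mult_nonneg_nonpos)
    with D show "\<exists>y. (lo has_real_derivative y) (at x) \<and> y \<le> 0" by blast
  qed
  have "hi b = p * ((B + (p - 1)) * b powr (p - 1))" "lo b = p * ((- B + (p - 1)) * b powr (p - 1))"
    unfolding hi_def lo_def pw(1)[OF b] by (simp_all add: algebra_simps)
  moreover have "1 * b powr (p - 1) \<le> (B + (p - 1)) * b powr (p - 1)"
     "(- B + (p - 1)) * b powr (p - 1) \<le> 1 * b powr (p - 1)"
    by (intro mult_right_mono; simp add: B_def abs_if)+
  ultimately have ends: "p * b powr (p - 1) \<le> hi b" "lo b \<le> p * b powr (p - 1)"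
    using p by (auto intro!: mult_left_mono)
  have up: "p * b powr (p - 1) \<le> hi t" if "b \<le> t" for t
    using hi_mono[of b t] ends that by linarith
  have down: "lo t \<le> p * b powr (p - 1)" if "b \<le> t" for t
    using lo_mono[of b t] ends that by linarith
  have "mono g"
  proof (rule monoI)
    fix s t :: real assume st: "s \<le> t"
    have "lo (- s) \<le> hi t" if "s < -b" "b < t" for s t
      using up[of t] down[of "- s"] that by auto
    then show "g s \<le> g t"
      using st b up[of t] down[of "- s"] hi_mono[of s t] lo_mono[of "- t" "- s"]
      by (auto simp: g_def)
  qed
  have cont: "continuous_on UNIV f"
    unfolding f_def burkholder_def using p b by (intro continuous_intros) auto
  have der: "(f has_real_derivative g x) (at x)" if "x \<notin> {- b, b}" for x
  proof -
    have "x \<noteq> b" "x \<noteq> - b" using that by auto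
    then consider "x > b" | "x < - b" | "- b < x" "x < b" by linarith
    then show ?thesis
    proof cases
      case 1
      have "((\<lambda>t. B * t powr p + p * b * t powr (p - 1)) has_real_derivative g x) (at x)"
        using 1 b by (auto intro!: derivative_eq_intros simp: g_def hi_def algebra_simps)
      then show ?thesis
      proof (rule DERIV_cong_ev[THEN iffD1, rotated 3])
        show "\<forall>\<^sub>F t in nhds x. B * t powr p + p * b * t powr (p - 1) = f t"
        proof (rule eventually_mono[OF eventually_nhds_in_open[of "{b<..}" x]])
          fix t assume "t \<in> {b<..}"
          then show "B * t powr p + p * b * t powr (p - 1) = f t"
            using b pw(1)[of t] by (simp add: f_def burkholder_def B_def)
        qed (use 1 in auto)
      qed auto
    next
      case 2
      have "((\<lambda>t. B * (- t) powr p - p * b * (- t) powr (p - 1)) has_real_derivative g x) (at x)"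
        using 2 b by (auto intro!: derivative_eq_intros simp: g_def lo_def algebra_simps)
      then show ?thesis
      proof (rule DERIV_cong_ev[THEN iffD1, rotated 3])
        show "\<forall>\<^sub>F t in nhds x. B * (- t) powr p - p * b * (- t) powr (p - 1) = f t"
        proof (rule eventually_mono[OF eventually_nhds_in_open[of "{..<-b}" x]])
          fix t assume "t \<in> {..<-b}"
          then show "B * (- t) powr p - p * b * (- t) powr (p - 1) = f t"
            using b pw(1)[of "- t"] by (simp add: f_def burkholder_def B_def)
        qed (use 2 in auto)
      qed auto
    next
      case 3
      have "((\<lambda>t. B * b powr p + p * t * b powr (p - 1)) has_real_derivative g x) (at x)"
        using 3 b by (auto intro!: derivative_eq_intros simp: g_def algebra_simps)
      then show ?thesis
      proof (rule DERIV_cong_ev[THEN iffD1, rotated 3])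
        show "\<forall>\<^sub>F t in nhds x. B * b powr p + p * t * b powr (p - 1) = f t"
        proof (rule eventually_mono[OF eventually_nhds_in_open[of "{-b<..<b}" x]])
          fix t assume "t \<in> {-b<..<b}"
          then have "max \<bar>t\<bar> \<bar>b\<bar> = b" by auto
          then show "B * b powr p + p * t * b powr (p - 1) = f t"
            using b pw(1)[of b] by (simp add: f_def burkholder_def B_def)
        qed (use 3 in auto)
      qed auto
    qed
  qed
  have "f a + g a * (a + h - a) \<le> f (a + h)" for h
    by (rule supporting_line[OF cont _ \<open>mono g\<close> der, where K="{-b, b}"]) auto
  then show ?thesis
    by (intro exI[of _ "- g a"] allI) (simp add: f_def algebra_simps)
qed

text \<open>Negative b is reduced to positive b by central symmetry; on the axis b = 0 the function
  is a nonpositive multiple of the convex \<bar>a\<bar>^p.\<close>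

lemma burkholder_slope:
  fixes p a b :: real
  assumes p: "1 < p"
  shows "\<exists>s. \<forall>h. burkholder p (a + h) b \<le> burkholder p a b + h * s"
proof -
  consider "b > 0" | "b = 0" | "b < 0" by linarith
  then show ?thesis
  proof cases
    case 1 then show ?thesis by (rule burkholder_slope_pos[OF p])
  next
    case 2
    let ?s = "sgn a * (p * \<bar>a\<bar> powr (p - 1))"
    have "\<bar>p - 2\<bar> * (\<bar>a\<bar> powr p + ?s * h) \<le> \<bar>p - 2\<bar> * \<bar>a + h\<bar> powr p" for h
      using abs_powr_supporting_line[of p a "a + h"] p by (intro mult_left_mono) auto
    then show ?thesis
      using 2 by (intro exI[of _ "- \<bar>p - 2\<bar> * ?s"]) (simp add: burkholder_zero_right algebra_simps)
  next
    case 3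
    obtain s where s: "burkholder p (- a + h) (- b) \<le> burkholder p (- a) (- b) + h * s" for h
      using burkholder_slope_pos[OF p, of "- b" "- a"] 3 by auto
    have "burkholder p (a + h) b \<le> burkholder p a b + h * (- s)" for h
      using s[of "- h"] burkholder_uminus[of p "a + h" b] burkholder_uminus[of p a b] by simp
    then show ?thesis by blast
  qed
qed

text \<open>With m the larger of \<bar>a\<bar> and \<bar>b\<bar>, the product a b is at most m
  (\<bar>a + b\<bar> - m). So the function is at least (p - \<bar>p - 2\<bar>) m^p minus the mixed
  term p \<bar>a + b\<bar> m^(p-1), and half of the main term absorbs the mixed one. The main term
  is positive exactly for p > 1.\<close>

lemma burkholder_lower_bound:
  fixes p :: real
  assumes p: "1 < p"
  shows "\<exists>A C. 0 < A \<and> 0 < C \<and>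
    (\<forall>a b. A * \<bar>b\<bar> powr p - C * \<bar>a + b\<bar> powr p \<le> burkholder p a b)"
proof -
  define A where "A = (p - \<bar>p - 2\<bar>) / 2"
  \<comment> \<open>Fits the case p x > A m below: there m is at most (p / A) x, which turns the
    mixed term p x m^(p-1) into C x^p.\<close>
  define C where "C = p * (p / A) powr (p - 1)"
  have A: "0 < A" using p by (auto simp: A_def abs_if)
  have C: "0 < C" using A p by (simp add: C_def)
  have "A * \<bar>b\<bar> powr p - C * \<bar>a + b\<bar> powr p \<le> burkholder p a b" for a b
  proof -
    define m where "m = max \<bar>a\<bar> \<bar>b\<bar>"
    define x where "x = \<bar>a + b\<bar>"
    have m: "0 \<le> m" "\<bar>b\<bar> \<le> m" by (auto simp: m_def)
    have x: "0 \<le> x" by (simp add: x_def)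
    show ?thesis
    proof (cases "m = 0")
      case True
      then have "a = 0" "b = 0" by (auto simp: m_def max_def split: if_splits)
      then show ?thesis by (simp add: burkholder_def)
    next
      case False
      with m have m0: "0 < m" by simp
      have e: "m powr p = m * m powr (p - 1)" "m powr (p - 1) = m * m powr (p - 2)"
        using m0 by (simp_all add: powr_mult_base flip: powr_add)
      have "a * b \<le> m * (x - m)"
      proof (cases "0 \<le> a * b")
        case True
        have "\<bar>a\<bar> * \<bar>b\<bar> \<le> m * min \<bar>a\<bar> \<bar>b\<bar>"
          by (auto simp: m_def max_def min_def)
        moreover have "min \<bar>a\<bar> \<bar>b\<bar> = x - m"
          using True by (auto simp: m_def x_def zero_le_mult_iff abs_if max_def min_def)
        ultimately show ?thesis using True by (simp flip: abs_mult)
      next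
        case F: False
        then have x': "x = m - min \<bar>a\<bar> \<bar>b\<bar>"
          by (auto simp: m_def x_def zero_le_mult_iff abs_if max_def min_def)
        have "\<bar>a\<bar> * \<bar>b\<bar> = m * min \<bar>a\<bar> \<bar>b\<bar>"
          by (auto simp: m_def max_def min_def)
        then have "- (a * b) = m * min \<bar>a\<bar> \<bar>b\<bar>" using F by (simp flip: abs_mult)
        then show ?thesis by (simp add: x')
      qed
      then have "p * (a * b) * m powr (p - 2) \<le> p * (m * (x - m)) * m powr (p - 2)"
        using p by (intro mult_right_mono mult_left_mono) auto
      moreover have "p * (m * (x - m)) * m powr (p - 2) = p * x * m powr (p - 1) - p * m powr p"
        by (simp add: e algebra_simps)
      ultimately have w: "burkholder p a b \<ge> 2 * A * m powr p - p * x * m powr (p - 1)"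
      proof -
        have "2 * A * m powr p = p * m powr p - \<bar>p - 2\<bar> * m powr p"
          by (simp add: A_def field_simps)
        moreover have "burkholder p a b = - \<bar>p - 2\<bar> * m powr p - p * (a * b) * m powr (p - 2)"
          by (simp add: burkholder_def m_def)
        ultimately show ?thesis
          using \<open>p * (a * b) * m powr (p - 2) \<le> p * (m * (x - m)) * m powr (p - 2)\<close>
            \<open>p * (m * (x - m)) * m powr (p - 2) = p * x * m powr (p - 1) - p * m powr p\<close>
          by simp
      qed
      have "p * x * m powr (p - 1) \<le> A * m powr p + C * x powr p"
      proof (cases "p * x \<le> A * m")
        case True
        then have "p * x * m powr (p - 1) \<le> A * m * m powr (p - 1)"
          by (intro mult_right_mono) auto
        also have "\<dots> \<le> A * m powr p + C * x powr p" using C by (simp add: e)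
        finally show ?thesis .
      next
        case F: False
        then have "m \<le> p / A * x" using A by (simp add: field_simps)
        then have "m powr (p - 1) \<le> (p / A * x) powr (p - 1)"
          using p m0 by (intro powr_mono2) auto
        also have "\<dots> = (p / A) powr (p - 1) * x powr (p - 1)"
          using A p x by (subst powr_mult[symmetric]) auto
        finally have "p * x * m powr (p - 1) \<le> p * x * ((p / A) powr (p - 1) * x powr (p - 1))"
          using p x by (intro mult_left_mono) auto
        also have "\<dots> = C * x powr p"
          using x by (simp add: C_def powr_mult_base)
        also have "\<dots> \<le> A * m powr p + C * x powr p" using A by simp
        finally show ?thesis .
      qed
      with w have "A * m powr p - C * x powr p \<le> burkholder p a b" by linarith
      moreover have "A * \<bar>b\<bar> powr p \<le> A * m powr p"
        using A p m by (intro mult_left_mono powr_mono2) auto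
      ultimately show ?thesis by (simp add: x_def)
    qed
  qed
  with A C show ?thesis by blast
qed

text \<open>The ratio r is split as sqrt r * sqrt r: one factor sums to a constant, the other stays
  with the largest term. A maximum can be raised to the power q for q < 1 as well, and may then be
  replaced by a sum again; the Cauchy product with a geometric series finishes.\<close>

lemma discrete_hardy:
  fixes a b :: "nat \<Rightarrow> real" and q r :: real
  assumes q: "0 < q" and r: "0 < r" "r < 1" and a: "\<And>j. 0 \<le> a j" and b: "\<And>k. 0 \<le> b k"
    and le: "\<And>k. b k \<le> (\<Sum>j\<le>k. r ^ (k - j) * a j)"
    and sum: "summable (\<lambda>j. a j powr q)"
  defines "H \<equiv> (1 / (1 - sqrt r)) powr q * (1 / (1 - sqrt r powr q))"
  shows "summable (\<lambda>k. b k powr q) \<and> (\<Sum>k. b k powr q) \<le> H * (\<Sum>j. a j powr q)"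
proof -
  define s where "s = sqrt r"
  have s: "0 < s" "s < 1" "s * s = r" using r by (auto simp: s_def)
  define D where "D = 1 / (1 - s)"
  have D: "0 < D" using s by (simp add: D_def)
  have sq: "0 < s powr q" "s powr q < 1" using s q powr_less_mono2[of q s 1] by auto
  have bk: "b k powr q \<le> D powr q * (\<Sum>j\<le>k. a j powr q * (s powr q) ^ (k - j))" for k
  proof -
    define M where "M = Max ((\<lambda>j. s ^ (k - j) * a j) ` {..k})"
    have M: "s ^ (k - j) * a j \<le> M" if "j \<le> k" for j
      unfolding M_def using that by (intro Max_ge) auto
    have "M \<in> (\<lambda>j. s ^ (k - j) * a j) ` {..k}" unfolding M_def by (intro Max_in) auto
    then obtain i where i: "i \<le> k" "M = s ^ (k - i) * a i" by auto
    have M0: "0 \<le> M" using i s a by simp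
    have "b k \<le> (\<Sum>j\<le>k. s ^ (k - j) * (s ^ (k - j) * a j))"
      using le[of k] by (simp flip: s(3) add: power_mult_distrib mult_ac)
    also have "\<dots> \<le> (\<Sum>j\<le>k. s ^ (k - j) * M)"
      using s M by (intro sum_mono mult_left_mono) auto
    also have "\<dots> = (\<Sum>j\<le>k. s ^ j) * M"
      unfolding sum_distrib_right[symmetric]
      by (subst sum.nat_diff_reindex[of "\<lambda>j. s ^ j" "Suc k", unfolded lessThan_Suc_atMost, symmetric]) simp
    also have "\<dots> \<le> D * M"
    proof (rule mult_right_mono[OF _ M0])
      have "(\<Sum>j\<le>k. s ^ j) = (1 - s ^ Suc k) / (1 - s)"
        using s sum_gp_basic[of s k] by (simp add: field_simps)
      also have "\<dots> \<le> D" using s unfolding D_def by (intro divide_right_mono) auto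
      finally show "(\<Sum>j\<le>k. s ^ j) \<le> D" .
    qed
    finally have "b k powr q \<le> (D * M) powr q" using b q by (intro powr_mono2) auto
    also have "\<dots> = D powr q * (a i powr q * (s powr q) ^ (k - i))"
      using D M0 i s a by (simp add: powr_mult powr_power mult_ac powr_realpow[symmetric] powr_powr)
    also have "\<dots> \<le> D powr q * (\<Sum>j\<le>k. a j powr q * (s powr q) ^ (k - j))"
      using i by (intro mult_left_mono member_le_sum) auto
    finally show ?thesis .
  qed
  have geo: "summable (\<lambda>k. (s powr q) ^ k)" using sq by (intro summable_geometric) auto
  have geos: "(\<Sum>k. (s powr q) ^ k) = 1 / (1 - s powr q)" using sq by (intro suminf_geometric) auto
  have cp: "(\<lambda>k. \<Sum>j\<le>k. a j powr q * (s powr q) ^ (k - j)) sums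
      ((\<Sum>k. a k powr q) * (\<Sum>k. (s powr q) ^ k))"
    using sum geo by (intro Cauchy_product_sums) simp_all
  then have cp': "(\<lambda>k. D powr q * (\<Sum>j\<le>k. a j powr q * (s powr q) ^ (k - j))) sums
      (D powr q * ((\<Sum>k. a k powr q) * (\<Sum>k. (s powr q) ^ k)))"
    by (rule sums_mult)
  have S: "summable (\<lambda>k. b k powr q)"
    by (rule summable_comparison_test[OF _ sums_summable[OF cp']]) (use bk in auto)
  moreover have "(\<Sum>k. b k powr q) \<le> D powr q * ((\<Sum>k. a k powr q) * (\<Sum>k. (s powr q) ^ k))"
    using suminf_le[OF bk S sums_summable[OF cp']] sums_unique[OF cp'] by simp
  ultimately show ?thesis
    using geos unfolding H_def D_def s_def by (simp add: mult_ac)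
qed

section \<open>Lebesgue spaces\<close>

text \<open>Integrability is a separate predicate because the integral of a non-integrable function
  is 0 by convention, so that the value of \<open>lp_norm\<close> alone says nothing.\<close>

definition in_lp :: "'a measure \<Rightarrow> real \<Rightarrow> ('a \<Rightarrow> real) \<Rightarrow> bool" where
  "in_lp M p f \<longleftrightarrow> f \<in> borel_measurable M \<and> integrable M (\<lambda>x. \<bar>f x\<bar> powr p)"

definition lp_norm :: "'a measure \<Rightarrow> real \<Rightarrow> ('a \<Rightarrow> real) \<Rightarrow> real" where
  "lp_norm M p f = (\<integral>x. \<bar>f x\<bar> powr p \<partial>M) powr (1 / p)"

lemma in_lp_measurable: "in_lp M p f \<Longrightarrow> f \<in> borel_measurable M"
  by (simp add: in_lp_def)

lemma in_lp_integrable: "in_lp M p f \<Longrightarrow> integrable M (\<lambda>x. \<bar>f x\<bar> powr p)"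
  by (simp add: in_lp_def)

lemma lp_norm_nonneg [simp]: "0 \<le> lp_norm M p f"
  by (simp add: lp_norm_def)

lemma lp_norm_powr: "p \<noteq> 0 \<Longrightarrow> lp_norm M p f powr p = (\<integral>x. \<bar>f x\<bar> powr p \<partial>M)"
  by (simp add: lp_norm_def powr_powr)

lemma lp_norm_le_iff:
  assumes "0 < p" "0 \<le> B"
  shows "lp_norm M p f \<le> B \<longleftrightarrow> (\<integral>x. \<bar>f x\<bar> powr p \<partial>M) \<le> B powr p"
proof -
  have "lp_norm M p f \<le> B \<longleftrightarrow> lp_norm M p f powr p \<le> B powr p"
    using assms by (meson lp_norm_nonneg not_le powr_less_mono2 powr_mono2 less_imp_le)
  then show ?thesis using assms by (simp add: lp_norm_powr)
qed

lemma in_lp_bound: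
  assumes "0 < p" "in_lp M p g" "f \<in> borel_measurable M" "AE x in M. \<bar>f x\<bar> \<le> \<bar>g x\<bar>"
  shows "in_lp M p f"
  unfolding in_lp_def
proof
  note [measurable] = assms(3)
  show "integrable M (\<lambda>x. \<bar>f x\<bar> powr p)"
    by (rule Bochner_Integration.integrable_bound[OF in_lp_integrable[OF assms(2)]])
       (use assms in \<open>auto elim!: eventually_mono intro!: powr_mono2\<close>)
qed (rule assms)

lemma lp_norm_mono:
  assumes "0 < p" "in_lp M p g" "f \<in> borel_measurable M" "AE x in M. \<bar>f x\<bar> \<le> \<bar>g x\<bar>"
  shows "lp_norm M p f \<le> lp_norm M p g"
  unfolding lp_norm_def
  using in_lp_bound[OF assms] assms
  by (intro powr_mono2 integral_mono_AE) (auto simp: in_lp_def elim!: eventually_mono intro!: powr_mono2)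

lemma lp_norm_cong_AE:
  assumes "f \<in> borel_measurable M" "g \<in> borel_measurable M" "AE x in M. f x = g x"
  shows "lp_norm M p f = lp_norm M p g"
proof -
  note [measurable] = assms(1,2)
  show ?thesis
    unfolding lp_norm_def using assms(3)
    by (intro arg_cong[where f="\<lambda>x. x powr (1 / p)"] integral_cong_AE) auto
qed

lemma lp_norm_abs [simp]: "lp_norm M p (\<lambda>x. \<bar>f x\<bar>) = lp_norm M p f"
  by (simp add: lp_norm_def)

lemma in_lp_abs: "in_lp M p f \<Longrightarrow> in_lp M p (\<lambda>x. \<bar>f x\<bar>)"
  by (auto simp: in_lp_def)

lemma in_lp_cmult: "in_lp M p f \<Longrightarrow> in_lp M p (\<lambda>x. c * f x)"
  by (auto simp: in_lp_def abs_mult powr_mult)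

lemma lp_norm_cmult: "0 < p \<Longrightarrow> lp_norm M p (\<lambda>x. c * f x) = \<bar>c\<bar> * lp_norm M p f"
  by (simp add: lp_norm_def abs_mult powr_mult powr_powr)

lemma in_lp_add:
  assumes "0 < p" "in_lp M p f" "in_lp M p g"
  shows "in_lp M p (\<lambda>x. f x + g x)"
  unfolding in_lp_def
proof
  note [measurable] = in_lp_measurable[OF assms(2)] in_lp_measurable[OF assms(3)]
  show "(\<lambda>x. f x + g x) \<in> borel_measurable M" by simp
  have "integrable M (\<lambda>x. 2 powr p * (\<bar>f x\<bar> powr p + \<bar>g x\<bar> powr p))"
    using assms by (auto simp: in_lp_def)
  then show "integrable M (\<lambda>x. \<bar>f x + g x\<bar> powr p)"
    by (rule Bochner_Integration.integrable_bound)
       (use assms(1) powr_abs_add_le in \<open>auto intro!: AE_I2\<close>)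
qed

lemma in_lp_diff:
  assumes "0 < p" "in_lp M p f" "in_lp M p g"
  shows "in_lp M p (\<lambda>x. f x - g x)"
  using in_lp_add[OF assms(1,2) in_lp_cmult[OF assms(3), of "-1"]] by simp

lemma in_lp_zero [simp]: "0 < p \<Longrightarrow> in_lp M p (\<lambda>_. 0)"
  by (simp add: in_lp_def)

lemma lp_norm_zero [simp]: "0 < p \<Longrightarrow> lp_norm M p (\<lambda>_. 0) = 0"
  by (simp add: lp_norm_def)

lemma in_lp_sum:
  assumes "0 < p" "\<And>i. i \<in> I \<Longrightarrow> in_lp M p (f i)"
  shows "in_lp M p (\<lambda>x. \<Sum>i\<in>I. f i x)"
  using assms(2)
proof (induction I rule: infinite_finite_induct)
  case (insert i I)
  then show ?case by (simp add: in_lp_add[OF assms(1)])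
qed (use assms(1) in auto)

lemma lp_norm_eq_0_AE:
  assumes "0 < p" "in_lp M p f" "lp_norm M p f = 0"
  shows "AE x in M. f x = 0"
proof -
  have "(\<integral>x. \<bar>f x\<bar> powr p \<partial>M) = 0"
    using assms lp_norm_powr[of p M f] by simp
  then have "AE x in M. \<bar>f x\<bar> powr p = 0"
    using in_lp_integrable[OF assms(2)] by (subst (asm) integral_nonneg_eq_0_iff_AE) auto
  then show ?thesis by simp
qed

text \<open>By homogeneity: (f + g) / (a + b) is the convex combination of f / a and g / b with
  weights a / s and b / s, and both have norm 1. The divisions force the two cases of a vanishing
  norm.\<close>

lemma lp_norm_triangle:
  assumes p: "1 \<le> p" and f: "in_lp M p f" and g: "in_lp M p g"
  shows "lp_norm M p (\<lambda>x. f x + g x) \<le> lp_norm M p f + lp_norm M p g"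
proof -
  note [measurable] = in_lp_measurable[OF f] in_lp_measurable[OF g]
  define a b where "a = lp_norm M p f" and "b = lp_norm M p g"
  have ab: "0 \<le> a" "0 \<le> b" by (auto simp: a_def b_def)
  have p0: "0 < p" using p by simp
  consider "a = 0" | "b = 0" | "0 < a" "0 < b" using ab by linarith
  then show ?thesis
  proof cases
    case 1
    then have "AE x in M. f x = 0" using lp_norm_eq_0_AE[OF p0 f] by (simp add: a_def)
    then have "lp_norm M p (\<lambda>x. f x + g x) = lp_norm M p g"
      by (intro lp_norm_cong_AE) auto
    then show ?thesis by simp
  next
    case 2
    then have "AE x in M. g x = 0" using lp_norm_eq_0_AE[OF p0 g] by (simp add: b_def)
    then have "lp_norm M p (\<lambda>x. f x + g x) = lp_norm M p f"
      by (intro lp_norm_cong_AE) auto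
    then show ?thesis by simp
  next
    case 3
    define s where "s = a + b"
    have s: "0 < s" using 3 by (simp add: s_def)
    have pw: "\<bar>f x + g x\<bar> powr p
        \<le> s powr p * (a / s * (\<bar>f x\<bar> powr p / a powr p) + b / s * (\<bar>g x\<bar> powr p / b powr p))" for x
    proof -
      have "f x + g x = s * (a / s * (f x / a) + b / s * (g x / b))"
        using 3 s by (simp add: field_simps)
      then have "\<bar>f x + g x\<bar> powr p = s powr p * \<bar>a / s * (f x / a) + b / s * (g x / b)\<bar> powr p"
        using s by (simp add: abs_mult powr_mult)
      also have "\<dots> \<le> s powr p * (a / s * \<bar>f x / a\<bar> powr p + b / s * \<bar>g x / b\<bar> powr p)"
        using p s 3 by (intro mult_left_mono abs_powr_convex_comb)
          (auto simp: s_def add_divide_distrib[symmetric])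
      finally show ?thesis using 3 by (simp add: powr_divide abs_divide)
    qed
    have "(\<integral>x. \<bar>f x + g x\<bar> powr p \<partial>M)
      \<le> (\<integral>x. s powr p * (a / s * (\<bar>f x\<bar> powr p / a powr p) + b / s * (\<bar>g x\<bar> powr p / b powr p)) \<partial>M)"
      using in_lp_add[OF p0 f g] f g pw by (intro integral_mono) (auto simp: in_lp_def)
    also have "\<dots> = s powr p * (a / s * ((\<integral>x. \<bar>f x\<bar> powr p \<partial>M) / a powr p)
         + b / s * ((\<integral>x. \<bar>g x\<bar> powr p \<partial>M) / b powr p))"
      using f g by (simp add: in_lp_def)
    also have "\<dots> = s powr p * (a / s + b / s)"
    proof -
      have "(\<integral>x. \<bar>f x\<bar> powr p \<partial>M) = a powr p" "(\<integral>x. \<bar>g x\<bar> powr p \<partial>M) = b powr p"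
        using p0 by (simp_all add: a_def b_def lp_norm_powr)
      with 3 show ?thesis by simp
    qed
    also have "a / s + b / s = 1"
      using s by (simp add: s_def add_divide_distrib[symmetric])
    also have "s powr p * 1 = s powr p" by simp
    finally have "(\<integral>x. \<bar>f x + g x\<bar> powr p \<partial>M) \<le> s powr p" .
    then show ?thesis using s p0 by (subst lp_norm_le_iff) (auto simp: s_def a_def b_def)
  qed
qed

lemma lp_norm_triangle_diff:
  assumes "1 \<le> p" "in_lp M p f" "in_lp M p g"
  shows "lp_norm M p (\<lambda>x. f x - g x) \<le> lp_norm M p f + lp_norm M p g"
  using lp_norm_triangle[OF assms(1,2) in_lp_cmult[OF assms(3), of "-1"]] assms
  by (simp add: lp_norm_cmult[of p M "-1" g, simplified])

lemma lp_norm_sum: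
  assumes "1 \<le> p" "\<And>i. i \<in> I \<Longrightarrow> in_lp M p (f i)"
  shows "lp_norm M p (\<lambda>x. \<Sum>i\<in>I. f i x) \<le> (\<Sum>i\<in>I. lp_norm M p (f i))"
  using assms(2)
proof (induction I rule: infinite_finite_induct)
  case (insert i I)
  have "lp_norm M p (\<lambda>x. f i x + (\<Sum>i\<in>I. f i x)) \<le> lp_norm M p (f i) + lp_norm M p (\<lambda>x. \<Sum>i\<in>I. f i x)"
    using insert assms(1) by (intro lp_norm_triangle in_lp_sum) auto
  with insert show ?case by simp
qed (use assms(1) in auto)

text \<open>The supporting line at the mean z is integrated over A, where its linear part
  cancels.\<close>

lemma integral_jensen_powr:
  fixes f :: "'a \<Rightarrow> real"
  assumes p: "1 \<le> p" and A: "A \<in> sets M" and m: "emeasure M A = ennreal m" "0 < m"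
    and f: "integrable M f" "integrable M (\<lambda>x. \<bar>f x\<bar> powr p)"
  shows "\<bar>(\<integral>x. indicator A x * f x \<partial>M) / m\<bar> powr p \<le> (\<integral>x. indicator A x * \<bar>f x\<bar> powr p \<partial>M) / m"
proof -
  define z where "z = (\<integral>x. indicator A x * f x \<partial>M) / m"
  define s where "s = sgn z * (p * \<bar>z\<bar> powr (p - 1))"
  have iA: "integrable M (\<lambda>x. indicator A x * g x)" if "integrable M g" for g :: "'a \<Rightarrow> real"
    using integrable_mult_indicator[OF A that] by simp
  have i1: "integrable M (indicator A :: 'a \<Rightarrow> real)"
    using A m by (simp add: integrable_indicator_iff)
  have mA: "(\<integral>x. indicator A x \<partial>M) = m"
    using A m by (simp add: measure_def)
  have "(\<integral>x. (\<bar>z\<bar> powr p - s * z) * indicator A x + s * (indicator A x * f x) \<partial>M)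
     \<le> (\<integral>x. indicator A x * \<bar>f x\<bar> powr p \<partial>M)"
  proof (rule integral_mono)
    show "integrable M (\<lambda>x. (\<bar>z\<bar> powr p - s * z) * indicator A x + s * (indicator A x * f x))"
      using i1 iA[OF f(1)] by simp
    show "integrable M (\<lambda>x. indicator A x * \<bar>f x\<bar> powr p)" by (rule iA[OF f(2)])
    fix x
    show "(\<bar>z\<bar> powr p - s * z) * indicator A x + s * (indicator A x * f x) \<le> indicator A x * \<bar>f x\<bar> powr p"
      using abs_powr_supporting_line[OF p, of z "f x"]
      by (cases "x \<in> A") (auto simp: s_def algebra_simps)
  qed
  also have "(\<integral>x. (\<bar>z\<bar> powr p - s * z) * indicator A x + s * (indicator A x * f x) \<partial>M)
     = (\<bar>z\<bar> powr p - s * z) * m + s * (m * z)"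
    using i1 iA[OF f(1)] mA m by (simp add: z_def)
  finally have "m * \<bar>z\<bar> powr p \<le> (\<integral>x. indicator A x * \<bar>f x\<bar> powr p \<partial>M)"
    by (simp add: algebra_simps)
  then show ?thesis using m unfolding z_def[symmetric] by (simp add: pos_le_divide_eq mult.commute)
qed

section \<open>Dyadic grids and Walsh functions\<close>

lemma measurable_vec_nth [measurable]: "(\<lambda>x::real^'d. x $ i) \<in> borel_measurable borel"
  by (intro borel_measurable_continuous_onI continuous_intros)

lemma emeasure_half_open_box:
  fixes a b :: "real ^ 'd"
  assumes "\<And>l. a $ l \<le> b $ l"
  shows "{y. \<forall>l. a $ l \<le> y $ l \<and> y $ l < b $ l} \<in> sets borel"
    and "emeasure lborel {y. \<forall>l. a $ l \<le> y $ l \<and> y $ l < b $ l} = ennreal (\<Prod>l\<in>UNIV. b $ l - a $ l)"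
proof -
  let ?S = "{y. \<forall>l. a $ l \<le> y $ l \<and> y $ l < b $ l}"
  have S: "?S = {y \<in> space borel. \<forall>l\<in>UNIV. a $ l \<le> y $ l \<and> y $ l < b $ l}" by simp
  show meas: "?S \<in> sets borel" unfolding S by measurable
  have le: "\<forall>i\<in>Basis. a \<bullet> i \<le> b \<bullet> i"
    using assms by (auto simp: Basis_vec_def inner_axis)
  have pr: "(\<Prod>i\<in>Basis. (b - a) \<bullet> i) = (\<Prod>l\<in>UNIV. b $ l - a $ l)"
  proof -
    have inj: "inj (\<lambda>l::'d. axis l (1::real))" by (auto simp: inj_def axis_eq_axis)
    have B: "(Basis :: (real^'d) set) = range (\<lambda>l. axis l 1)" by (auto simp: Basis_vec_def)
    show ?thesis unfolding B by (subst prod.reindex[OF inj]) (simp add: inner_axis)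
  qed
  have "emeasure lborel (box a b) \<le> emeasure lborel ?S"
    using meas by (intro emeasure_mono) (auto simp: mem_box_cart less_imp_le)
  moreover have "emeasure lborel ?S \<le> emeasure lborel (cbox a b)"
    using meas by (intro emeasure_mono) (auto simp: mem_box_cart less_imp_le)
  moreover have "emeasure lborel (box a b) = emeasure lborel (cbox a b)"
    by (simp add: emeasure_lborel_box_eq emeasure_lborel_cbox_eq)
  moreover have "emeasure lborel (cbox a b) = ennreal (\<Prod>l\<in>UNIV. b $ l - a $ l)"
    using le by (simp add: emeasure_lborel_cbox_eq pr)
  ultimately show "emeasure lborel ?S = ennreal (\<Prod>l\<in>UNIV. b $ l - a $ l)" by simp
qed

lemma nn_integral_lborel_translate:
  fixes f :: "'a::euclidean_space \<Rightarrow> ennreal"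
  assumes [measurable]: "f \<in> borel_measurable borel"
  shows "(\<integral>\<^sup>+x. f (x + c) \<partial>lborel) = (\<integral>\<^sup>+x. f x \<partial>lborel)"
  by (subst (2) lborel_distr_plus[symmetric, of c]) (simp add: nn_integral_distr add.commute)

lemma integral_lborel_translate:
  fixes f :: "'a::euclidean_space \<Rightarrow> real"
  assumes [measurable]: "f \<in> borel_measurable borel"
  shows "(\<integral>x. f (x + c) \<partial>lborel) = (\<integral>x. f x \<partial>lborel)"
  by (subst (2) lborel_distr_plus[symmetric, of c]) (simp add: integral_distr add.commute)

lemma integrable_lborel_translate:
  fixes f :: "'a::euclidean_space \<Rightarrow> real"
  assumes "integrable lborel f"
  shows "integrable lborel (\<lambda>x. f (x + c))"
proof -
  have "integrable (distr lborel borel ((+) c)) f" using assms by (simp add: lborel_distr_plus)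
  then show ?thesis by (subst (asm) integrable_distr_eq) (use assms in \<open>auto simp: add.commute\<close>)
qed

section \<open>Dyadic cells and step functions\<close>

definition half_open_cube :: "(real ^ 'd) set" where
  "half_open_cube = {x. \<forall>l. 0 \<le> x $ l \<and> x $ l < 1}"

definition grid :: "nat \<Rightarrow> real ^ 'd \<Rightarrow> 'd \<Rightarrow> int" where
  "grid k x = (\<lambda>l. \<lfloor>2 ^ k * x $ l\<rfloor>)"

definition cell :: "nat \<Rightarrow> real ^ 'd \<Rightarrow> (real ^ 'd) set" where
  "cell k x = {y. grid k y = grid k x}"

definition cellwise :: "nat \<Rightarrow> (real ^ 'd \<Rightarrow> 'a) \<Rightarrow> bool" where
  "cellwise k g \<longleftrightarrow> (\<forall>x y. grid k x = grid k y \<longrightarrow> g x = g y)"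

text \<open>Measurability and integrability are automatic for such functions, even if their values
  come from a choice operator, as those of the slopes of Burkholder's function do later.\<close>

definition step :: "nat \<Rightarrow> (real ^ 'd \<Rightarrow> real) \<Rightarrow> bool" where
  "step k g \<longleftrightarrow> cellwise k g \<and> (\<forall>x. x \<notin> half_open_cube \<longrightarrow> g x = 0)"

lemma floor_half: "\<lfloor>2 ^ k * t\<rfloor> = \<lfloor>2 ^ Suc k * t\<rfloor> div 2" for t :: real
  using floor_divide_real_eq_div[of 2 "2 ^ Suc k * t"] by simp

lemma grid_Suc: "grid k x l = grid (Suc k) x l div 2"
  by (simp add: grid_def floor_half[of k])

lemma grid_mono:
  assumes "j \<le> k" "grid k x = grid k y"
  shows "grid j x = grid j y"
  using assms
proof (induction rule: inc_induct)
  case (step n)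
  then show ?case by (intro ext) (simp add: grid_Suc[of n])
qed

text \<open>The half-open cube is a union of cells at every level k, which is the reason for working
  with it instead of \<open>unit_cube\<close>.\<close>

lemma half_open_cube_iff: "x \<in> half_open_cube \<longleftrightarrow> (\<forall>l. grid k x l \<in> {0..<2 ^ k})"
proof -
  have "(0 \<le> t \<and> t < 1) \<longleftrightarrow> (0 \<le> \<lfloor>2 ^ k * t\<rfloor> \<and> \<lfloor>2 ^ k * t\<rfloor> < 2 ^ k)" for t :: real
    using mult_le_cancel_left_pos[of "2 ^ k" 0 t] by (simp add: floor_less_iff)
  then show ?thesis by (simp add: half_open_cube_def grid_def)
qed

lemma grid_half_open_cube: "grid k x = grid k y \<Longrightarrow> x \<in> half_open_cube \<longleftrightarrow> y \<in> half_open_cube"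
  by (simp add: half_open_cube_iff[of _ k])

lemma measurable_grid [measurable]: "(grid k :: real ^ 'd \<Rightarrow> _) \<in> borel \<rightarrow>\<^sub>M count_space UNIV"
proof (subst measurable_count_space_eq2_countable)
  have "grid k -` {v} \<inter> space borel \<in> sets (borel :: (real ^ 'd) measure)" for v
  proof -
    have "grid k -` {v} \<inter> space borel = {x::real^'d \<in> space borel. \<forall>l\<in>UNIV. \<lfloor>2 ^ k * x $ l\<rfloor> = v l}"
      by (auto simp: grid_def)
    also have "\<dots> \<in> sets borel" by measurable
    finally show ?thesis .
  qed
  then show "(grid k :: real ^ 'd \<Rightarrow> _) \<in> space borel \<rightarrow> UNIV \<and>
      (\<forall>a\<in>UNIV. grid k -` {a} \<inter> space (borel :: (real ^ 'd) measure) \<in> sets borel)"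
    by blast
qed

lemma cell_halfopen:
  "cell k x = {y. \<forall>l. (\<chi> l. real_of_int (grid k x l) / 2 ^ k) $ l \<le> y $ l \<and>
      y $ l < (\<chi> l. (real_of_int (grid k x l) + 1) / 2 ^ k) $ l}"
proof -
  have "grid k y = grid k x \<longleftrightarrow> (\<forall>l. real_of_int (grid k x l) / 2 ^ k \<le> y $ l \<and>
      y $ l < (real_of_int (grid k x l) + 1) / 2 ^ k)" for y
  proof -
    have "grid k y = grid k x \<longleftrightarrow> (\<forall>l. \<lfloor>2 ^ k * y $ l\<rfloor> = grid k x l)"
      by (auto simp: grid_def fun_eq_iff)
    then show ?thesis
      by (simp add: floor_eq_iff pos_divide_le_eq pos_less_divide_eq mult.commute)
  qed
  then show ?thesis by (simp add: cell_def)
qed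

lemma cell_sets [measurable]: "cell k x \<in> sets borel"
  unfolding cell_halfopen by (rule emeasure_half_open_box) (simp add: divide_right_mono)

lemma emeasure_cell: "emeasure lborel (cell k (x :: real ^ 'd)) = ennreal (1 / 2 ^ (k * CARD('d)))"
  unfolding cell_halfopen
  by (subst emeasure_half_open_box) (auto simp: divide_right_mono diff_divide_distrib[symmetric] power_mult power_divide)

lemma half_open_cube_eq_cell: "(half_open_cube :: (real ^ 'd) set) = cell 0 0"
  by (auto simp: half_open_cube_def cell_halfopen grid_def)

lemma half_open_cube_sets [measurable]: "half_open_cube \<in> sets borel"
  unfolding half_open_cube_eq_cell by simp

lemma emeasure_half_open_cube: "emeasure lborel (half_open_cube :: (real ^ 'd) set) = 1"
  unfolding half_open_cube_eq_cell by (subst emeasure_cell) simp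

lemma cellwiseD: "cellwise k g \<Longrightarrow> grid k x = grid k y \<Longrightarrow> g x = g y"
  unfolding cellwise_def by blast

lemma cellwise_mono: "cellwise j g \<Longrightarrow> j \<le> k \<Longrightarrow> cellwise k g"
  unfolding cellwise_def using grid_mono by blast

text \<open>Such a function factors through \<open>grid k\<close>, which takes only countably many
  values; \<open>G\<close> picks a representative point for each of them.\<close>

lemma cellwise_measurable:
  fixes g :: "real ^ 'd \<Rightarrow> 'a::topological_space"
  assumes "cellwise k g"
  shows "g \<in> borel_measurable borel"
proof -
  define G where "G v = g (SOME x. grid k x = v)" for v
  have "g x = G (grid k x)" for x
    unfolding G_def by (rule cellwiseD[OF assms]) (metis (mono_tags) someI_ex)
  then have "g = (\<lambda>x. G (grid k x))" by (intro ext)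
  moreover have "(\<lambda>x. G (grid k x)) \<in> borel_measurable borel"
    by (rule measurable_compose[OF measurable_grid]) simp
  ultimately show ?thesis by simp
qed

lemma stepD: "step k g \<Longrightarrow> grid k x = grid k y \<Longrightarrow> g x = g y"
  unfolding step_def using cellwiseD by blast

lemma step_cellwise: "step k g \<Longrightarrow> cellwise k g"
  by (simp add: step_def)

lemma step_outside: "step k g \<Longrightarrow> x \<notin> half_open_cube \<Longrightarrow> g x = 0"
  by (simp add: step_def)

lemma stepI: "(\<And>x y. grid k x = grid k y \<Longrightarrow> g x = g y) \<Longrightarrow> (\<And>x. x \<notin> half_open_cube \<Longrightarrow> g x = 0) \<Longrightarrow> step k g"
  unfolding step_def cellwise_def by blast

lemma step_mono: "step j g \<Longrightarrow> j \<le> k \<Longrightarrow> step k g"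
  by (auto simp: step_def intro: cellwise_mono)

lemma step_measurable: "step k g \<Longrightarrow> g \<in> borel_measurable borel"
  by (rule cellwise_measurable[OF step_cellwise])

lemma finite_grid_image: "finite (grid k ` half_open_cube)"
proof (rule finite_subset)
  show "grid k ` half_open_cube \<subseteq> (UNIV \<rightarrow>\<^sub>E {0..<2 ^ k})"
    by (auto simp: half_open_cube_iff[of _ k])
qed (auto intro: finite_PiE)

lemma step_finite_range:
  assumes "step k g"
  shows "finite (range g)"
proof (rule finite_subset)
  show "range g \<subseteq> insert 0 ((\<lambda>v. g (SOME x. grid k x = v)) ` (grid k ` half_open_cube))"
  proof
    fix t assume "t \<in> range g"
    then obtain x where x: "t = g x" by auto
    have "g (SOME y. grid k y = grid k x) = g x"
      by (rule stepD[OF assms]) (metis (mono_tags) someI_ex)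
    then show "t \<in> insert 0 ((\<lambda>v. g (SOME x. grid k x = v)) ` (grid k ` half_open_cube))"
      using step_outside[OF assms, of x] unfolding x image_image by (metis (no_types, lifting) image_eqI insertCI)
  qed
qed (use finite_grid_image in auto)

lemma step_bounded:
  assumes "step k g"
  obtains B where "\<And>x. \<bar>g x\<bar> \<le> B"
proof -
  have "bdd_above (abs ` range g)" using step_finite_range[OF assms] by (intro bdd_above_finite) auto
  then obtain B where "\<forall>y\<in>abs ` range g. y \<le> B" unfolding bdd_above_def by blast
  then show thesis using that[of B] by auto
qed

lemma step_integrable:
  fixes g :: "real ^ 'd \<Rightarrow> real"
  assumes "step k g"
  shows "integrable lborel g"
proof -
  obtain B where B: "\<And>x. \<bar>g x\<bar> \<le> B" using step_bounded[OF assms] by blast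
  have "integrable lborel (\<lambda>x::real^'d. B * indicator half_open_cube x)"
    by (auto simp: integrable_indicator_iff emeasure_half_open_cube)
  then show ?thesis
  proof (rule Bochner_Integration.integrable_bound)
    show "AE x in lborel. norm (g x) \<le> norm (B * indicator half_open_cube x)"
      using B step_outside[OF assms] by (auto intro!: AE_I2 simp: indicator_def intro: order_trans[OF B abs_ge_self])
  qed (use step_measurable[OF assms] in auto)
qed

section \<open>Walsh characters of one level and the averages over cells\<close>

definition rademacher :: "nat \<Rightarrow> real \<Rightarrow> real" where
  "rademacher k t = (if even \<lfloor>2 ^ Suc k * t\<rfloor> then 1 else -1)"

text \<open>These are the characters of the group (Z/2)^d on the 2^d subcells of a cell of level k.
  Cut down to one cell, a character with nonempty e is a Haar function of level k + 1.\<close>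

definition walsh :: "nat \<Rightarrow> 'd set \<Rightarrow> real ^ 'd \<Rightarrow> real" where
  "walsh k e x = (\<Prod>l\<in>e. rademacher k (x $ l))"

text \<open>Being a function of x, it records the Haar coefficients of type e on all cells of level
  k at once. The empty type gives the conditional expectation, abbreviated \<open>avg\<close>
  below.\<close>

definition walsh_coeff :: "nat \<Rightarrow> 'd set \<Rightarrow> (real ^ 'd \<Rightarrow> real) \<Rightarrow> real ^ 'd \<Rightarrow> real" where
  "walsh_coeff k e f x = 2 ^ (k * CARD('d)) * (\<integral>y. indicator (cell k x) y * (walsh k e y * f y) \<partial>lborel)"

abbreviation avg :: "nat \<Rightarrow> (real ^ 'd \<Rightarrow> real) \<Rightarrow> real ^ 'd \<Rightarrow> real" where
  "avg k \<equiv> walsh_coeff k {}"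

lemma walsh_empty [simp]: "walsh k {} x = 1"
  by (simp add: walsh_def)

lemma rademacher_abs [simp]: "\<bar>rademacher k t\<bar> = 1"
  by (simp add: rademacher_def)

lemma walsh_abs [simp]: "\<bar>walsh k e x\<bar> = 1"
  by (simp add: walsh_def abs_prod)

lemma walsh_cases: "walsh k e x = 1 \<or> walsh k e x = -1"
  using walsh_abs[of k e x] by linarith

lemma walsh_square [simp]: "walsh k e x * walsh k e x = 1"
  using walsh_cases[of k e x] by auto

lemma walsh_mult:
  fixes e e' :: "('d::finite) set"
  shows "walsh k e x * walsh k e' x = walsh k ((e - e') \<union> (e' - e)) x"
proof -
  have "walsh k e x = walsh k (e - e') x * walsh k (e \<inter> e') x"
    unfolding walsh_def by (subst prod.union_disjoint[symmetric]) (auto intro: prod.cong)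
  moreover have "walsh k e' x = walsh k (e' - e) x * walsh k (e \<inter> e') x"
    unfolding walsh_def by (subst prod.union_disjoint[symmetric]) (auto intro: prod.cong)
  moreover have "walsh k (e - e') x * walsh k (e' - e) x = walsh k ((e - e') \<union> (e' - e)) x"
    unfolding walsh_def by (subst prod.union_disjoint[symmetric]) auto
  moreover have "(a * c) * (b * c) = a * b" if "c * c = 1" for a b c :: real
    using that by (simp add: mult_ac)
  ultimately show ?thesis
    using walsh_square[of k "e \<inter> e'" x] by metis
qed

lemma cellwise_walsh: "cellwise (Suc k) (walsh k e)"
  unfolding cellwise_def walsh_def rademacher_def grid_def
  by (auto intro!: prod.cong simp: fun_eq_iff simp del: power_Suc)

lemma walsh_measurable [measurable]: "walsh k e \<in> borel_measurable borel"
  by (rule cellwise_measurable[OF cellwise_walsh])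

lemma integrable_bounded_mult:
  fixes f :: "real ^ 'd \<Rightarrow> real"
  assumes "integrable lborel f" "\<And>x. \<bar>g x\<bar> \<le> 1" "g \<in> borel_measurable borel"
  shows "integrable lborel (\<lambda>x. g x * f x)"
proof (rule Bochner_Integration.integrable_bound[OF assms(1)])
  show "AE x in lborel. norm (g x * f x) \<le> norm (f x)"
    using assms(2) by (auto intro!: AE_I2 simp: abs_mult mult_left_le_one_le)
qed (use assms in auto)

text \<open>Swapping the two halves of every cell in a direction \<open>l \<in> e\<close> changes the sign of the
  integrand.\<close>

lemma integral_cellwise_walsh:
  fixes g :: "real ^ 'd \<Rightarrow> real"
  assumes g: "cellwise k g" "integrable lborel g" and e: "e \<noteq> {}"
  shows "(\<integral>x. g x * walsh k e x \<partial>lborel) = 0"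
proof -
  obtain l where l: "l \<in> e" using e by auto
  define c :: "real ^ 'd" where "c = axis l (1 / 2 ^ Suc k)"
  define F where "F x = g x * walsh k e x" for x
  define R where "R x = rademacher k (x $ l)" for x :: "real ^ 'd"
  define lo where "lo x = (if R x = 1 then F x else 0)" for x
  define hi where "hi x = (if R x = 1 then 0 else F x)" for x
  note [measurable] = cellwise_measurable[OF g(1)]
  have fl: "\<lfloor>2 ^ Suc k * (t + 1 / 2 ^ Suc k)\<rfloor> = \<lfloor>2 ^ Suc k * t\<rfloor> + 1" for t :: real
  proof -
    have "2 ^ Suc k * (t + 1 / 2 ^ Suc k) = 2 ^ Suc k * t + 1" by (simp add: distrib_left)
    then show ?thesis by (simp only:) simp
  qed
  have R: "R (x + c) = - R x" for x
    unfolding R_def c_def rademacher_def by (simp add: axis_def fl del: power_Suc)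
  \<comment> \<open>Only from the lower half does the shift by \<open>c\<close> stay inside the
    cell; hence the decomposition into \<open>lo\<close> and \<open>hi\<close>.\<close>
  have F: "F (x + c) = - F x" if "R x = 1" for x
  proof -
    have "grid k (x + c) i = grid k x i" for i
    proof (cases "i = l")
      case True
      have "grid (Suc k) (x + c) l = grid (Suc k) x l + 1"
        unfolding grid_def c_def by (simp add: axis_def fl del: power_Suc)
      moreover have "even (grid (Suc k) x l)"
        using that by (auto simp: R_def rademacher_def grid_def split: if_splits)
      ultimately show ?thesis unfolding True grid_Suc[of k] by (elim evenE) simp
    qed (simp add: grid_def c_def axis_def)
    then have "g (x + c) = g x" by (intro cellwiseD[OF g(1)] ext)
    moreover have "walsh k e (x + c) = - walsh k e x"
    proof -
      have "walsh k e y = R y * (\<Prod>i\<in>e - {l}. rademacher k (y $ i))" for y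
        unfolding walsh_def R_def using l by (subst prod.remove) auto
      moreover have "(\<Prod>i\<in>e - {l}. rademacher k ((x + c) $ i)) = (\<Prod>i\<in>e - {l}. rademacher k (x $ i))"
        by (intro prod.cong) (auto simp: c_def axis_def)
      ultimately show ?thesis by (simp add: R)
    qed
    ultimately show ?thesis by (simp add: F_def)
  qed
  have Fint: "integrable lborel F"
    unfolding F_def using integrable_bounded_mult[OF g(2), of "walsh k e"] by (simp add: mult.commute)
  have [measurable]: "R \<in> borel_measurable borel" "F \<in> borel_measurable borel"
    unfolding R_def F_def rademacher_def by measurable
  have [measurable]: "lo \<in> borel_measurable borel" "hi \<in> borel_measurable borel"
    unfolding lo_def hi_def by measurable
  have i: "integrable lborel lo" "integrable lborel hi"
    by (rule Bochner_Integration.integrable_bound[OF Fint]; simp add: lo_def hi_def)+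
  have "hi (x + c) = - lo x" for x
  proof -
    have "R x = 1 \<or> R x = -1" unfolding R_def rademacher_def by simp
    then show ?thesis using R[of x] F[of x] by (auto simp: hi_def lo_def)
  qed
  then have "(\<integral>x. hi x \<partial>lborel) = - (\<integral>x. lo x \<partial>lborel)"
    using integral_lborel_translate[of hi c] by simp
  moreover have "(\<integral>x. F x \<partial>lborel) = (\<integral>x. lo x + hi x \<partial>lborel)"
    by (intro Bochner_Integration.integral_cong) (auto simp: lo_def hi_def)
  ultimately show ?thesis using i by (simp add: F_def[symmetric])
qed

lemma cell_cong: "grid k x = grid k y \<Longrightarrow> cell k x = cell k y"
  by (simp add: cell_def)

lemma walsh_coeff_cellwise: "cellwise k (walsh_coeff k e f)"
  by (auto simp: cellwise_def walsh_coeff_def dest: cell_cong)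

lemma walsh_coeff_step:
  fixes f :: "real ^ 'd \<Rightarrow> real"
  assumes "\<And>x. x \<notin> half_open_cube \<Longrightarrow> f x = 0"
  shows "step k (walsh_coeff k e f)"
  unfolding step_def
proof (intro conjI allI impI walsh_coeff_cellwise)
  fix x :: "real ^ 'd" assume "x \<notin> half_open_cube"
  then have "indicator (cell k x) y * (walsh k e y * f y) = 0" for y
    using assms[of y] grid_half_open_cube[of k y x] by (auto simp: cell_def indicator_def)
  then have "(\<integral>y. indicator (cell k x) y * (walsh k e y * f y) \<partial>lborel) = (\<integral>y. 0 \<partial>(lborel :: (real ^ 'd) measure))"
    by (intro Bochner_Integration.integral_cong) auto
  then show "walsh_coeff k e f x = 0" by (simp add: walsh_coeff_def)
qed

lemma integrable_indicator_cell:
  "integrable lborel (indicator (cell k (x :: real ^ 'd)) :: _ \<Rightarrow> real)"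
  by (simp add: integrable_indicator_iff emeasure_cell)

lemma walsh_coeff_mult_cellwise:
  assumes "cellwise k g"
  shows "walsh_coeff k e (\<lambda>y. g y * f y) x = g x * walsh_coeff k e f x"
proof -
  have "indicator (cell k x) y * (walsh k e y * (g y * f y)) = g x * (indicator (cell k x) y * (walsh k e y * f y))" for y
    using cellwiseD[OF assms, of y x] by (auto simp: indicator_def cell_def)
  then have "(\<integral>y. indicator (cell k x) y * (walsh k e y * (g y * f y)) \<partial>lborel)
      = (\<integral>y. g x * (indicator (cell k x) y * (walsh k e y * f y)) \<partial>lborel)"
    by (intro Bochner_Integration.integral_cong) auto
  then show ?thesis by (simp add: walsh_coeff_def)
qed

lemma walsh_coeff_walsh_other:
  assumes "e \<noteq> e'"
  shows "walsh_coeff k e (walsh k e') x = 0"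
proof -
  have "cellwise k (indicator (cell k x) :: _ \<Rightarrow> real)"
    by (auto simp: cellwise_def cell_def indicator_def)
  from integral_cellwise_walsh[OF this integrable_indicator_cell, of "(e - e') \<union> (e' - e)"]
  show ?thesis using assms by (auto simp: walsh_coeff_def walsh_mult)
qed

lemma walsh_coeff_walsh_same: "walsh_coeff k e (walsh k e) x = 1"
  by (simp add: walsh_coeff_def emeasure_cell measure_def)

lemma avg_cellwise:
  assumes "cellwise k g"
  shows "avg k g x = g x"
  using walsh_coeff_mult_cellwise[OF assms, of "{}" "\<lambda>_. 1" x] walsh_coeff_walsh_same[of k "{}" x]
  by (simp cong: Bochner_Integration.integral_cong add: walsh_coeff_def)

lemma walsh_coeff_add:
  assumes "integrable lborel f" "integrable lborel g"
  shows "walsh_coeff k e (\<lambda>y. f y + g y) x = walsh_coeff k e f x + walsh_coeff k e g x"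
proof -
  have "integrable lborel (\<lambda>y. indicator (cell k x) y * (walsh k e y * h y))" if "integrable lborel h" for h
    by (intro integrable_bounded_mult that) (auto simp: indicator_def)
  with assms show ?thesis by (simp add: walsh_coeff_def algebra_simps)
qed

lemma walsh_coeff_cmult: "walsh_coeff k e (\<lambda>y. c * f y) x = c * walsh_coeff k e f x"
  using walsh_coeff_mult_cellwise[of k "\<lambda>_. c"] by (simp add: cellwise_def)

lemma walsh_coeff_diff:
  assumes "integrable lborel f" "integrable lborel g"
  shows "walsh_coeff k e (\<lambda>y. f y - g y) x = walsh_coeff k e f x - walsh_coeff k e g x"
  using walsh_coeff_add[OF assms(1) integrable_mult_right[OF assms(2), of "-1"]] walsh_coeff_cmult[of k e "-1" g x]
  by simp

lemma walsh_coeff_sum: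
  assumes "\<And>i. i \<in> I \<Longrightarrow> integrable lborel (f i)"
  shows "walsh_coeff k e (\<lambda>y. \<Sum>i\<in>I. f i y) x = (\<Sum>i\<in>I. walsh_coeff k e (f i) x)"
  using assms
proof (induction I rule: infinite_finite_induct)
  case (insert i I)
  have "walsh_coeff k e (\<lambda>y. f i y + (\<Sum>i\<in>I. f i y)) x = walsh_coeff k e (f i) x + walsh_coeff k e (\<lambda>y. \<Sum>i\<in>I. f i y) x"
    using insert by (intro walsh_coeff_add) auto
  with insert show ?case by simp
qed (simp_all add: walsh_coeff_def)

lemma grid_Suc_eq_iff:
  "grid (Suc k) x = grid (Suc k) y \<longleftrightarrow> grid k x = grid k y \<and> (\<forall>l. rademacher k (x $ l) = rademacher k (y $ l))"
proof -
  have *: "(a = b) \<longleftrightarrow> (a div 2 = b div 2 \<and> (even a \<longleftrightarrow> even b))" for a b :: int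
    by presburger
  show ?thesis
    unfolding fun_eq_iff grid_Suc[of k] rademacher_def
    by (subst *) (auto simp: grid_def)
qed

text \<open>The sum over all subsets e is the expanded product of the factors 1 + r_l(x) r_l(y), and
  a single disagreement of signs makes a factor vanish.\<close>

lemma sum_walsh_kernel:
  fixes x y :: "real ^ 'd"
  shows "(\<Sum>e\<in>UNIV. walsh k e x * walsh k e y)
    = (if \<forall>l. rademacher k (x $ l) = rademacher k (y $ l) then 2 ^ CARD('d) else 0)"
proof -
  have "(\<Sum>e\<in>UNIV. walsh k e x * walsh k e y)
      = (\<Prod>l\<in>UNIV. rademacher k (x $ l) * rademacher k (y $ l) + 1)"
    by (subst prod_add) (auto simp: walsh_def prod.distrib)
  also have "\<dots> = (if \<forall>l. rademacher k (x $ l) = rademacher k (y $ l) then 2 ^ CARD('d) else 0)"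
  proof (cases "\<forall>l. rademacher k (x $ l) = rademacher k (y $ l)")
    case True
    then have "rademacher k (x $ l) * rademacher k (y $ l) + 1 = 2" for l
      by (simp add: rademacher_def)
    then show ?thesis using True by simp
  next
    case False
    then obtain l where "rademacher k (x $ l) \<noteq> rademacher k (y $ l)" by auto
    then have "rademacher k (x $ l) * rademacher k (y $ l) + 1 = 0"
      by (simp add: rademacher_def split: if_splits)
    then show ?thesis using False by (auto intro!: prod_zero)
  qed
  finally show ?thesis .
qed

text \<open>Completeness of the characters: their kernel turns the cell of x into 2^d times the
  indicator of its subcell. As the empty type contributes \<open>avg k f x\<close>, the other types
  together form the martingale increment.\<close>

lemma avg_Suc:
  assumes "integrable lborel f"
  shows "avg (Suc k) f x = (\<Sum>e\<in>UNIV. walsh_coeff k e f x * walsh k e x)"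
proof -
  have i: "integrable lborel (\<lambda>y. indicator (cell k x) y * (walsh k e y * f y))" for e
    by (intro integrable_bounded_mult assms) (auto simp: indicator_def)
  have "(\<Sum>e\<in>UNIV. walsh_coeff k e f x * walsh k e x)
      = 2 ^ (k * CARD('a)) * (\<Sum>e\<in>UNIV. \<integral>y. walsh k e x * (indicator (cell k x) y * (walsh k e y * f y)) \<partial>lborel)"
    unfolding walsh_coeff_def sum_distrib_left Bochner_Integration.integral_mult_right_zero
    by (intro sum.cong) (auto simp: mult_ac)
  also have "(\<Sum>e\<in>UNIV. \<integral>y. walsh k e x * (indicator (cell k x) y * (walsh k e y * f y)) \<partial>lborel)
     = (\<integral>y. (\<Sum>e\<in>UNIV. walsh k e x * (indicator (cell k x) y * (walsh k e y * f y))) \<partial>lborel)"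
    using i by (subst Bochner_Integration.integral_sum) auto
  also have "\<dots> = (\<integral>y. 2 ^ CARD('a) * (indicator (cell (Suc k) x) y * f y) \<partial>lborel)"
  proof (intro Bochner_Integration.integral_cong refl)
    fix y
    have "(\<Sum>e\<in>UNIV. walsh k e x * (indicator (cell k x) y * (walsh k e y * f y)))
        = indicator (cell k x) y * f y * (\<Sum>e\<in>UNIV. walsh k e x * walsh k e y)"
      by (simp add: sum_distrib_left mult_ac)
    also have "\<dots> = 2 ^ CARD('a) * (indicator (cell (Suc k) x) y * f y)"
      unfolding sum_walsh_kernel by (auto simp: cell_def grid_Suc_eq_iff indicator_def)
    finally show "(\<Sum>e\<in>UNIV. walsh k e x * (indicator (cell k x) y * (walsh k e y * f y)))
      = 2 ^ CARD('a) * (indicator (cell (Suc k) x) y * f y)" .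
  qed
  also have "2 ^ (k * CARD('a)) * \<dots> = avg (Suc k) f x"
    unfolding walsh_coeff_def Bochner_Integration.integral_mult_right_zero
    by (simp add: power_add mult_ac)
  finally show ?thesis by simp
qed

section \<open>Direct and inverse estimates\<close>

definition lp_cube :: "real \<Rightarrow> (real ^ 'd \<Rightarrow> real) \<Rightarrow> bool" where
  "lp_cube p f \<longleftrightarrow> in_lp lborel p f \<and> (\<forall>x. x \<notin> half_open_cube \<longrightarrow> f x = 0)"

lemma lp_cube_in_lp: "lp_cube p f \<Longrightarrow> in_lp lborel p f"
  by (simp add: lp_cube_def)

lemma lp_cube_outside: "lp_cube p f \<Longrightarrow> x \<notin> half_open_cube \<Longrightarrow> f x = 0"
  by (simp add: lp_cube_def)

lemma lp_cube_measurable: "lp_cube p f \<Longrightarrow> f \<in> borel_measurable borel"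
  using in_lp_measurable[OF lp_cube_in_lp] by simp

lemma lp_cube_integrable:
  fixes f :: "real ^ 'd \<Rightarrow> real"
  assumes "1 \<le> p" "lp_cube p f"
  shows "integrable lborel f"
proof -
  have "integrable lborel (\<lambda>x::real^'d. indicator half_open_cube x + \<bar>f x\<bar> powr p)"
    using in_lp_integrable[OF lp_cube_in_lp[OF assms(2)]]
    by (auto simp: integrable_indicator_iff emeasure_half_open_cube)
  then show ?thesis
  proof (rule Bochner_Integration.integrable_bound)
    have "\<bar>f x\<bar> \<le> indicator half_open_cube x + \<bar>f x\<bar> powr p" for x
    proof (cases "x \<in> half_open_cube")
      case True
      show ?thesis
      proof (cases "\<bar>f x\<bar> \<le> 1")
        case False
        then have "\<bar>f x\<bar> powr 1 \<le> \<bar>f x\<bar> powr p" using assms by (intro powr_mono) auto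
        with False True show ?thesis by simp
      qed (use True in \<open>simp add: add_increasing2\<close>)
    qed (use lp_cube_outside[OF assms(2)] in simp)
    then show "AE x in lborel. norm (f x) \<le> norm (indicator half_open_cube x + \<bar>f x\<bar> powr p)"
      by (auto intro!: AE_I2)
  qed (use lp_cube_measurable[OF assms(2)] in simp)
qed

lemma step_compose:
  assumes "step k g" "F 0 = 0"
  shows "step k (\<lambda>x. F (g x))"
proof (rule stepI)
  fix x y :: "real ^ 'a" assume "grid k x = grid k y"
  then have "g x = g y" by (rule stepD[OF assms(1)])
  then show "F (g x) = F (g y)" by (rule arg_cong)
qed (use step_outside[OF assms(1)] assms(2) in simp)

lemma step_compose2:
  assumes "step k g" "step k h" "F 0 0 = 0"
  shows "step k (\<lambda>x. F (g x) (h x))"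
proof (rule stepI)
  fix x y :: "real ^ 'a" assume xy: "grid k x = grid k y"
  have "g x = g y" "h x = h y" by (rule stepD[OF assms(1) xy], rule stepD[OF assms(2) xy])
  then show "F (g x) (h x) = F (g y) (h y)" by simp
qed (use step_outside[OF assms(1)] step_outside[OF assms(2)] assms(3) in simp)

lemma step_abs_powr: "step k g \<Longrightarrow> 0 < p \<Longrightarrow> step k (\<lambda>x. \<bar>g x\<bar> powr p)"
  by (rule step_compose) auto

lemma step_lp_cube:
  assumes "step k g" "0 < p"
  shows "lp_cube p g"
  using step_integrable[OF step_abs_powr[OF assms]] step_measurable[OF assms(1)] step_outside[OF assms(1)]
  by (auto simp: lp_cube_def in_lp_def)

lemma lp_cube_diff: "0 < p \<Longrightarrow> lp_cube p f \<Longrightarrow> lp_cube p g \<Longrightarrow> lp_cube p (\<lambda>x. f x - g x)"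
  by (auto simp: lp_cube_def intro: in_lp_diff)

lemma lp_cube_cmult: "lp_cube p f \<Longrightarrow> lp_cube p (\<lambda>x. c * f x)"
  by (auto simp: lp_cube_def intro: in_lp_cmult)

lemma lp_cube_sum: "0 < p \<Longrightarrow> (\<And>i. i \<in> I \<Longrightarrow> lp_cube p (f i)) \<Longrightarrow> lp_cube p (\<lambda>x. \<Sum>i\<in>I. f i x)"
  by (auto simp: lp_cube_def intro: in_lp_sum)

lemma lp_cube_abs: "lp_cube p f \<Longrightarrow> lp_cube p (\<lambda>x. \<bar>f x\<bar>)"
  by (auto simp: lp_cube_def intro: in_lp_abs)

lemma nn_integral_lp_norm:
  assumes "0 < p" "in_lp M p f"
  shows "(\<integral>\<^sup>+x. ennreal (\<bar>f x\<bar> powr p) \<partial>M) = ennreal (lp_norm M p f powr p)"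
  using nn_integral_eq_integral[OF in_lp_integrable[OF assms(2)]] lp_norm_powr[of p M f] assms by simp

lemma lp_norm_le_nn:
  assumes "0 < p" "in_lp M p f" "0 \<le> B" "(\<integral>\<^sup>+x. ennreal (\<bar>f x\<bar> powr p) \<partial>M) \<le> ennreal (B powr p)"
  shows "lp_norm M p f \<le> B"
  using assms(4) unfolding nn_integral_lp_norm[OF assms(1,2)] using assms
  by (subst lp_norm_le_iff) (auto simp: lp_norm_powr)

section \<open>Averages as symmetric contractions\<close>

definition navg :: "nat \<Rightarrow> (real ^ 'd \<Rightarrow> ennreal) \<Rightarrow> real ^ 'd \<Rightarrow> ennreal" where
  "navg k F x = 2 ^ (k * CARD('d)) * (\<integral>\<^sup>+y. indicator (cell k x) y * F y \<partial>lborel)"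

lemma pred_same_grid [measurable]:
  assumes [measurable]: "f \<in> borel_measurable M" "g \<in> borel_measurable M"
  shows "Measurable.pred M (\<lambda>x. grid k (f x :: real ^ 'd) = grid k (g x :: real ^ 'd))"
proof -
  have "(\<lambda>x. grid k (f x) = grid k (g x)) = (\<lambda>x. \<forall>l\<in>UNIV. \<lfloor>2 ^ k * f x $ l\<rfloor> = \<lfloor>2 ^ k * g x $ l\<rfloor>)"
    by (auto simp: grid_def fun_eq_iff)
  also have "Measurable.pred M \<dots>" by measurable
  finally show ?thesis .
qed

lemma indicator_cell: "indicator (cell k x) y = (if grid k y = grid k x then 1 else 0)"
  by (simp add: indicator_def cell_def)

text \<open>The kernel is symmetric and nonnegative, so Tonelli's theorem applies, and extended
  nonnegative values keep integrability out of the way. It lets an average change sides, both for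
  contractivity on L_p and for the boundary estimate behind Bernstein's inequality.\<close>

lemma navg_adjoint:
  fixes F G :: "real ^ 'd \<Rightarrow> ennreal"
  assumes [measurable]: "F \<in> borel_measurable borel" "G \<in> borel_measurable borel"
  shows "(\<integral>\<^sup>+x. navg k F x * G x \<partial>lborel) = (\<integral>\<^sup>+x. F x * navg k G x \<partial>lborel)"
proof -
  let ?c = "2 ^ (k * CARD('d)) :: ennreal"
  have 1: "navg k F x * G x = (\<integral>\<^sup>+y. ?c * ((if grid k y = grid k x then 1 else 0) * F y * G x) \<partial>lborel)" for x
    unfolding navg_def indicator_cell by (simp add: nn_integral_cmult[symmetric] nn_integral_multc[symmetric] mult_ac)
  have 2: "F y * navg k G y = (\<integral>\<^sup>+x. ?c * ((if grid k y = grid k x then 1 else 0) * F y * G x) \<partial>lborel)" for y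
    unfolding navg_def indicator_cell
    by (simp add: nn_integral_cmult[symmetric] nn_integral_multc[symmetric] mult_ac eq_commute[of "grid k y"])
  show ?thesis
    unfolding 1 2 by (rule lborel_pair.Fubini') measurable
qed

lemma navg_cellwise:
  fixes F :: "real ^ 'd \<Rightarrow> ennreal"
  assumes "cellwise k F"
  shows "navg k F x = F x"
proof -
  have "(\<integral>\<^sup>+y. indicator (cell k x) y * F y \<partial>lborel) = (\<integral>\<^sup>+y. F x * indicator (cell k x) y \<partial>lborel)"
    by (intro nn_integral_cong) (auto simp: indicator_def cell_def dest: cellwiseD[OF assms])
  also have "\<dots> = F x * ennreal (1 / 2 ^ (k * CARD('d)))"
    by (simp add: nn_integral_cmult_indicator emeasure_cell)
  finally have "navg k F x = 2 ^ (k * CARD('d)) * ennreal (1 / 2 ^ (k * CARD('d))) * F x"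
    by (simp add: navg_def mult_ac)
  also have "2 ^ (k * CARD('d)) * ennreal (1 / 2 ^ (k * CARD('d))) = ennreal (2 ^ (k * CARD('d)) * (1 / 2 ^ (k * CARD('d))))"
    by (subst ennreal_mult) (auto simp: ennreal_power[symmetric])
  finally show ?thesis by simp
qed

lemma ennreal_avg:
  fixes F :: "real ^ 'd \<Rightarrow> real"
  assumes "integrable lborel F" "\<And>x. 0 \<le> F x"
  shows "ennreal (avg k F x) = navg k (\<lambda>x. ennreal (F x)) x"
proof -
  have i: "integrable lborel (\<lambda>y. indicator (cell k x) y * F y)"
    using integrable_bounded_mult[OF assms(1), of "indicator (cell k x)"] by (simp add: indicator_def)
  have "(\<integral>\<^sup>+y. indicator (cell k x) y * ennreal (F y) \<partial>lborel)
      = (\<integral>\<^sup>+y. ennreal (indicator (cell k x) y * F y) \<partial>lborel)"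
    by (intro nn_integral_cong) (auto simp: indicator_def)
  also have "\<dots> = ennreal (\<integral>y. indicator (cell k x) y * F y \<partial>lborel)"
    using i assms by (intro nn_integral_eq_integral) auto
  finally show ?thesis
    using assms by (simp add: navg_def walsh_coeff_def ennreal_mult ennreal_power[symmetric])
qed

lemma abs_walsh_coeff_le:
  assumes "integrable lborel f"
  shows "\<bar>walsh_coeff k e f x\<bar> \<le> avg k (\<lambda>x. \<bar>f x\<bar>) x"
proof -
  have "\<bar>\<integral>y. indicator (cell k x) y * (walsh k e y * f y) \<partial>lborel\<bar>
     \<le> (\<integral>y. \<bar>indicator (cell k x) y * (walsh k e y * f y)\<bar> \<partial>lborel)"
    by (rule integral_abs_bound)
  also have "\<dots> = (\<integral>y. indicator (cell k x) y * \<bar>f y\<bar> \<partial>lborel)"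
    by (simp add: abs_mult)
  finally show ?thesis by (simp add: walsh_coeff_def abs_mult)
qed

lemma abs_avg_powr_le:
  assumes "1 \<le> p" "lp_cube p f"
  shows "\<bar>avg k f x\<bar> powr p \<le> avg k (\<lambda>x. \<bar>f x\<bar> powr p) x"
  using integral_jensen_powr[OF assms(1), of "cell k x" lborel, OF _ emeasure_cell _ lp_cube_integrable[OF assms] in_lp_integrable[OF lp_cube_in_lp[OF assms(2)]]]
  by (simp add: walsh_coeff_def mult.commute)

lemma lp_cube_walsh_coeff: "0 < p \<Longrightarrow> lp_cube p f \<Longrightarrow> lp_cube p (walsh_coeff k e f)"
  by (rule step_lp_cube[OF walsh_coeff_step]) (auto dest: lp_cube_outside)

text \<open>Jensen's inequality on each cell, then symmetry against the constant 1, which is its own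
  average.\<close>

lemma lp_norm_avg_le:
  fixes f :: "real ^ 'd \<Rightarrow> real"
  assumes p: "1 \<le> p" and f: "lp_cube p f"
  shows "lp_norm lborel p (avg k f) \<le> lp_norm lborel p f"
proof (rule lp_norm_le_nn)
  have [measurable]: "f \<in> borel_measurable borel" by (rule lp_cube_measurable[OF f])
  have int: "integrable lborel (\<lambda>x. \<bar>f x\<bar> powr p)" by (rule in_lp_integrable[OF lp_cube_in_lp[OF f]])
  have "(\<integral>\<^sup>+x. ennreal (\<bar>avg k f x\<bar> powr p) \<partial>lborel) \<le> (\<integral>\<^sup>+x. navg k (\<lambda>x. ennreal (\<bar>f x\<bar> powr p)) x * 1 \<partial>lborel)"
    using abs_avg_powr_le[OF p f] by (intro nn_integral_mono) (simp add: ennreal_avg[OF int, symmetric] ennreal_leI)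
  also have "\<dots> = (\<integral>\<^sup>+x. ennreal (\<bar>f x\<bar> powr p) * navg k (\<lambda>_. 1) x \<partial>lborel)"
    by (rule navg_adjoint) auto
  also have "\<dots> = ennreal (lp_norm lborel p f powr p)"
    using nn_integral_lp_norm[OF _ lp_cube_in_lp[OF f]] p by (simp add: navg_cellwise cellwise_def)
  finally show "(\<integral>\<^sup>+x. ennreal (\<bar>avg k f x\<bar> powr p) \<partial>lborel) \<le> ennreal (lp_norm lborel p f powr p)" .
qed (use p f in \<open>auto intro: lp_cube_in_lp[OF lp_cube_walsh_coeff]\<close>)

lemma lp_norm_walsh_coeff_le:
  assumes p: "1 \<le> p" and f: "lp_cube p f"
  shows "lp_norm lborel p (walsh_coeff k e f) \<le> lp_norm lborel p f"
proof -
  have "lp_norm lborel p (walsh_coeff k e f) \<le> lp_norm lborel p (avg k (\<lambda>x. \<bar>f x\<bar>))"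
    using p f lp_cube_integrable[OF p f]
    by (intro lp_norm_mono lp_cube_in_lp[OF lp_cube_walsh_coeff] lp_cube_abs AE_I2
         in_lp_measurable[OF lp_cube_in_lp[OF lp_cube_walsh_coeff]])
       (auto intro: order_trans[OF abs_walsh_coeff_le abs_ge_self])
  also have "\<dots> \<le> lp_norm lborel p f"
    using lp_norm_avg_le[OF p lp_cube_abs[OF f], of k] by simp
  finally show ?thesis .
qed

section \<open>Differences inside the cube and Jackson's inequality\<close>

definition shift_diff :: "real ^ 'd \<Rightarrow> (real ^ 'd \<Rightarrow> real) \<Rightarrow> real ^ 'd \<Rightarrow> real" where
  "shift_diff y f x = (if x \<in> half_open_cube \<and> x + y \<in> half_open_cube then f (x + y) - f x else 0)"

lemma shift_diff_measurable [measurable]: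
  assumes [measurable]: "f \<in> borel_measurable borel"
  shows "shift_diff y f \<in> borel_measurable borel"
  unfolding shift_diff_def by measurable

lemma abs_shift_diff_powr_le:
  "0 < p \<Longrightarrow> \<bar>shift_diff y f x\<bar> powr p \<le> 2 powr p * (\<bar>f (x + y)\<bar> powr p + \<bar>f x\<bar> powr p)"
  using powr_abs_diff_le[of p "f (x + y)" "f x"] by (simp add: shift_diff_def)

lemma shift_diff_in_lp:
  assumes "0 < p" "lp_cube p f"
  shows "in_lp lborel p (shift_diff y f)"
  unfolding in_lp_def
proof
  have [measurable]: "f \<in> borel_measurable borel" by (rule lp_cube_measurable[OF assms(2)])
  show "shift_diff y f \<in> borel_measurable lborel" by simp
  have int: "integrable lborel (\<lambda>x. \<bar>f x\<bar> powr p)" by (rule in_lp_integrable[OF lp_cube_in_lp[OF assms(2)]])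
  have "integrable lborel (\<lambda>x. 2 powr p * (\<bar>f (x + y)\<bar> powr p + \<bar>f x\<bar> powr p))"
    using integrable_lborel_translate[OF int] int by simp
  then show "integrable lborel (\<lambda>x. \<bar>shift_diff y f x\<bar> powr p)"
    by (rule Bochner_Integration.integrable_bound)
       (use abs_shift_diff_powr_le[OF assms(1), of y f] in \<open>auto intro!: AE_I2\<close>)
qed

lemma lp_norm_shift_diff_le:
  assumes p: "0 < p" and f: "lp_cube p f"
  shows "lp_norm lborel p (shift_diff y f) \<le> 2 * 2 powr (1 / p) * lp_norm lborel p f"
proof (subst lp_norm_le_iff)
  have [measurable]: "f \<in> borel_measurable borel" by (rule lp_cube_measurable[OF f])
  have int: "integrable lborel (\<lambda>x. \<bar>f x\<bar> powr p)" by (rule in_lp_integrable[OF lp_cube_in_lp[OF f]])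
  have "(\<integral>x. \<bar>shift_diff y f x\<bar> powr p \<partial>lborel)
     \<le> (\<integral>x. 2 powr p * (\<bar>f (x + y)\<bar> powr p + \<bar>f x\<bar> powr p) \<partial>lborel)"
    using integrable_lborel_translate[OF int] int in_lp_integrable[OF shift_diff_in_lp[OF assms]]
      abs_shift_diff_powr_le[OF p]
    by (intro integral_mono) auto
  also have "\<dots> = 2 powr p * (2 * (\<integral>x. \<bar>f x\<bar> powr p \<partial>lborel))"
    using integrable_lborel_translate[OF int] int integral_lborel_translate[of "\<lambda>x. \<bar>f x\<bar> powr p" y] by simp
  also have "\<dots> = (2 * 2 powr (1 / p) * lp_norm lborel p f) powr p"
    using p by (simp add: powr_mult powr_powr lp_norm_powr)
  finally show "(\<integral>x. \<bar>shift_diff y f x\<bar> powr p \<partial>lborel) \<le> (2 * 2 powr (1 / p) * lp_norm lborel p f) powr p" .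
qed (use p in auto)

text \<open>By Jensen, \<bar>f x - avg k f x\<bar>^p is at most the mean of \<bar>f y - f x\<bar>^p
  over the cell of x. With y = x + u the shifts u stay in the cube \<open>?Q\<close> of side 2 /
  2^k, and exchanging the integrals leaves L_p norms of differences. The volume of \<open>?Q\<close>
  relative to a cell is 2^d, hence the constant.\<close>

lemma jackson:
  fixes f :: "real ^ 'd \<Rightarrow> real"
  assumes p: "1 \<le> p" and f: "lp_cube p f" and B: "0 \<le> B"
    and bound: "\<And>y. 0 < norm y \<Longrightarrow> norm y \<le> CARD('d) / 2 ^ k \<Longrightarrow> lp_norm lborel p (shift_diff y f) \<le> B"
  shows "lp_norm lborel p (\<lambda>x. f x - avg k f x) \<le> 2 powr (CARD('d) / p) * B"
proof (rule lp_norm_le_nn)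
  let ?U = "half_open_cube :: (real ^ 'd) set"
  let ?c = "2 ^ (k * CARD('d)) :: real"
  let ?Q = "{u :: real ^ 'd. \<forall>l. (\<chi> l. - (1 / 2 ^ k)) $ l \<le> u $ l \<and> u $ l < (\<chi> l. 1 / 2 ^ k) $ l}"
  have p0: "0 < p" using p by simp
  have [measurable]: "f \<in> borel_measurable borel" by (rule lp_cube_measurable[OF f])
  have Q [measurable]: "?Q \<in> sets borel" "emeasure lborel ?Q = ennreal ((2 / 2 ^ k) ^ CARD('d))"
    by (subst emeasure_half_open_box; simp)+
  let ?H = "\<lambda>x y. (if x \<in> ?U \<and> grid k y = grid k x then \<bar>f y - f x\<bar> powr p else 0)"
  have pt: "ennreal (\<bar>f x - avg k f x\<bar> powr p) \<le> ennreal ?c * (\<integral>\<^sup>+y. ennreal (?H x y) \<partial>lborel)" for x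
  proof (cases "x \<in> ?U")
    case False
    then have "avg k f x = 0" "f x = 0"
      using step_outside[OF walsh_coeff_step] lp_cube_outside[OF f] by blast+
    then show ?thesis by simp
  next
    case True
    \<comment> \<open>Jensen is applied to the difference with x frozen; cutting the constant off
      outside the cube keeps \<open>h\<close> in \<open>lp_cube\<close>.\<close>
    define h where "h y = f x * indicator ?U y - f y" for y
    have iU: "step 0 (indicator ?U)"
      by (rule stepI) (auto simp: indicator_def dest: grid_half_open_cube)
    have h: "lp_cube p h"
      unfolding h_def by (intro lp_cube_diff lp_cube_cmult step_lp_cube[OF iU] f p0)
    have [measurable]: "h \<in> borel_measurable borel" by (rule lp_cube_measurable[OF h])
    have hint: "integrable lborel (\<lambda>y. \<bar>h y\<bar> powr p)" by (rule in_lp_integrable[OF lp_cube_in_lp[OF h]])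
    have "avg k h x = f x * indicator ?U x - avg k f x"
      unfolding h_def using lp_cube_integrable[OF p f] step_integrable[OF iU] step_cellwise[OF step_mono[OF iU]]
      by (subst walsh_coeff_diff) (auto simp: walsh_coeff_cmult avg_cellwise)
    then have "ennreal (\<bar>f x - avg k f x\<bar> powr p) \<le> navg k (\<lambda>y. ennreal (\<bar>h y\<bar> powr p)) x"
      using True abs_avg_powr_le[OF p h, of k x] by (simp add: ennreal_avg[OF hint, symmetric] ennreal_leI)
    also have "\<dots> = ennreal ?c * (\<integral>\<^sup>+y. ennreal (?H x y) \<partial>lborel)"
    proof -
      have "indicator (cell k x) y * ennreal (\<bar>h y\<bar> powr p) = ennreal (?H x y)" for y
        using True grid_half_open_cube[of k y x] by (auto simp: indicator_cell h_def abs_minus_commute)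
      then show ?thesis by (simp add: navg_def ennreal_power[symmetric])
    qed
    finally show ?thesis .
  qed
  have HQ: "ennreal (?H x (x + u)) \<le> indicator ?Q u * ennreal (\<bar>shift_diff u f x\<bar> powr p)" for x u
  proof (cases "x \<in> ?U \<and> grid k (x + u) = grid k x")
    case True
    then have "x + u \<in> ?U" using grid_half_open_cube by blast
    moreover have "u \<in> ?Q"
    proof -
      have "- (1 / 2 ^ k) \<le> u $ l \<and> u $ l < 1 / 2 ^ k" for l
      proof -
        have "\<lfloor>2 ^ k * (x $ l + u $ l)\<rfloor> = \<lfloor>2 ^ k * x $ l\<rfloor>"
          using True by (auto simp: grid_def fun_eq_iff)
        then have "\<bar>2 ^ k * (x $ l + u $ l) - 2 ^ k * x $ l\<bar> < 1" by linarith
        then have "\<bar>2 ^ k * u $ l\<bar> < 1" by (simp add: algebra_simps)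
        then have "- 1 < 2 ^ k * u $ l" "2 ^ k * u $ l < 1" by linarith+
        then show ?thesis by (simp add: field_simps)
      qed
      then show ?thesis by simp
    qed
    ultimately show ?thesis using True by (simp add: shift_diff_def)
  qed auto
  have uB: "indicator ?Q u * (\<integral>\<^sup>+x. ennreal (\<bar>shift_diff u f x\<bar> powr p) \<partial>lborel) \<le> ennreal (B powr p) * indicator ?Q u" for u
  proof (cases "u \<in> ?Q \<and> u \<noteq> 0")
    case True
    \<comment> \<open>Every coordinate of u is at most 1 / 2^k in modulus, so the l1 norm yields the
      radius in the hypothesis \<open>bound\<close>.\<close>
    have "norm u \<le> (\<Sum>l\<in>UNIV. \<bar>u $ l\<bar>)" by (rule norm_le_l1_cart)
    also have "\<dots> \<le> (\<Sum>l\<in>(UNIV::'d set). 1 / 2 ^ k)"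
      using True by (intro sum_mono) (auto simp: abs_le_iff intro: less_imp_le, smt (verit))
    finally have "lp_norm lborel p (shift_diff u f) \<le> B" using True by (intro bound) auto
    then have "ennreal (lp_norm lborel p (shift_diff u f) powr p) \<le> ennreal (B powr p)"
      using p0 by (intro ennreal_leI powr_mono2) auto
    then show ?thesis
      using True nn_integral_lp_norm[OF p0 shift_diff_in_lp[OF p0 f], of u] by simp
  next
    case False
    have "shift_diff 0 f = (\<lambda>_. 0)" by (auto simp: shift_diff_def)
    with False show ?thesis by (cases "u = 0") auto
  qed
  have "(\<integral>\<^sup>+x. ennreal (\<bar>f x - avg k f x\<bar> powr p) \<partial>lborel)
     \<le> (\<integral>\<^sup>+x. ennreal ?c * (\<integral>\<^sup>+y. ennreal (?H x y) \<partial>lborel) \<partial>lborel)"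
    using pt by (intro nn_integral_mono)
  also have "\<dots> = ennreal ?c * (\<integral>\<^sup>+x. (\<integral>\<^sup>+y. ennreal (?H x y) \<partial>lborel) \<partial>lborel)"
    by (rule nn_integral_cmult) measurable
  also have "(\<integral>\<^sup>+x. (\<integral>\<^sup>+y. ennreal (?H x y) \<partial>lborel) \<partial>lborel)
     = (\<integral>\<^sup>+x. (\<integral>\<^sup>+u. ennreal (?H x (x + u)) \<partial>lborel) \<partial>lborel)"
  proof (rule nn_integral_cong)
    fix x
    have "(\<lambda>y. ennreal (?H x y)) \<in> borel_measurable borel" by measurable
    from nn_integral_lborel_translate[OF this, of x]
    show "(\<integral>\<^sup>+y. ennreal (?H x y) \<partial>lborel) = (\<integral>\<^sup>+u. ennreal (?H x (x + u)) \<partial>lborel)"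
      by (simp only: add.commute[of _ x])
  qed
  also have "\<dots> \<le> (\<integral>\<^sup>+x. (\<integral>\<^sup>+u. indicator ?Q u * ennreal (\<bar>shift_diff u f x\<bar> powr p) \<partial>lborel) \<partial>lborel)"
    using HQ by (intro nn_integral_mono)
  also have "\<dots> = (\<integral>\<^sup>+u. (\<integral>\<^sup>+x. indicator ?Q u * ennreal (\<bar>shift_diff u f x\<bar> powr p) \<partial>lborel) \<partial>lborel)"
    unfolding shift_diff_def by (rule lborel_pair.Fubini'[symmetric]) measurable
  also have "\<dots> = (\<integral>\<^sup>+u. indicator ?Q u * (\<integral>\<^sup>+x. ennreal (\<bar>shift_diff u f x\<bar> powr p) \<partial>lborel) \<partial>lborel)"
    by (intro nn_integral_cong nn_integral_cmult) measurable
  also have "\<dots> \<le> (\<integral>\<^sup>+u. ennreal (B powr p) * indicator ?Q u \<partial>lborel)"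
    using uB by (intro nn_integral_mono)
  also have "\<dots> = ennreal (B powr p) * ennreal ((2 / 2 ^ k) ^ CARD('d))"
    using Q by (simp add: nn_integral_cmult_indicator)
  also have "ennreal ?c * (ennreal (B powr p) * ennreal ((2 / 2 ^ k) ^ CARD('d)))
     = ennreal (?c * (B powr p * (2 / 2 ^ k) ^ CARD('d)))"
    by (simp add: ennreal_mult)
  also have "?c * (B powr p * (2 / 2 ^ k) ^ CARD('d)) = (2 powr (CARD('d) / p) * B) powr p"
    using p0 B by (simp add: powr_mult powr_powr power_divide power_mult powr_realpow)
  finally show "(\<integral>\<^sup>+x. ennreal (\<bar>f x - avg k f x\<bar> powr p) \<partial>lborel) \<le> ennreal ((2 powr (CARD('d) / p) * B) powr p)"
    by (simp add: mult_left_mono)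
qed (use p f B in \<open>auto intro!: lp_cube_in_lp[OF lp_cube_diff] lp_cube_walsh_coeff\<close>)

section \<open>Bernstein's inequality for step functions\<close>

lemma navg_leaving_le:
  fixes x y :: "real ^ 'd"
  shows "navg k (\<lambda>z. if grid k (z + y) \<noteq> grid k z then 1 else 0) x
    \<le> ennreal (2 ^ k * (CARD('d) * norm y))"
proof -
  let ?s = "\<lambda>l. 2 ^ k * \<bar>y $ l\<bar>"
  let ?S = "{z \<in> cell k x. z + y \<in> cell k x}"
  let ?L = "{z \<in> cell k x. z + y \<notin> cell k x}"
  let ?c = "2 ^ (k * CARD('d)) :: real"
  define a :: "real ^ 'd" where "a = (\<chi> l. real_of_int (grid k x l) / 2 ^ k)"
  define b :: "real ^ 'd" where "b = (\<chi> l. (real_of_int (grid k x l) + 1) / 2 ^ k)"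
  have ab: "b $ l = a $ l + 1 / 2 ^ k" for l by (simp add: a_def b_def add_divide_distrib)
  have C: "z \<in> cell k x \<longleftrightarrow> (\<forall>l. a $ l \<le> z $ l \<and> z $ l < b $ l)" for z
    unfolding cell_halfopen a_def b_def by simp
  have L [measurable]: "?L \<in> sets borel" "?S \<in> sets borel" by measurable
  \<comment> \<open>The points that remain in the cell after the shift form a box with sides (1 - ?s
    l) / 2^k, and the product of the 1 - ?s l is at least one minus the sum of the ?s l. If some ?s
    l exceeds 1, the volume of the whole cell is bound enough.\<close>
  have "emeasure lborel ?L \<le> ennreal (1 / ?c * (\<Sum>l\<in>UNIV. ?s l))"
  proof (cases "\<forall>l. ?s l \<le> 1")
    case True
    define a' :: "real ^ 'd" where "a' = (\<chi> l. max (a $ l) (a $ l - y $ l))"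
    define b' :: "real ^ 'd" where "b' = (\<chi> l. min (b $ l) (b $ l - y $ l))"
    have ab': "b' $ l - a' $ l = (1 - ?s l) / 2 ^ k" for l
    proof -
      have "b' $ l - a' $ l = 1 / 2 ^ k - \<bar>y $ l\<bar>"
        by (auto simp: a'_def b'_def ab max_def min_def)
      then show ?thesis by (simp add: field_simps)
    qed
    have "a' $ l \<le> b' $ l" for l
      using ab'[of l] True[rule_format, of l] by (smt (verit) divide_nonneg_nonneg zero_le_power)
    then have m: "emeasure lborel {z. \<forall>l. a' $ l \<le> z $ l \<and> z $ l < b' $ l} = ennreal (\<Prod>l\<in>UNIV. (1 - ?s l) / 2 ^ k)"
      by (subst emeasure_half_open_box) (auto simp: ab')
    have "(\<Prod>l\<in>(UNIV::'d set). (1 - ?s l) / 2 ^ k) = (\<Prod>l\<in>(UNIV::'d set). 1 - ?s l) / ?c"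
      by (simp add: prod_dividef power_mult)
    also have "\<dots> \<ge> (1 - (\<Sum>l\<in>UNIV. ?s l)) / ?c"
      using True by (intro divide_right_mono Weierstrass_prod_ineq) auto
    finally have pr: "(1 - (\<Sum>l\<in>UNIV. ?s l)) / ?c \<le> (\<Prod>l\<in>(UNIV::'d set). (1 - ?s l) / 2 ^ k)" .
    have pr0: "0 \<le> (\<Prod>l\<in>(UNIV::'d set). (1 - ?s l) / 2 ^ k)"
      using True by (intro prod_nonneg) auto
    have "{z. \<forall>l. a' $ l \<le> z $ l \<and> z $ l < b' $ l} = ?S"
    proof -
      have "(a' $ l \<le> z $ l \<and> z $ l < b' $ l) \<longleftrightarrow>
        (a $ l \<le> z $ l \<and> z $ l < b $ l) \<and> (a $ l \<le> (z + y) $ l \<and> (z + y) $ l < b $ l)" for z l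
        by (auto simp: a'_def b'_def)
      then show ?thesis unfolding C by blast
    qed
    with m have m: "emeasure lborel ?S = ennreal (\<Prod>l\<in>UNIV. (1 - ?s l) / 2 ^ k)" by simp
    have "?L = cell k x - ?S" by auto
    also have "emeasure lborel (cell k x - ?S) = emeasure lborel (cell k x) - emeasure lborel ?S"
      by (rule emeasure_Diff) (auto simp: m)
    also have "\<dots> = ennreal (1 / ?c - (\<Prod>l\<in>(UNIV::'d set). (1 - ?s l) / 2 ^ k))"
      using pr0 unfolding m emeasure_cell by (subst ennreal_minus) auto
    also have "\<dots> \<le> ennreal (1 / ?c * (\<Sum>l\<in>UNIV. ?s l))"
      using pr by (intro ennreal_leI) (simp add: diff_divide_distrib)
    finally show ?thesis .
  next
    case False
    then obtain l where l: "1 < ?s l" by (auto simp: not_le)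
    have "emeasure lborel ?L \<le> emeasure lborel (cell k x)" by (intro emeasure_mono) auto
    also have "\<dots> = ennreal (1 / ?c * 1)" by (simp add: emeasure_cell)
    also have "\<dots> \<le> ennreal (1 / ?c * (\<Sum>l\<in>UNIV. ?s l))"
    proof (intro ennreal_leI mult_left_mono)
      have "?s l \<le> (\<Sum>l\<in>UNIV. ?s l)" by (rule member_le_sum) auto
      with l show "1 \<le> (\<Sum>l\<in>UNIV. ?s l)" by linarith
    qed auto
    finally show ?thesis .
  qed
  also have "\<dots> \<le> ennreal (1 / ?c * (2 ^ k * (CARD('d) * norm y)))"
  proof (intro ennreal_leI mult_left_mono)
    have "(\<Sum>l\<in>(UNIV::'d set). ?s l) \<le> (\<Sum>l\<in>(UNIV::'d set). 2 ^ k * norm y)"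
      by (intro sum_mono mult_left_mono component_le_norm_cart) auto
    then show "(\<Sum>l\<in>(UNIV::'d set). ?s l) \<le> 2 ^ k * (CARD('d) * norm y)" by (simp add: mult_ac)
  qed auto
  finally have "ennreal ?c * emeasure lborel ?L \<le> ennreal ?c * ennreal (1 / ?c * (2 ^ k * (CARD('d) * norm y)))"
    by (rule mult_left_mono) auto
  also have "\<dots> = ennreal (2 ^ k * (CARD('d) * norm y))"
    by (subst ennreal_mult[symmetric]) auto
  also have "ennreal ?c * emeasure lborel ?L = navg k (\<lambda>z. if grid k (z + y) \<noteq> grid k z then 1 else 0) x"
  proof -
    have "(\<integral>\<^sup>+z. indicator (cell k x) z * (if grid k (z + y) \<noteq> grid k z then 1 else 0) \<partial>lborel)
        = (\<integral>\<^sup>+z. indicator ?L z \<partial>lborel)"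
      by (intro nn_integral_cong) (auto simp: indicator_def cell_def)
    then show ?thesis by (simp add: navg_def ennreal_power[symmetric])
  qed
  finally show ?thesis .
qed

text \<open>As G is its own average, symmetry moves the average onto the indicator of the points
  that change cell, whose mean over every cell is already estimated.\<close>

lemma nn_integral_step_leaving:
  fixes G :: "real ^ 'd \<Rightarrow> ennreal"
  assumes "cellwise n G"
  shows "(\<integral>\<^sup>+x. G x * (if grid n (x + y) \<noteq> grid n x then 1 else 0) \<partial>lborel)
    \<le> ennreal (2 ^ n * (CARD('d) * norm y)) * (\<integral>\<^sup>+x. G x \<partial>lborel)"
proof -
  let ?\<phi> = "\<lambda>x. if grid n (x + y) \<noteq> grid n x then 1 else 0 :: ennreal"
  have [measurable]: "G \<in> borel_measurable borel" by (rule cellwise_measurable[OF assms])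
  have "(\<integral>\<^sup>+x. G x * ?\<phi> x \<partial>lborel) = (\<integral>\<^sup>+x. navg n G x * ?\<phi> x \<partial>lborel)"
    by (simp add: navg_cellwise[OF assms])
  also have "\<dots> = (\<integral>\<^sup>+x. G x * navg n ?\<phi> x \<partial>lborel)"
    by (rule navg_adjoint) measurable
  also have "\<dots> \<le> (\<integral>\<^sup>+x. G x * ennreal (2 ^ n * (CARD('d) * norm y)) \<partial>lborel)"
    by (intro nn_integral_mono mult_left_mono navg_leaving_le) auto
  also have "\<dots> = ennreal (2 ^ n * (CARD('d) * norm y)) * (\<integral>\<^sup>+x. G x \<partial>lborel)"
    by (simp add: nn_integral_multc mult.commute)
  finally show ?thesis .
qed

text \<open>A difference of a step function is nonzero only at points that change cell. The part
  with g (x + y) is translated back, which replaces y by -y. Nothing here is convex, so the case p <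
  1 can rely on it.\<close>

lemma bernstein:
  fixes g :: "real ^ 'd \<Rightarrow> real"
  assumes p: "0 < p" and g: "step n g"
  shows "lp_norm lborel p (shift_diff y g)
    \<le> (2 powr (p + 1) * CARD('d)) powr (1 / p) * (2 ^ n * norm y) powr (1 / p) * lp_norm lborel p g"
proof (rule lp_norm_le_nn[OF p])
  have lg: "lp_cube p g" by (rule step_lp_cube[OF g p])
  show "in_lp lborel p (shift_diff y g)" by (rule shift_diff_in_lp[OF p lg])
  have [measurable]: "g \<in> borel_measurable borel" by (rule step_measurable[OF g])
  define G where "G x = ennreal (\<bar>g x\<bar> powr p)" for x
  have cG: "cellwise n G"
    unfolding cellwise_def
  proof (intro allI impI)
    fix x z :: "real ^ 'd" assume "grid n x = grid n z"
    then have "g x = g z" by (rule stepD[OF g])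
    then show "G x = G z" by (simp add: G_def)
  qed
  have [measurable]: "G \<in> borel_measurable borel" by (rule cellwise_measurable[OF cG])
  let ?\<phi> = "\<lambda>y x. if grid n (x + y) \<noteq> grid n x then 1 else 0 :: ennreal"
  let ?N = "ennreal (2 ^ n * (CARD('d) * norm y))"
  have pt: "ennreal (\<bar>shift_diff y g x\<bar> powr p) \<le> ennreal (2 powr p) * (G (x + y) * ?\<phi> y x + G x * ?\<phi> y x)" for x
  proof (cases "grid n (x + y) = grid n x")
    case True
    then have "g (x + y) = g x" by (rule stepD[OF g])
    then show ?thesis by (simp add: shift_diff_def)
  next
    case False
    have "ennreal (\<bar>shift_diff y g x\<bar> powr p) \<le> ennreal (2 powr p * (\<bar>g (x + y)\<bar> powr p + \<bar>g x\<bar> powr p))"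
      by (intro ennreal_leI abs_shift_diff_powr_le p)
    with False show ?thesis by (simp add: G_def ennreal_mult)
  qed
  have G': "(\<integral>\<^sup>+x. G x \<partial>lborel) = ennreal (lp_norm lborel p g powr p)"
    unfolding G_def by (rule nn_integral_lp_norm[OF p lp_cube_in_lp[OF lg]])
  have 1: "(\<integral>\<^sup>+x. G x * ?\<phi> y x \<partial>lborel) \<le> ?N * (\<integral>\<^sup>+x. G x \<partial>lborel)"
    by (rule nn_integral_step_leaving[OF cG])
  have "(\<integral>\<^sup>+x. G (x + y) * ?\<phi> y x \<partial>lborel) = (\<integral>\<^sup>+x. (\<lambda>z. G z * ?\<phi> (- y) z) (x + y) \<partial>lborel)"
    by (intro nn_integral_cong) (simp add: eq_commute)
  also have "\<dots> = (\<integral>\<^sup>+z. G z * ?\<phi> (- y) z \<partial>lborel)"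
    by (rule nn_integral_lborel_translate) measurable
  also have "\<dots> \<le> ennreal (2 ^ n * (CARD('d) * norm (- y))) * (\<integral>\<^sup>+x. G x \<partial>lborel)"
    by (rule nn_integral_step_leaving[OF cG])
  finally have 2: "(\<integral>\<^sup>+x. G (x + y) * ?\<phi> y x \<partial>lborel) \<le> ?N * (\<integral>\<^sup>+x. G x \<partial>lborel)" by simp
  have "(\<integral>\<^sup>+x. ennreal (\<bar>shift_diff y g x\<bar> powr p) \<partial>lborel)
    \<le> (\<integral>\<^sup>+x. ennreal (2 powr p) * (G (x + y) * ?\<phi> y x + G x * ?\<phi> y x) \<partial>lborel)"
    using pt by (intro nn_integral_mono)
  also have "\<dots> = ennreal (2 powr p) * ((\<integral>\<^sup>+x. G (x + y) * ?\<phi> y x \<partial>lborel) + (\<integral>\<^sup>+x. G x * ?\<phi> y x \<partial>lborel))"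
  proof -
    have [measurable]: "(\<lambda>x. G (x + y) * ?\<phi> y x) \<in> borel_measurable lborel"
      "(\<lambda>x. G x * ?\<phi> y x) \<in> borel_measurable lborel" by measurable
    show ?thesis
      by (subst nn_integral_cmult) (simp_all add: nn_integral_add)
  qed
  also have "\<dots> \<le> ennreal (2 powr p) * (?N * (\<integral>\<^sup>+x. G x \<partial>lborel) + ?N * (\<integral>\<^sup>+x. G x \<partial>lborel))"
    using 1 2 by (intro mult_left_mono add_mono) auto
  also have "\<dots> = ennreal (2 powr p * (2 * (2 ^ n * (CARD('d) * norm y) * lp_norm lborel p g powr p)))"
    unfolding G'
  proof -
    have "ennreal a * (ennreal b * ennreal c + ennreal b * ennreal c) = ennreal (a * (2 * (b * c)))"
      if "0 \<le> a" "0 \<le> b" "0 \<le> c" for a b c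
    proof -
      have "ennreal b * ennreal c + ennreal b * ennreal c = ennreal (b * c + b * c)"
        using that by (simp only: ennreal_mult ennreal_plus mult_nonneg_nonneg)
      moreover have "a * (2 * (b * c)) = a * (b * c + b * c)" by simp
      moreover have "ennreal (a * (b * c + b * c)) = ennreal a * ennreal (b * c + b * c)"
        using that by (intro ennreal_mult) auto
      ultimately show ?thesis by (simp only:)
    qed
    then show "ennreal (2 powr p) * (?N * ennreal (lp_norm lborel p g powr p) + ?N * ennreal (lp_norm lborel p g powr p))
      = ennreal (2 powr p * (2 * (2 ^ n * (CARD('d) * norm y) * lp_norm lborel p g powr p)))"
      by simp
  qed
  also have "2 powr p * (2 * (2 ^ n * (CARD('d) * norm y) * lp_norm lborel p g powr p))
    = ((2 powr (p + 1) * CARD('d)) powr (1 / p) * (2 ^ n * norm y) powr (1 / p) * lp_norm lborel p g) powr p"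
    using p by (simp add: powr_mult powr_powr powr_add)
  finally show "(\<integral>\<^sup>+x. ennreal (\<bar>shift_diff y g x\<bar> powr p) \<partial>lborel)
    \<le> ennreal (((2 powr (p + 1) * CARD('d)) powr (1 / p) * (2 ^ n * norm y) powr (1 / p) * lp_norm lborel p g) powr p)" .
qed auto

section \<open>The modulus of smoothness\<close>

lemma AE_lborel_translate:
  fixes y :: "'a::euclidean_space"
  assumes "AE x in lborel. P x"
  shows "AE x in lborel. P (x + y)"
proof -
  from assms obtain N where N: "{x. \<not> P x} \<subseteq> N" "emeasure lborel N = 0" "N \<in> sets lborel"
    by (auto elim: AE_E)
  have [measurable]: "N \<in> sets borel" using N by simp
  have "(\<integral>\<^sup>+x. indicator N (x + y) \<partial>lborel) = (\<integral>\<^sup>+x. indicator N x \<partial>lborel)"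
    by (rule nn_integral_lborel_translate) simp
  also have "\<dots> = 0" using N by simp
  finally have "AE x in lborel. indicator N (x + y) = (0 :: ennreal)"
    by (subst (asm) nn_integral_0_iff_AE) auto
  then show ?thesis using N(1) by (auto elim!: eventually_mono simp: indicator_def split: if_splits)
qed

lemma borel_measurable_lebesgue_AE:
  fixes f F :: "'a::euclidean_space \<Rightarrow> real"
  assumes f: "f \<in> borel_measurable borel" and AE: "AE x in lborel. F x = f x"
  shows "F \<in> borel_measurable lebesgue"
proof (rule measurableI)
  fix B :: "real set" assume B: "B \<in> sets borel"
  have [measurable]: "f \<in> borel_measurable lebesgue" "B \<in> sets borel"
    using f B by (auto intro: measurable_completion)
  have 1 [measurable]: "Measurable.pred lebesgue (\<lambda>x. F x \<noteq> f x)"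
    by (rule sets_completion_AE) (use AE in \<open>auto elim: eventually_mono\<close>)
  have 2 [measurable]: "Measurable.pred lebesgue (\<lambda>x. F x \<in> B \<and> F x \<noteq> f x)"
    by (rule sets_completion_AE) (use AE in \<open>auto elim: eventually_mono\<close>)
  have "F -` B \<inter> space lebesgue = {x \<in> space lebesgue. (F x \<in> B \<and> F x \<noteq> f x) \<or> (f x \<in> B \<and> \<not> (F x \<noteq> f x))}"
    by auto
  also have "\<dots> \<in> sets lebesgue" by measurable
  finally show "F -` B \<inter> space lebesgue \<in> sets lebesgue" .
qed simp

lemma lebesgue_integral_AE:
  fixes f F :: "'a::euclidean_space \<Rightarrow> real"
  assumes f: "f \<in> borel_measurable borel" and AE: "AE x in lborel. F x = f x"
  shows "integrable lebesgue F \<longleftrightarrow> integrable lborel f"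
    and "(\<integral>x. F x \<partial>lebesgue) = (\<integral>x. f x \<partial>lborel)"
proof -
  have m: "f \<in> borel_measurable lebesgue" "F \<in> borel_measurable lebesgue"
    using measurable_completion[of f lborel borel] f borel_measurable_lebesgue_AE[OF assms] by auto
  have AE': "AE x in lebesgue. F x = f x" using AE by (rule AE_completion)
  show "integrable lebesgue F \<longleftrightarrow> integrable lborel f"
    using integrable_cong_AE[OF m(2,1) AE'] integrable_completion[of f lborel] f by simp
  show "(\<integral>x. F x \<partial>lebesgue) = (\<integral>x. f x \<partial>lborel)"
    using integral_cong_AE[OF m(2,1) AE'] integral_completion[of f lborel] f by simp
qed

lemma half_open_cube_subset: "half_open_cube \<subseteq> unit_cube"
  by (auto simp: half_open_cube_def unit_cube_def mem_box_cart less_imp_le)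

lemma AE_half_open_cube:
  "AE x in lborel. x \<in> unit_cube \<longrightarrow> (x :: real ^ 'd) \<in> half_open_cube"
proof -
  have "emeasure lborel (unit_cube :: (real ^ 'd) set) = 1"
    by (auto simp: unit_cube_def emeasure_lborel_cbox_eq Basis_vec_def inner_axis intro!: prod.neutral)
  then have "emeasure lborel (unit_cube - half_open_cube :: (real ^ 'd) set) = 0"
    using half_open_cube_subset
    by (subst emeasure_Diff) (auto simp: emeasure_half_open_cube unit_cube_def)
  then have "unit_cube - half_open_cube \<in> null_sets (lborel :: (real ^ 'd) measure)"
    by (auto simp: null_sets_def unit_cube_def)
  from AE_not_in[OF this] show ?thesis by (auto elim!: eventually_mono)
qed

text \<open>The bridge from the given spaces, made of Lebesgue functions on the closed cube, to
  Borel functions on the whole space that vanish off the half-open cube. All norms and moduli are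
  computed on the representative f with integrals over \<open>lborel\<close>.\<close>

definition represents :: "real \<Rightarrow> (real ^ 'd \<Rightarrow> real) \<Rightarrow> (real ^ 'd \<Rightarrow> real) \<Rightarrow> bool" where
  "represents p f g \<longleftrightarrow> lp_cube p f \<and> (AE x in lborel. x \<in> unit_cube \<longrightarrow> g x = f x)"

definition lp_modulus :: "real \<Rightarrow> (real ^ 'd \<Rightarrow> real) \<Rightarrow> real \<Rightarrow> real" where
  "lp_modulus p f t = (SUP y\<in>{y. 0 < norm y \<and> norm y \<le> t}. lp_norm lborel p (shift_diff y f))"

lemma representsD:
  assumes "represents p f g"
  shows "lp_cube p f" and "AE x in lborel. x \<in> unit_cube \<longrightarrow> x \<in> half_open_cube \<and> g x = f x"
proof -
  show "lp_cube p f" using assms by (simp add: represents_def)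
  from assms AE_half_open_cube show "AE x in lborel. x \<in> unit_cube \<longrightarrow> x \<in> half_open_cube \<and> g x = f x"
    unfolding represents_def by (auto elim: eventually_elim2)
qed

lemma represents_indicator_AE:
  assumes "represents p f g"
  shows "AE x in lborel. indicator unit_cube x * g x = f x"
  using representsD(2)[OF assms]
proof eventually_elim
  case (elim x)
  then show ?case
    using lp_cube_outside[OF representsD(1)[OF assms], of x] half_open_cube_subset
    by (auto simp: indicator_def)
qed

lemma represents_Lp_quasinorm:
  assumes p: "0 < p" and r: "represents p f g"
  shows "Lp_quasinorm p unit_cube g = lp_norm lborel p f"
proof -
  have [measurable]: "f \<in> borel_measurable borel" by (rule lp_cube_measurable[OF representsD(1)[OF r]])
  have "(LINT x:unit_cube|lebesgue. \<bar>g x\<bar> powr p) = (\<integral>x. \<bar>f x\<bar> powr p \<partial>lborel)"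
    unfolding set_lebesgue_integral_def
  proof (rule lebesgue_integral_AE)
    show "AE x in lborel. indicator unit_cube x *\<^sub>R \<bar>g x\<bar> powr p = \<bar>f x\<bar> powr p"
      using represents_indicator_AE[OF r]
    proof eventually_elim
      case (elim x) show ?case unfolding elim[symmetric] using p by (simp add: indicator_def)
    qed
  qed measurable
  then show ?thesis by (simp add: Lp_quasinorm_def lp_norm_def)
qed

lemma represents_Lp_space:
  assumes p: "0 < p" and r: "represents p f g"
  shows "g \<in> Lp_space p"
proof -
  have [measurable]: "f \<in> borel_measurable borel" by (rule lp_cube_measurable[OF representsD(1)[OF r]])
  have S: "unit_cube \<inter> space lebesgue \<in> sets lebesgue" by (simp add: unit_cube_def)
  have "(\<lambda>x. indicator unit_cube x *\<^sub>R g x) \<in> borel_measurable lebesgue"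
    using represents_indicator_AE[OF r] by (intro borel_measurable_lebesgue_AE[of f]) auto
  moreover have "integrable lebesgue (\<lambda>x. indicator unit_cube x *\<^sub>R \<bar>g x\<bar> powr p)"
  proof (subst lebesgue_integral_AE)
    show "AE x in lborel. indicator unit_cube x *\<^sub>R \<bar>g x\<bar> powr p = \<bar>f x\<bar> powr p"
      using represents_indicator_AE[OF r]
    proof eventually_elim
      case (elim x) show ?case unfolding elim[symmetric] using p by (simp add: indicator_def)
    qed
    show "integrable lborel (\<lambda>x. \<bar>f x\<bar> powr p)"
      by (rule in_lp_integrable[OF lp_cube_in_lp[OF representsD(1)[OF r]]])
  qed measurable
  ultimately show ?thesis
    unfolding Lp_space_def integrable_restrict_space[OF S] borel_measurable_restrict_space_iff[OF S] by simp
qed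

lemma represents_shift:
  assumes p: "0 < p" and r: "represents p f g"
  shows "Lp_quasinorm p (shift_domain y) (\<lambda>x. g (x + y) - g x) = lp_norm lborel p (shift_diff y f)"
proof -
  have [measurable]: "f \<in> borel_measurable borel" by (rule lp_cube_measurable[OF representsD(1)[OF r]])
  have "(LINT x:shift_domain y|lebesgue. \<bar>g (x + y) - g x\<bar> powr p) = (\<integral>x. \<bar>shift_diff y f x\<bar> powr p \<partial>lborel)"
    unfolding set_lebesgue_integral_def
  proof (rule lebesgue_integral_AE)
    show "AE x in lborel. indicator (shift_domain y) x *\<^sub>R \<bar>g (x + y) - g x\<bar> powr p = \<bar>shift_diff y f x\<bar> powr p"
      using representsD(2)[OF r] AE_lborel_translate[OF representsD(2)[OF r], of y]
    proof eventually_elim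
      case (elim x)
      then show ?case
        using p half_open_cube_subset by (auto simp: indicator_def shift_domain_def shift_diff_def)
    qed
  qed measurable
  then show ?thesis by (simp add: Lp_quasinorm_def lp_norm_def)
qed

lemma represents_modulus:
  assumes "0 < p" "represents p f g"
  shows "modulus p g = lp_modulus p f"
  by (intro ext) (simp add: modulus_def lp_modulus_def represents_shift[OF assms])

text \<open>A Lebesgue measurable function agrees almost everywhere with a Borel one, and cutting
  the latter down to the half-open cube costs only a null set.\<close>

lemma Lp_space_represents:
  fixes g :: "real ^ 'd \<Rightarrow> real"
  assumes p: "0 < p" and g: "g \<in> Lp_space p"
  obtains f where "represents p f g"
proof -
  have S: "unit_cube \<inter> space lebesgue \<in> sets lebesgue" by (simp add: unit_cube_def)
  have m: "(\<lambda>x. indicator unit_cube x *\<^sub>R g x) \<in> borel_measurable lebesgue"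
    and i: "integrable lebesgue (\<lambda>x. indicator unit_cube x *\<^sub>R \<bar>g x\<bar> powr p)"
    using g unfolding Lp_space_def integrable_restrict_space[OF S] borel_measurable_restrict_space_iff[OF S]
    by auto
  obtain g' where g' [measurable]: "g' \<in> borel_measurable borel" and "AE x in lborel. indicator unit_cube x *\<^sub>R g x = g' x"
    using completion_ex_borel_measurable_real[OF m] by auto
  then have AE: "AE x in lborel. indicator unit_cube x *\<^sub>R g x = indicator half_open_cube x * g' x"
    using AE_half_open_cube half_open_cube_subset
    by (auto elim!: eventually_elim2 simp: indicator_def split: if_splits)
  let ?f = "\<lambda>x. indicator half_open_cube x * g' x"
  have "integrable lborel (\<lambda>x. \<bar>?f x\<bar> powr p)"
  proof (subst lebesgue_integral_AE(1)[symmetric])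
    show "AE x in lborel. indicator unit_cube x *\<^sub>R \<bar>g x\<bar> powr p = \<bar>?f x\<bar> powr p"
      using AE
    proof eventually_elim
      case (elim x) show ?case unfolding elim[symmetric] using p by (simp add: indicator_def)
    qed
  qed (use i in measurable)
  then have "lp_cube p ?f" by (simp add: lp_cube_def in_lp_def)
  then have "represents p ?f g"
    unfolding represents_def using AE by (auto elim!: eventually_mono simp: indicator_def)
  then show thesis by (rule that)
qed

lemma represents_refl: "lp_cube p f \<Longrightarrow> represents p f f"
  by (simp add: represents_def)

lemma represents_diff:
  "0 < p \<Longrightarrow> represents p f g \<Longrightarrow> represents p f' g' \<Longrightarrow> represents p (\<lambda>x. f x - f' x) (\<lambda>x. g x - g' x)"
  by (auto simp: represents_def lp_cube_diff elim: eventually_elim2)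

lemma represents_lincomb:
  assumes "0 < p" "\<And>i. i \<in> I \<Longrightarrow> represents p (f i) (g i)"
  shows "represents p (\<lambda>x. \<Sum>i\<in>I. c i * f i x) (\<lambda>x. \<Sum>i\<in>I. c i * g i x)"
proof (cases "finite I")
  case True
  have "AE x in lborel. \<forall>i\<in>I. x \<in> unit_cube \<longrightarrow> g i x = f i x"
    using assms True by (intro AE_finite_allI) (auto simp: represents_def)
  then have "AE x in lborel. x \<in> unit_cube \<longrightarrow> (\<Sum>i\<in>I. c i * g i x) = (\<Sum>i\<in>I. c i * f i x)"
    by (auto elim!: eventually_mono intro!: sum.cong)
  then show ?thesis
    using assms by (auto simp: represents_def intro!: lp_cube_sum lp_cube_cmult)
next
  case False
  then show ?thesis using assms(1) by (simp add: represents_def lp_cube_def)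
qed

definition has_besov :: "real \<Rightarrow> real \<Rightarrow> (real ^ 'd \<Rightarrow> real) \<Rightarrow> bool" where
  "has_besov p q f \<longleftrightarrow> set_integrable lborel {0<..1} (\<lambda>t. lp_modulus p f t powr q / t)"

definition besov_norm :: "real \<Rightarrow> real \<Rightarrow> (real ^ 'd \<Rightarrow> real) \<Rightarrow> real" where
  "besov_norm p q f = (lp_norm lborel p f powr q
     + (LBINT t:{0<..1}. lp_modulus p f t powr q / t)) powr (1 / q)"

lemma represents_besov_space:
  "0 < p \<Longrightarrow> represents p f g \<Longrightarrow> g \<in> besov_space p q \<longleftrightarrow> has_besov p q f"
  by (simp add: besov_space_def has_besov_def represents_Lp_space represents_modulus)

lemma represents_besov_quasinorm:
  "0 < p \<Longrightarrow> represents p f g \<Longrightarrow> besov_quasinorm p q g = besov_norm p q f"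
  by (simp add: besov_quasinorm_def besov_norm_def represents_Lp_quasinorm represents_modulus)

section \<open>Monotonicity of the modulus and dyadic discretisation of dt / t\<close>

definition shift_const :: "real \<Rightarrow> real" where "shift_const p = 2 * 2 powr (1 / p)"

lemma lp_modulus_upper:
  assumes "0 < p" "lp_cube p f" "0 < norm y" "norm y \<le> t"
  shows "lp_norm lborel p (shift_diff y f) \<le> lp_modulus p f t"
  unfolding lp_modulus_def
  by (rule cSUP_upper, use assms in simp)
     (use lp_norm_shift_diff_le[OF assms(1,2)] in \<open>auto intro!: bdd_aboveI2\<close>)

lemma lp_modulus_least:
  fixes f :: "real ^ 'd \<Rightarrow> real"
  assumes "0 < t" "\<And>y. 0 < norm y \<Longrightarrow> norm y \<le> t \<Longrightarrow> lp_norm lborel p (shift_diff y f) \<le> B"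
  shows "lp_modulus p f t \<le> B"
  unfolding lp_modulus_def
proof (rule cSUP_least)
  obtain y :: "real ^ 'd" where "norm y = t" using vector_choose_size[of t] assms(1) by auto
  then show "{y :: real ^ 'd. 0 < norm y \<and> norm y \<le> t} \<noteq> {}" using assms(1) by auto
qed (use assms in auto)

lemma lp_modulus_nonneg:
  fixes f :: "real ^ 'd \<Rightarrow> real"
  assumes "0 < p" "lp_cube p f" "0 < t"
  shows "0 \<le> lp_modulus p f t"
proof -
  obtain y :: "real ^ 'd" where "norm y = t" using vector_choose_size[of t] assms(3) by auto
  then show ?thesis
    using lp_modulus_upper[OF assms(1,2), of y t] assms(3) lp_norm_nonneg[of lborel p "shift_diff y f"] by linarith
qed

lemma lp_modulus_mono:
  assumes "0 < p" "lp_cube p f" "0 < s" "s \<le> t"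
  shows "lp_modulus p f s \<le> lp_modulus p f t"
  using assms by (intro lp_modulus_least lp_modulus_upper) auto

lemma lp_modulus_le:
  assumes "0 < p" "lp_cube p f" "0 < t"
  shows "lp_modulus p f t \<le> shift_const p * lp_norm lborel p f"
  using assms lp_norm_shift_diff_le[OF assms(1,2)] by (intro lp_modulus_least) (auto simp: shift_const_def)

lemma dyadic_intervals_cover:
  "(\<Union>k. {1 / 2 ^ Suc k <.. 1 / 2 ^ k}) = {0 <.. 1 :: real}"
proof (intro equalityI subsetI)
  fix t :: real assume t: "t \<in> {0<..1}"
  define P where "P k \<longleftrightarrow> 1 / 2 ^ k < t" for k
  obtain n where "(1 / 2) ^ n < t" using real_arch_pow_inv[of t "1/2"] t by auto
  then have ex: "P n" by (simp add: P_def power_one_over)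
  define m where "m = (LEAST k. P k)"
  have Pm: "P m" unfolding m_def using ex by (rule LeastI)
  have "m \<noteq> 0"
  proof
    assume "m = 0"
    with Pm t show False by (simp add: P_def)
  qed
  then obtain k where k: "m = Suc k" using not0_implies_Suc by blast
  have "\<not> P k" using k not_less_Least[of k P] by (simp add: m_def)
  then show "t \<in> (\<Union>k. {1 / 2 ^ Suc k <.. 1 / 2 ^ k})"
    using Pm k by (auto simp: P_def not_less intro!: exI[of _ k])
next
  fix t :: real assume "t \<in> (\<Union>k. {1 / 2 ^ Suc k <.. 1 / 2 ^ k})"
  then obtain k where k: "1 / 2 ^ Suc k < t" "t \<le> 1 / 2 ^ k" by auto
  have "0 < 1 / (2::real) ^ Suc k" "1 / (2::real) ^ k \<le> 1" by (auto simp: field_simps)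
  with k show "t \<in> {0<..1}" unfolding greaterThanAtMost_iff by linarith
qed

lemma dyadic_intervals_disjoint: "disjoint_family (\<lambda>k. {1 / 2 ^ Suc k <.. 1 / 2 ^ k :: real})"
proof -
  have "{1 / 2 ^ Suc m <.. 1 / 2 ^ m} \<inter> {1 / 2 ^ Suc n <.. 1 / 2 ^ n} = ({} :: real set)" if "m < n" for m n
  proof -
    have "1 / 2 ^ n \<le> 1 / (2::real) ^ Suc m"
      using that by (intro divide_left_mono power_increasing) auto
    then show ?thesis by auto
  qed
  then show ?thesis unfolding disjoint_family_on_def by (metis Int_commute linorder_neqE_nat)
qed

text \<open>On the interval from 2^-(k+1) to 2^-k, of length 2^-(k+1), the factor 1 / t lies between
  2^k and 2^(k+1). By monotonicity of w the integral is at most the value at the right end and at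
  least half the value at the left end, whence the factor 2. The left ends start with t = 1 /
  2.\<close>

lemma dyadic_discretisation:
  fixes w :: "real \<Rightarrow> real"
  assumes mono: "\<And>s t. 0 < s \<Longrightarrow> s \<le> t \<Longrightarrow> w s \<le> w t" and nonneg: "\<And>t. 0 < t \<Longrightarrow> 0 \<le> w t" and q: "0 < q"
  defines "I \<equiv> \<integral>\<^sup>+t. ennreal (w t powr q / t) * indicator {0<..1} t \<partial>lborel"
  shows "(\<lambda>t. indicator {0<..1} t *\<^sub>R (w t powr q / t)) \<in> borel_measurable borel"
    and "I \<le> (\<Sum>k. ennreal (w (1 / 2 ^ k) powr q))"
    and "(\<Sum>k. ennreal (w (1 / 2 ^ Suc k) powr q)) \<le> 2 * I"
proof -
  have "w \<in> borel_measurable (restrict_space borel {0<..})"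
    by (rule borel_measurable_mono_on_fnc) (auto simp: mono_on_def intro: mono)
  then have w [measurable]: "(\<lambda>t. indicator {0<..} t *\<^sub>R w t) \<in> borel_measurable borel"
    by (subst (asm) borel_measurable_restrict_space_iff) auto
  have e: "indicator {0<..1} t *\<^sub>R (w t powr q / t) = indicator {0<..1} t * ((indicator {0<..} t *\<^sub>R w t) powr q / t)" for t
    by (auto simp: indicator_def)
  show m [measurable]: "(\<lambda>t. indicator {0<..1} t *\<^sub>R (w t powr q / t)) \<in> borel_measurable borel"
    unfolding e by measurable
  define J where "J k = {1 / 2 ^ Suc k <.. 1 / 2 ^ k :: real}" for k
  have J01: "J k \<subseteq> {0<..1}" for k using dyadic_intervals_cover by (auto simp: J_def)
  let ?g = "\<lambda>t. ennreal (indicator {0<..1} t *\<^sub>R (w t powr q / t))"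
  have "I = (\<integral>\<^sup>+t. ?g t * indicator (\<Union>k. J k) t \<partial>lborel)"
    unfolding I_def J_def dyadic_intervals_cover by (intro nn_integral_cong) (auto simp: indicator_def)
  also have "\<dots> = (\<Sum>k. \<integral>\<^sup>+t. ?g t * indicator (J k) t \<partial>lborel)"
  proof (rule nn_integral_disjoint_family)
    show "?g \<in> borel_measurable lborel" using m by (intro measurable_compose[OF _ measurable_ennreal]) simp
  qed (use dyadic_intervals_disjoint in \<open>auto simp: J_def\<close>)
  finally have I: "I = (\<Sum>k. \<integral>\<^sup>+t. ?g t * indicator (J k) t \<partial>lborel)" .
  have len: "emeasure lborel (J k) = ennreal (1 / 2 ^ Suc k)" for k
    by (simp add: J_def field_simps)
  have Jsets: "J k \<in> sets borel" for k by (simp add: J_def)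
  have up: "(\<integral>\<^sup>+t. ?g t * indicator (J k) t \<partial>lborel) \<le> ennreal (w (1 / 2 ^ k) powr q)" for k
  proof -
    have "w t powr q / t \<le> w (1 / 2 ^ k) powr q * 2 ^ Suc k" if t: "t \<in> J k" for t
    proof -
      have t0: "0 < t" using J01[of k] t by auto
      have "1 / t \<le> 2 ^ Suc k" using t t0 by (simp add: J_def field_simps)
      moreover have "w t powr q \<le> w (1 / 2 ^ k) powr q"
        using t t0 q by (intro powr_mono2 nonneg mono) (auto simp: J_def)
      ultimately have "w t powr q * (1 / t) \<le> w (1 / 2 ^ k) powr q * 2 ^ Suc k"
        using t0 by (intro mult_mono) auto
      then show ?thesis by simp
    qed
    then have "(\<integral>\<^sup>+t. ?g t * indicator (J k) t \<partial>lborel)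
        \<le> (\<integral>\<^sup>+t. ennreal (w (1 / 2 ^ k) powr q * 2 ^ Suc k) * indicator (J k) t \<partial>lborel)"
      using J01[of k] by (intro nn_integral_mono) (auto simp: indicator_def subset_iff intro!: ennreal_leI)
    also have "\<dots> = ennreal (w (1 / 2 ^ k) powr q * 2 ^ Suc k) * ennreal (1 / 2 ^ Suc k)"
      by (subst nn_integral_cmult_indicator) (simp_all add: len Jsets)
    also have "\<dots> = ennreal (w (1 / 2 ^ k) powr q)"
      by (subst ennreal_mult[symmetric]) auto
    finally show ?thesis .
  qed
  then show "I \<le> (\<Sum>k. ennreal (w (1 / 2 ^ k) powr q))"
    unfolding I by (intro suminf_le) auto
  have low: "ennreal (w (1 / 2 ^ Suc k) powr q) \<le> 2 * (\<integral>\<^sup>+t. ?g t * indicator (J k) t \<partial>lborel)" for k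
  proof -
    have "w (1 / 2 ^ Suc k) powr q * 2 ^ k \<le> w t powr q / t" if t: "t \<in> J k" for t
    proof -
      have t0: "0 < t" using J01[of k] t by auto
      have "2 ^ k \<le> 1 / t" using t t0 by (simp add: J_def field_simps)
      moreover have "w (1 / 2 ^ Suc k) powr q \<le> w t powr q"
        using t t0 q by (intro powr_mono2 nonneg mono) (auto simp: J_def)
      ultimately have "w (1 / 2 ^ Suc k) powr q * 2 ^ k \<le> w t powr q * (1 / t)"
        using t0 by (intro mult_mono) auto
      then show ?thesis by simp
    qed
    then have "(\<integral>\<^sup>+t. ennreal (w (1 / 2 ^ Suc k) powr q * 2 ^ k) * indicator (J k) t \<partial>lborel)
        \<le> (\<integral>\<^sup>+t. ?g t * indicator (J k) t \<partial>lborel)"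
      using J01[of k] by (intro nn_integral_mono) (auto simp: indicator_def subset_iff intro!: ennreal_leI)
    moreover have "(\<integral>\<^sup>+t. ennreal (w (1 / 2 ^ Suc k) powr q * 2 ^ k) * indicator (J k) t \<partial>lborel)
       = ennreal (w (1 / 2 ^ Suc k) powr q * 2 ^ k) * ennreal (1 / 2 ^ Suc k)"
      by (subst nn_integral_cmult_indicator) (simp_all add: len Jsets)
    moreover have "ennreal (w (1 / 2 ^ Suc k) powr q) = 2 * (ennreal (w (1 / 2 ^ Suc k) powr q * 2 ^ k) * ennreal (1 / 2 ^ Suc k))"
      unfolding ennreal_numeral[symmetric] by (subst ennreal_mult[symmetric], simp, simp)+ simp
    ultimately show ?thesis by (simp only:) (intro mult_left_mono, auto)
  qed
  have "(\<Sum>k. ennreal (w (1 / 2 ^ Suc k) powr q)) \<le> (\<Sum>k. 2 * (\<integral>\<^sup>+t. ?g t * indicator (J k) t \<partial>lborel))"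
    using low by (intro suminf_le) auto
  then show "(\<Sum>k. ennreal (w (1 / 2 ^ Suc k) powr q)) \<le> 2 * I"
    unfolding I by simp
qed

section \<open>Besov norms and dyadic approximation errors\<close>

lemma has_besovI:
  fixes f :: "real ^ 'd \<Rightarrow> real"
  assumes p: "0 < p" and q: "0 < q" and f: "lp_cube p f"
    and sum: "summable (\<lambda>k. lp_modulus p f (1 / 2 ^ k) powr q)"
  shows "has_besov p q f"
    and "besov_norm p q f powr q \<le> lp_norm lborel p f powr q + (\<Sum>k. lp_modulus p f (1 / 2 ^ k) powr q)"
proof -
  let ?w = "lp_modulus p f"
  let ?g = "\<lambda>t. indicator {0<..1} t *\<^sub>R (?w t powr q / t)"
  note disc = dyadic_discretisation[where w="lp_modulus p f", OF lp_modulus_mono[OF p f] lp_modulus_nonneg[OF p f] q]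
  have nn: "0 \<le> ?g t" for t by (auto simp: indicator_def)
  have "(\<integral>\<^sup>+t. ennreal (?g t) \<partial>lborel) = (\<integral>\<^sup>+t. ennreal (?w t powr q / t) * indicator {0<..1} t \<partial>lborel)"
    by (intro nn_integral_cong) (auto simp: indicator_def)
  also have "\<dots> \<le> (\<Sum>k. ennreal (?w (1 / 2 ^ k) powr q))" by (rule disc(2))
  also have "\<dots> = ennreal (\<Sum>k. ?w (1 / 2 ^ k) powr q)" using sum by (intro suminf_ennreal2) auto
  finally have le: "(\<integral>\<^sup>+t. ennreal (?g t) \<partial>lborel) \<le> ennreal (\<Sum>k. ?w (1 / 2 ^ k) powr q)" .
  have int: "integrable lborel ?g"
  proof (rule integrableI_nonneg)
    show "(\<integral>\<^sup>+t. ennreal (?g t) \<partial>lborel) < \<infinity>" using le_less_trans[OF le] by simp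
  qed (use disc(1) nn in auto)
  then show "has_besov p q f" by (simp add: has_besov_def set_integrable_def)
  have "ennreal (\<integral>t. ?g t \<partial>lborel) \<le> ennreal (\<Sum>k. ?w (1 / 2 ^ k) powr q)"
    using le nn_integral_eq_integral[OF int] nn by simp
  then have "(\<integral>t. ?g t \<partial>lborel) \<le> (\<Sum>k. ?w (1 / 2 ^ k) powr q)"
    using suminf_nonneg[OF sum] by (simp add: ennreal_le_iff)
  moreover have "0 \<le> (\<integral>t. ?g t \<partial>lborel)" using nn by (intro Bochner_Integration.integral_nonneg) auto
  ultimately show "besov_norm p q f powr q \<le> lp_norm lborel p f powr q + (\<Sum>k. ?w (1 / 2 ^ k) powr q)"
    using q by (simp add: besov_norm_def powr_powr set_lebesgue_integral_def)
qed

lemma besov_norm_powr: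
  assumes "0 < q"
  shows "besov_norm p q f powr q = lp_norm lborel p f powr q + (LBINT t:{0<..1}. lp_modulus p f t powr q / t)"
    and "0 \<le> (LBINT t:{0<..1}. lp_modulus p f t powr q / t)"
proof -
  show nn: "0 \<le> (LBINT t:{0<..1}. lp_modulus p f t powr q / t)"
    unfolding set_lebesgue_integral_def by (intro Bochner_Integration.integral_nonneg) (auto simp: indicator_def)
  show "besov_norm p q f powr q = lp_norm lborel p f powr q + (LBINT t:{0<..1}. lp_modulus p f t powr q / t)"
    using assms nn by (simp add: besov_norm_def powr_powr)
qed

text \<open>The series starts at t = 1 / 2 because the integral does not see the value of the
  modulus at the end point 1.\<close>

lemma has_besovD:
  fixes f :: "real ^ 'd \<Rightarrow> real"
  assumes p: "0 < p" and q: "0 < q" and f: "lp_cube p f" and b: "has_besov p q f"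
  shows "summable (\<lambda>k. lp_modulus p f (1 / 2 ^ Suc k) powr q)"
    and "(\<Sum>k. lp_modulus p f (1 / 2 ^ Suc k) powr q) \<le> 2 * besov_norm p q f powr q"
proof -
  let ?w = "lp_modulus p f"
  let ?g = "\<lambda>t. indicator {0<..1} t *\<^sub>R (?w t powr q / t)"
  note disc = dyadic_discretisation[where w="lp_modulus p f", OF lp_modulus_mono[OF p f] lp_modulus_nonneg[OF p f] q]
  have nn: "0 \<le> ?g t" for t by (auto simp: indicator_def)
  have int: "integrable lborel ?g" using b by (simp add: has_besov_def set_integrable_def)
  have "(\<integral>\<^sup>+t. ennreal (?w t powr q / t) * indicator {0<..1} t \<partial>lborel) = (\<integral>\<^sup>+t. ennreal (?g t) \<partial>lborel)"
    by (intro nn_integral_cong) (auto simp: indicator_def)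
  also have "\<dots> = ennreal (\<integral>t. ?g t \<partial>lborel)" using nn by (intro nn_integral_eq_integral int) auto
  finally have "(\<integral>\<^sup>+t. ennreal (?w t powr q / t) * indicator {0<..1} t \<partial>lborel) = ennreal (\<integral>t. ?g t \<partial>lborel)" .
  with disc(3) have "(\<Sum>k. ennreal (?w (1 / 2 ^ Suc k) powr q)) \<le> 2 * ennreal (\<integral>t. ?g t \<partial>lborel)"
    by (simp only:)
  also have "\<dots> \<le> 2 * ennreal (besov_norm p q f powr q)"
    using besov_norm_powr[OF q, of p f]
    by (intro mult_left_mono ennreal_leI) (auto simp: set_lebesgue_integral_def)
  also have "\<dots> = ennreal (2 * besov_norm p q f powr q)"
    unfolding ennreal_numeral[symmetric] by (subst ennreal_mult[symmetric]) auto
  finally have le: "(\<Sum>k. ennreal (?w (1 / 2 ^ Suc k) powr q)) \<le> ennreal (2 * besov_norm p q f powr q)" .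
  then have "(\<Sum>k. ennreal (?w (1 / 2 ^ Suc k) powr q)) \<noteq> top" by (auto simp: top_unique)
  then show s: "summable (\<lambda>k. ?w (1 / 2 ^ Suc k) powr q)"
    by (rule summable_suminf_not_top[rotated]) auto
  show "(\<Sum>k. ?w (1 / 2 ^ Suc k) powr q) \<le> 2 * besov_norm p q f powr q"
    using le suminf_nonneg[OF s] by (subst (asm) suminf_ennreal2[OF _ s]) (auto simp: ennreal_le_iff)
qed

section \<open>Equivalence with the errors of dyadic averages\<close>

definition approx_err :: "real \<Rightarrow> (real ^ 'd \<Rightarrow> real) \<Rightarrow> nat \<Rightarrow> real" where
  "approx_err p f k = lp_norm lborel p (\<lambda>x. f x - avg k f x)"

lemma approx_err_nonneg [simp]: "0 \<le> approx_err p f k"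
  by (simp add: approx_err_def)

lemma lp_cube_approx: "0 < p \<Longrightarrow> lp_cube p f \<Longrightarrow> lp_cube p (\<lambda>x. f x - avg k f x)"
  by (intro lp_cube_diff lp_cube_walsh_coeff)

lemma approx_err_le:
  assumes "1 \<le> p" "lp_cube p f"
  shows "approx_err p f k \<le> 2 * lp_norm lborel p f"
  using lp_norm_triangle_diff[OF assms(1) lp_cube_in_lp[OF assms(2)] lp_cube_in_lp[OF lp_cube_walsh_coeff[where k=k and e="{}" and f=f]]]
    lp_norm_avg_le[OF assms, of k] assms
  by (simp add: approx_err_def)

lemma besov_lower:
  fixes p q :: real
  assumes p: "1 \<le> p" and q: "0 < q"
  shows "\<exists>C. \<forall>f :: real ^ 'd \<Rightarrow> real. lp_cube p f \<longrightarrow> has_besov p q f \<longrightarrow>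
    summable (\<lambda>k. approx_err p f k powr q) \<and> (\<Sum>k. approx_err p f k powr q) \<le> C * besov_norm p q f powr q"
proof (intro exI allI impI)
  fix f :: "real ^ 'd \<Rightarrow> real"
  assume f: "lp_cube p f" and b: "has_besov p q f"
  let ?d = "CARD('d)"
  let ?E = "\<lambda>k. approx_err p f k powr q"
  let ?C1 = "(2 powr (?d / p)) powr q"
  have p0: "0 < p" using p by simp
  \<comment> \<open>Jackson's inequality asks for shifts of length up to \<open>?d / 2 ^ n\<close>.
    As \<open>?d\<close> is at most \<open>2 ^ ?d\<close>, raising the level by
    \<open>Suc ?d\<close> makes them shorter than \<open>1 / 2 ^ Suc k\<close>. The first
    \<open>Suc ?d\<close> errors, lost by this shift of the index, are bounded by the L_p
    norm.\<close>
  have sh: "?E (k + Suc ?d) \<le> ?C1 * lp_modulus p f (1 / 2 ^ Suc k) powr q" for k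
  proof -
    have "real ?d \<le> 2 ^ ?d" by (rule less_imp_le[OF of_nat_less_two_power])
    then have le: "real ?d / 2 ^ (k + Suc ?d) \<le> 1 / 2 ^ Suc k" by (simp add: field_simps power_add)
    have "lp_norm lborel p (\<lambda>x. f x - avg (k + Suc ?d) f x) \<le> 2 powr (?d / p) * lp_modulus p f (1 / 2 ^ Suc k)"
      using lp_modulus_nonneg[OF p0 f] lp_modulus_upper[OF p0 f] le by (intro jackson p f) fastforce+
    then have "?E (k + Suc ?d) \<le> (2 powr (?d / p) * lp_modulus p f (1 / 2 ^ Suc k)) powr q"
      using q by (intro powr_mono2) (auto simp: approx_err_def)
    then show ?thesis using lp_modulus_nonneg[OF p0 f, of "1 / 2 ^ Suc k"] by (simp add: powr_mult)
  qed
  note D = has_besovD[OF p0 q f b]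
  have s': "summable (\<lambda>k. ?E (k + Suc ?d))"
    by (rule summable_comparison_test'[OF summable_mult[OF D(1), of ?C1]]) (use sh in auto)
  then have s: "summable ?E" by (subst (asm) summable_iff_shift)
  have head: "?E k \<le> 2 powr q * besov_norm p q f powr q" for k
  proof -
    have "?E k \<le> (2 * lp_norm lborel p f) powr q"
      using approx_err_le[OF p f] q by (intro powr_mono2) auto
    also have "\<dots> \<le> 2 powr q * besov_norm p q f powr q"
      using besov_norm_powr[OF q, of p f] by (auto simp: powr_mult intro!: mult_left_mono)
    finally show ?thesis .
  qed
  have "(\<Sum>k. ?E k) = (\<Sum>k. ?E (k + Suc ?d)) + (\<Sum>k<Suc ?d. ?E k)"
    by (rule suminf_split_initial_segment[OF s])
  also have "(\<Sum>k. ?E (k + Suc ?d)) \<le> ?C1 * (2 * besov_norm p q f powr q)"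
  proof -
    have "(\<Sum>k. ?E (k + Suc ?d)) \<le> (\<Sum>k. ?C1 * lp_modulus p f (1 / 2 ^ Suc k) powr q)"
      by (rule suminf_le[OF _ s' summable_mult[OF D(1)]]) (rule sh)
    also have "\<dots> = ?C1 * (\<Sum>k. lp_modulus p f (1 / 2 ^ Suc k) powr q)"
      by (rule suminf_mult[OF D(1)])
    also have "\<dots> \<le> ?C1 * (2 * besov_norm p q f powr q)"
      by (rule mult_left_mono[OF D(2)]) simp
    finally show ?thesis .
  qed
  also have "(\<Sum>k<Suc ?d. ?E k) \<le> (\<Sum>k<Suc ?d. 2 powr q * besov_norm p q f powr q)"
    using head by (intro sum_mono)
  finally have "(\<Sum>k. ?E k) \<le> (?C1 * 2 + (real ?d + 1) * 2 powr q) * besov_norm p q f powr q"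
    by (simp add: algebra_simps)
  with s show "summable ?E \<and> (\<Sum>k. ?E k) \<le> (?C1 * 2 + (real ?d + 1) * 2 powr q) * besov_norm p q f powr q"
    by simp
qed

lemma shift_diff_add: "shift_diff y (\<lambda>x. f x + g x) = (\<lambda>x. shift_diff y f x + shift_diff y g x)"
  by (auto simp: shift_diff_def)

lemma shift_diff_sum: "shift_diff y (\<lambda>x. \<Sum>i\<in>I. f i x) = (\<lambda>x. \<Sum>i\<in>I. shift_diff y (f i) x)"
  by (rule ext, case_tac "x \<in> half_open_cube \<and> x + y \<in> half_open_cube")
     (auto simp: shift_diff_def sum_subtractf)

definition bernstein_const :: "real \<Rightarrow> nat \<Rightarrow> real" where
  "bernstein_const p d = (2 powr (p + 1) * d) powr (1 / p)"

lemma approx_err_diff: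
  fixes f :: "real ^ 'd \<Rightarrow> real"
  assumes "1 \<le> p" "lp_cube p f"
  shows "lp_norm lborel p (\<lambda>x. avg (Suc j) f x - avg j f x) \<le> approx_err p f j + approx_err p f (Suc j)"
proof -
  have p0: "0 < p" using assms by simp
  have "(\<lambda>x. avg (Suc j) f x - avg j f x) = (\<lambda>x. (f x - avg j f x) - (f x - avg (Suc j) f x))" by auto
  then show ?thesis
    unfolding approx_err_def
    using lp_norm_triangle_diff[OF assms(1) lp_cube_in_lp[OF lp_cube_approx[OF p0 assms(2), of j]]
        lp_cube_in_lp[OF lp_cube_approx[OF p0 assms(2), of "Suc j"]]] by simp
qed

text \<open>f is telescoped into its error at scale k, the increments \<open>D j\<close> with j < k,
  and \<open>avg 0 f\<close>. Shifts are estimated trivially for the error and by Bernstein for the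
  increments, where level j + 1 gains r^(k-j-1). The result is a geometric convolution, the input of
  \<open>discrete_hardy\<close>.\<close>

lemma lp_modulus_approx_err:
  fixes f :: "real ^ 'd \<Rightarrow> real"
  assumes p: "1 \<le> p" and f: "lp_cube p f"
  defines "r \<equiv> 2 powr (- (1 / p))"
  shows "lp_modulus p f (1 / 2 ^ k) \<le> (\<Sum>j\<le>k. r ^ (k - j) *
     ((shift_const p + bernstein_const p CARD('d) * (1 / r + 1)) * approx_err p f j))"
proof (rule lp_modulus_least)
  fix y :: "real ^ 'd" assume y: "0 < norm y" "norm y \<le> 1 / 2 ^ k"
  let ?E = "approx_err p f"
  let ?K = "shift_const p"
  let ?B = "bernstein_const p CARD('d)"
  have p0: "0 < p" using p by simp
  have r0: "0 < r" by (simp add: r_def)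
  have K0: "0 \<le> ?K" and B0: "0 \<le> ?B" by (simp_all add: shift_const_def bernstein_const_def)
  define D where "D j x = avg (Suc j) f x - avg j f x" for j x
  have stepavg: "step j (avg j f)" for j by (rule walsh_coeff_step[OF lp_cube_outside[OF f]])
  have stepD': "step (Suc j) (D j)" for j
    unfolding D_def by (rule step_compose2[OF stepavg step_mono[OF stepavg]]) auto
  have tel: "f x = (f x - avg k f x) + ((\<Sum>j<k. D j x) + avg 0 f x)" for x
    unfolding D_def by (subst sum_lessThan_telescope) simp
  \<comment> \<open>The whole half-open cube is a single cell of level 0, so \<open>avg 0 f\<close>
    has no differences inside it.\<close>
  have s0: "shift_diff y (avg 0 f) = (\<lambda>_. 0)"
  proof
    fix x
    have "x \<in> half_open_cube \<Longrightarrow> x + y \<in> half_open_cube \<Longrightarrow> grid 0 (x + y) = grid 0 x"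
      by (auto simp: half_open_cube_iff[of _ 0] intro!: ext) (metis atLeastLessThan_iff int_one_le_iff_zero_less not_less order_antisym)
    then show "shift_diff y (avg 0 f) x = 0"
      using stepD[OF stepavg, of 0 "x + y" x] by (auto simp: shift_diff_def)
  qed
  have "shift_diff y f = shift_diff y (\<lambda>x. (f x - avg k f x) + ((\<Sum>j<k. D j x) + avg 0 f x))"
    by (subst (1) tel[abs_def]) (rule refl)
  also have "\<dots> = (\<lambda>x. shift_diff y (\<lambda>x. f x - avg k f x) x + (\<Sum>j<k. shift_diff y (D j) x))"
    unfolding shift_diff_add shift_diff_sum s0 by simp
  finally have split: "shift_diff y f = (\<lambda>x. shift_diff y (\<lambda>x. f x - avg k f x) x + (\<Sum>j<k. shift_diff y (D j) x))" .
  have "lp_norm lborel p (shift_diff y f)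
     \<le> lp_norm lborel p (shift_diff y (\<lambda>x. f x - avg k f x)) + lp_norm lborel p (\<lambda>x. \<Sum>j<k. shift_diff y (D j) x)"
    unfolding split
  proof (rule lp_norm_triangle[OF p])
    show "in_lp lborel p (shift_diff y (\<lambda>x. f x - avg k f x))"
      by (intro shift_diff_in_lp lp_cube_approx p0 f)
    show "in_lp lborel p (\<lambda>x. \<Sum>j<k. shift_diff y (D j) x)"
      by (intro in_lp_sum shift_diff_in_lp step_lp_cube[OF stepD'] p0)
  qed
  also have "lp_norm lborel p (shift_diff y (\<lambda>x. f x - avg k f x)) \<le> ?K * ?E k"
    using lp_norm_shift_diff_le[OF p0 lp_cube_approx[OF p0 f]] by (simp add: approx_err_def shift_const_def)
  also have "lp_norm lborel p (\<lambda>x. \<Sum>j<k. shift_diff y (D j) x) \<le> (\<Sum>j<k. lp_norm lborel p (shift_diff y (D j)))"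
    using p p0 stepD' by (intro lp_norm_sum shift_diff_in_lp step_lp_cube) auto
  also have "\<dots> \<le> (\<Sum>j<k. ?B * (1 / r * r ^ (k - j) * ?E j + r ^ (k - Suc j) * ?E (Suc j)))"
  proof (rule sum_mono)
    fix j assume j: "j \<in> {..<k}"
    have "lp_norm lborel p (shift_diff y (D j)) \<le> ?B * (2 ^ Suc j * norm y) powr (1 / p) * lp_norm lborel p (D j)"
      unfolding bernstein_const_def by (rule bernstein[OF p0 stepD'])
    also have "\<dots> \<le> ?B * r ^ (k - Suc j) * (?E j + ?E (Suc j))"
    proof (intro mult_mono)
      have "(2 ^ Suc j * norm y) \<le> 2 ^ Suc j * (1 / 2 ^ k)" using y by (intro mult_left_mono) auto
      also have "\<dots> = 2 powr (- real (k - Suc j))"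
      proof -
        have "(2::real) ^ k = 2 ^ Suc j * 2 ^ (k - Suc j)" using j by (simp flip: power_add power_Suc)
        then show ?thesis by (simp add: powr_minus_divide powr_realpow del: power_Suc)
      qed
      finally have "(2 ^ Suc j * norm y) powr (1 / p) \<le> (2 powr (- real (k - Suc j))) powr (1 / p)"
        using p by (intro powr_mono2) auto
      also have "\<dots> = r ^ (k - Suc j)"
        by (simp add: r_def powr_powr powr_realpow[symmetric] mult.commute)
      finally show "(2 ^ Suc j * norm y) powr (1 / p) \<le> r ^ (k - Suc j)" .
      show "lp_norm lborel p (D j) \<le> ?E j + ?E (Suc j)"
        unfolding D_def by (rule approx_err_diff[OF p f])
    qed (use B0 r0 in auto)
    finally have "lp_norm lborel p (shift_diff y (D j)) \<le> ?B * r ^ (k - Suc j) * (?E j + ?E (Suc j))" .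
    \<comment> \<open>Rewrites \<open>r ^ (k - Suc j)\<close> as \<open>r ^ (k - j) / r\<close> for
      the term with \<open>?E j\<close>, so that both resulting sums are parts of the same
      convolution.\<close>
    moreover have "k - j = Suc (k - Suc j)" using j by auto
    ultimately show "lp_norm lborel p (shift_diff y (D j))
        \<le> ?B * (1 / r * r ^ (k - j) * ?E j + r ^ (k - Suc j) * ?E (Suc j))"
      using r0 by (simp add: algebra_simps)
  qed
  also have "\<dots> = ?B * (1 / r) * (\<Sum>j<k. r ^ (k - j) * ?E j) + ?B * (\<Sum>j<k. r ^ (k - Suc j) * ?E (Suc j))"
    by (simp add: sum.distrib sum_distrib_left algebra_simps)
  finally have main: "lp_norm lborel p (shift_diff y f) \<le> ?K * ?E k +
     (?B * (1 / r) * (\<Sum>j<k. r ^ (k - j) * ?E j) + ?B * (\<Sum>j<k. r ^ (k - Suc j) * ?E (Suc j)))"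
    by simp
  define S where "S = (\<Sum>j\<le>k. r ^ (k - j) * ?E j)"
  have S1: "(\<Sum>j<k. r ^ (k - j) * ?E j) \<le> S"
    unfolding S_def using r0 by (intro sum_mono2) auto
  have "(\<Sum>j<k. r ^ (k - Suc j) * ?E (Suc j)) = (\<Sum>j\<in>Suc ` {..<k}. r ^ (k - j) * ?E j)"
    by (subst sum.reindex) auto
  also have "\<dots> \<le> S"
    unfolding S_def using r0 by (intro sum_mono2) auto
  finally have S2: "(\<Sum>j<k. r ^ (k - Suc j) * ?E (Suc j)) \<le> S" .
  have "r ^ (k - k) * ?E k \<le> S"
    unfolding S_def using r0 by (intro member_le_sum) auto
  then have S3: "?E k \<le> S" by simp
  have "lp_norm lborel p (shift_diff y f) \<le> ?K * S + (?B * (1 / r) * S + ?B * S)"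
    using main mult_left_mono[OF S1, of "?B * (1 / r)"] mult_left_mono[OF S2 B0] mult_left_mono[OF S3 K0] B0 r0
    by simp
  also have "\<dots> = (?K + ?B * (1 / r + 1)) * S" by (simp add: algebra_simps)
  also have "\<dots> = (\<Sum>j\<le>k. r ^ (k - j) * ((?K + ?B * (1 / r + 1)) * ?E j))"
    by (simp add: S_def sum_distrib_left mult_ac)
  finally show "lp_norm lborel p (shift_diff y f) \<le> (\<Sum>j\<le>k. r ^ (k - j) * ((?K + ?B * (1 / r + 1)) * ?E j))" .
qed simp

lemma besov_upper:
  fixes p q :: real
  assumes p: "1 \<le> p" and q: "0 < q"
  shows "\<exists>C. \<forall>f :: real ^ 'd \<Rightarrow> real. lp_cube p f \<longrightarrow> summable (\<lambda>k. approx_err p f k powr q) \<longrightarrow>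
    has_besov p q f \<and> besov_norm p q f powr q \<le> lp_norm lborel p f powr q + C * (\<Sum>k. approx_err p f k powr q)"
proof -
  define r where "r = 2 powr (- (1 / p))"
  define A where "A = shift_const p + bernstein_const p CARD('d) * (1 / r + 1)"
  define H where "H = (1 / (1 - sqrt r)) powr q * (1 / (1 - sqrt r powr q))"
  have p0: "0 < p" using p by simp
  have r: "0 < r" "r < 1" using p by (auto simp: r_def powr_less_one)
  have A0: "0 \<le> A" using r by (simp add: A_def shift_const_def bernstein_const_def)
  show ?thesis
  proof (intro exI allI impI)
    fix f :: "real ^ 'd \<Rightarrow> real"
    assume f: "lp_cube p f" and s: "summable (\<lambda>k. approx_err p f k powr q)"
    have s': "summable (\<lambda>k. (A * approx_err p f k) powr q)"
      using summable_mult[OF s, of "A powr q"] A0 by (simp add: powr_mult)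
    have hardy: "summable (\<lambda>k. lp_modulus p f (1 / 2 ^ k) powr q) \<and>
       (\<Sum>k. lp_modulus p f (1 / 2 ^ k) powr q) \<le> H * (\<Sum>k. (A * approx_err p f k) powr q)"
      unfolding H_def
    proof (rule discrete_hardy[OF q r _ _ _ s'])
      show "lp_modulus p f (1 / 2 ^ k) \<le> (\<Sum>j\<le>k. r ^ (k - j) * (A * approx_err p f j))" for k
        unfolding A_def r_def by (rule lp_modulus_approx_err[OF p f])
      show "0 \<le> lp_modulus p f (1 / 2 ^ k)" for k by (rule lp_modulus_nonneg[OF p0 f]) simp
    qed (use A0 in auto)
    have "(\<Sum>k. (A * approx_err p f k) powr q) = A powr q * (\<Sum>k. approx_err p f k powr q)"
      using suminf_mult[OF s, of "A powr q"] A0 by (simp add: powr_mult)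
    with hardy has_besovI[OF p0 q f]
    show "has_besov p q f \<and> besov_norm p q f powr q \<le> lp_norm lborel p f powr q
        + (H * A powr q) * (\<Sum>k. approx_err p f k powr q)"
      by (auto simp: mult.assoc)
  qed
qed

lemma besov_norm_step:
  fixes p q :: real
  assumes p: "0 < p" and q: "0 < q"
  shows "\<exists>C. \<forall>n. \<forall>g :: real ^ 'd \<Rightarrow> real. step n g \<longrightarrow>
    has_besov p q g \<and> besov_norm p q g powr q \<le> C * (real n + 1) * lp_norm lborel p g powr q"
proof -
  define \<rho> where "\<rho> = 2 powr (- (q / p))"
  define K where "K = shift_const p powr q"
  define B where "B = bernstein_const p CARD('d) powr q"
  have \<rho>: "0 < \<rho>" "\<rho> < 1" using p q by (auto simp: \<rho>_def powr_less_one)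
  have KB: "0 \<le> K" "0 \<le> B" by (auto simp: K_def B_def)
  show ?thesis
  proof (intro exI allI impI)
    fix n and g :: "real ^ 'd \<Rightarrow> real"
    assume g: "step n g"
    let ?L = "lp_norm lborel p g"
    let ?w = "\<lambda>k. lp_modulus p g (1 / 2 ^ k) powr q"
    have lg: "lp_cube p g" by (rule step_lp_cube[OF g p])
    have head: "?w k \<le> K * ?L powr q" for k
    proof -
      have "?w k \<le> (shift_const p * ?L) powr q"
        using q lp_modulus_le[OF p lg] lp_modulus_nonneg[OF p lg] by (intro powr_mono2) auto
      then show ?thesis by (simp add: powr_mult K_def shift_const_def)
    qed
    have tail: "?w (k + n) \<le> B * ?L powr q * \<rho> ^ k" for k
    proof -
      have "lp_modulus p g (1 / 2 ^ (k + n)) \<le> bernstein_const p CARD('d) * (1 / 2 ^ k) powr (1 / p) * ?L"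
      proof (rule lp_modulus_least)
        fix y :: "real ^ 'd" assume y: "0 < norm y" "norm y \<le> 1 / 2 ^ (k + n)"
        have "2 ^ n * norm y \<le> 2 ^ n * (1 / 2 ^ (k + n))" using y by (intro mult_left_mono) auto
        then have "2 ^ n * norm y \<le> 1 / 2 ^ k" by (simp add: power_add)
        then have "(2 ^ n * norm y) powr (1 / p) \<le> (1 / 2 ^ k) powr (1 / p)"
          using p by (intro powr_mono2) auto
        then have "bernstein_const p CARD('d) * (2 ^ n * norm y) powr (1 / p) * ?L
            \<le> bernstein_const p CARD('d) * (1 / 2 ^ k) powr (1 / p) * ?L"
          by (intro mult_right_mono mult_left_mono) (auto simp: bernstein_const_def)
        with bernstein[OF p g, of y, folded bernstein_const_def]
        show "lp_norm lborel p (shift_diff y g) \<le> bernstein_const p CARD('d) * (1 / 2 ^ k) powr (1 / p) * ?L"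
          by (rule order_trans)
      qed simp
      then have "?w (k + n) \<le> (bernstein_const p CARD('d) * (1 / 2 ^ k) powr (1 / p) * ?L) powr q"
        using q lp_modulus_nonneg[OF p lg] by (intro powr_mono2) auto
      also have "\<dots> = B * ?L powr q * ((1 / 2 ^ k) powr (1 / p)) powr q"
        by (simp add: powr_mult B_def bernstein_const_def)
      also have "((1 / 2 ^ k) powr (1 / p)) powr q = \<rho> ^ k"
      proof -
        have "(1 / 2 ^ k :: real) = 2 powr (- real k)" by (simp add: powr_minus powr_realpow divide_inverse)
        then show ?thesis by (simp add: powr_powr \<rho>_def powr_realpow[symmetric] mult.commute)
      qed
      finally show ?thesis .
    qed
    have geo: "summable (\<lambda>k. B * ?L powr q * \<rho> ^ k)" using \<rho> by (intro summable_mult summable_geometric) auto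
    have s': "summable (\<lambda>k. ?w (k + n))"
      by (rule summable_comparison_test'[OF geo]) (use tail in auto)
    then have s: "summable ?w" by (subst (asm) summable_iff_shift)
    have "(\<Sum>k. ?w k) = (\<Sum>k. ?w (k + n)) + (\<Sum>k<n. ?w k)"
      by (rule suminf_split_initial_segment[OF s])
    also have "(\<Sum>k. ?w (k + n)) \<le> (\<Sum>k. B * ?L powr q * \<rho> ^ k)"
      by (rule suminf_le[OF tail s' geo])
    also have "\<dots> = B * ?L powr q * (1 / (1 - \<rho>))"
      using \<rho> by (subst suminf_mult) (auto intro: summable_geometric simp: suminf_geometric)
    also have "(\<Sum>k<n. ?w k) \<le> (\<Sum>k<n. K * ?L powr q)" using head by (intro sum_mono)
    finally have le: "(\<Sum>k. ?w k) \<le> (B / (1 - \<rho>) + K * n) * ?L powr q"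
      by (simp add: algebra_simps)
    have "besov_norm p q g powr q \<le> ?L powr q + (\<Sum>k. ?w k)" by (rule has_besovI(2)[OF p q lg s])
    also have "\<dots> \<le> (1 + B / (1 - \<rho>) + K * n) * ?L powr q" using le by (simp add: algebra_simps)
    also have "\<dots> \<le> ((1 + B / (1 - \<rho>) + K) * (real n + 1)) * ?L powr q"
    proof (rule mult_right_mono)
      have "c + K * n \<le> (c + K) * (real n + 1)" if "0 \<le> c" for c
        using that KB by (simp add: algebra_simps)
      then show "1 + B / (1 - \<rho>) + K * n \<le> (1 + B / (1 - \<rho>) + K) * (real n + 1)"
        using KB \<rho> by simp
    qed auto
    finally show "has_besov p q g \<and>
        besov_norm p q g powr q \<le> (1 + B / (1 - \<rho>) + K) * (real n + 1) * ?L powr q"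
      using has_besovI(1)[OF p q lg s] by simp
  qed
qed

section \<open>The Haar system\<close>

text \<open>The index i starts at 1, as in \<open>dyadic_interval\<close>, whereas
  \<open>grid\<close> starts at 0. The set e consists of the directions in which the function
  oscillates.\<close>

definition haar_cell :: "nat \<Rightarrow> ('d \<Rightarrow> nat) \<Rightarrow> 'd set \<Rightarrow> real ^ 'd \<Rightarrow> real" where
  "haar_cell k i e x = (if grid k x = (\<lambda>l. int (i l) - 1) then walsh k e x else 0)"

definition haar_index :: "nat \<Rightarrow> ('d \<Rightarrow> nat) set" where
  "haar_index k = {i. \<forall>l. i l \<in> {1..2 ^ k}}"

definition cell_index :: "nat \<Rightarrow> real ^ 'd \<Rightarrow> 'd \<Rightarrow> nat" where
  "cell_index k x l = nat (grid k x l) + 1"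

lemma dyadic_interval_iff:
  "1 \<le> i \<Longrightarrow> t \<in> dyadic_interval k i \<longleftrightarrow> \<lfloor>2 ^ k * t\<rfloor> = int i - 1"
  unfolding dyadic_interval_def floor_eq_iff by (auto simp: field_simps)

lemma haar_eq:
  assumes "1 \<le> i"
  shows "haar k i t = (if \<lfloor>2 ^ k * t\<rfloor> = int i - 1 then rademacher k t else 0)"
proof -
  have 1: "t \<in> dyadic_interval (Suc k) (2 * i - 1) \<longleftrightarrow> \<lfloor>2 ^ Suc k * t\<rfloor> = 2 * int i - 2"
    using assms by (subst dyadic_interval_iff) auto
  have 2: "t \<in> dyadic_interval (Suc k) (2 * i) \<longleftrightarrow> \<lfloor>2 ^ Suc k * t\<rfloor> = 2 * int i - 1"
    using assms by (subst dyadic_interval_iff) auto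
  show ?thesis
    unfolding haar_def indicator_def 1 2 rademacher_def floor_half[of k t]
    by (simp del: power_Suc) presburger
qed

lemma prod_if_all:
  fixes f :: "'a \<Rightarrow> real"
  assumes "finite I"
  shows "(\<Prod>l\<in>I. if P l then f l else 0) = (if \<forall>l\<in>I. P l then \<Prod>l\<in>I. f l else 0)"
  using assms by (auto intro: prod.cong prod_zero)

text \<open>Each factor is a one-dimensional indicator times a sign or 1: the indicators combine to
  one condition on \<open>grid\<close>, the signs to a character. The type e collects the
  coordinates with a Haar factor.\<close>

lemma haar_block_Suc:
  "haar_block (Suc k) = (\<lambda>(i, e). haar_cell k i e) ` (haar_index k \<times> {e :: 'd::finite set. e \<noteq> {}})"
proof -
  have prod: "(\<lambda>x::real^'d. \<Prod>l\<in>UNIV. \<psi> l (x $ l)) = haar_cell k i e"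
    if "i \<in> haar_index k" "\<And>l. l \<in> e \<Longrightarrow> \<psi> l = haar k (i l)"
      "\<And>l. l \<notin> e \<Longrightarrow> \<psi> l = indicator (dyadic_interval k (i l))" for \<psi> i e
  proof
    fix x :: "real ^ 'd"
    have i: "1 \<le> i l" for l using that(1) by (auto simp: haar_index_def)
    have "\<psi> l (x $ l) = (if \<lfloor>2 ^ k * x $ l\<rfloor> = int (i l) - 1 then (if l \<in> e then rademacher k (x $ l) else 1) else 0)" for l
      using i[of l] that(2,3)[of l] by (cases "l \<in> e") (auto simp: haar_eq indicator_def dyadic_interval_iff)
    then have "(\<Prod>l\<in>UNIV. \<psi> l (x $ l)) = (if \<forall>l\<in>UNIV. \<lfloor>2 ^ k * x $ l\<rfloor> = int (i l) - 1
        then \<Prod>l\<in>UNIV. (if l \<in> e then rademacher k (x $ l) else 1) else 0)"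
      by (simp only: prod_if_all[OF finite])
    also have "(\<Prod>l\<in>UNIV. (if l \<in> e then rademacher k (x $ l) else 1)) = walsh k e x"
      unfolding walsh_def by (subst prod.If_cases) auto
    finally show "(\<Prod>l\<in>UNIV. \<psi> l (x $ l)) = haar_cell k i e x"
      by (simp add: haar_cell_def grid_def fun_eq_iff)
  qed
  show ?thesis
  proof (intro equalityI subsetI)
    fix h :: "real ^ 'd \<Rightarrow> real" assume "h \<in> haar_block (Suc k)"
    then obtain \<psi> i where h: "h = (\<lambda>x. \<Prod>l\<in>UNIV. \<psi> l (x $ l))" "\<forall>l. i l \<in> {1..2 ^ k}"
      "\<forall>l. \<psi> l = haar k (i l) \<or> \<psi> l = indicator (dyadic_interval k (i l))" "\<exists>l. \<psi> l = haar k (i l)"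
      by auto
    define e where "e = {l. \<psi> l = haar k (i l)}"
    have "h = haar_cell k i e"
      unfolding h(1) using h by (intro prod) (auto simp: haar_index_def e_def)
    moreover have "i \<in> haar_index k" "e \<noteq> {}" using h by (auto simp: haar_index_def e_def)
    ultimately show "h \<in> (\<lambda>(i, e). haar_cell k i e) ` (haar_index k \<times> {e. e \<noteq> {}})" by auto
  next
    fix h :: "real ^ 'd \<Rightarrow> real" assume "h \<in> (\<lambda>(i, e). haar_cell k i e) ` (haar_index k \<times> {e. e \<noteq> {}})"
    then obtain i e where h: "h = haar_cell k i e" "i \<in> haar_index k" "e \<noteq> {}" by auto
    define \<psi> where "\<psi> l = (if l \<in> e then haar k (i l) else indicator (dyadic_interval k (i l)))" for l
    have "h = (\<lambda>x. \<Prod>l\<in>UNIV. \<psi> l (x $ l))"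
      unfolding h(1) using h(2) by (intro prod[symmetric]) (auto simp: \<psi>_def)
    moreover have "(\<forall>l. i l \<in> {1..2 ^ k}) \<and> (\<forall>l. \<psi> l = haar k (i l) \<or> \<psi> l = indicator (dyadic_interval k (i l))) \<and>
       (\<exists>l. \<psi> l = haar k (i l))"
      using h by (auto simp: haar_index_def \<psi>_def)
    ultimately show "h \<in> haar_block (Suc k)" by auto
  qed
qed

declare haar_block.simps(2) [simp del]

lemma finite_haar_index: "finite (haar_index k :: ('d::finite \<Rightarrow> nat) set)"
proof (rule finite_subset)
  show "haar_index k \<subseteq> (UNIV :: 'd set) \<rightarrow>\<^sub>E {1..2 ^ k}" by (auto simp: haar_index_def)
qed (auto intro: finite_PiE)

lemma finite_haar_block: "finite (haar_block k :: (real ^ 'd \<Rightarrow> real) set)"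
  by (cases k) (auto simp: haar_block_Suc finite_haar_index)

lemma cell_index_grid:
  assumes "x \<in> half_open_cube"
  shows "cell_index k x \<in> haar_index k" and "(\<lambda>l. int (cell_index k x l) - 1) = grid k x"
proof -
  have g: "0 \<le> grid k x l" "grid k x l < 2 ^ k" for l
    using assms by (auto simp: half_open_cube_iff[of _ k])
  then show "(\<lambda>l. int (cell_index k x l) - 1) = grid k x" by (auto simp: cell_index_def)
  have "nat (grid k x l) < 2 ^ k" for l using g[of l] by (simp add: nat_less_iff)
  then show "cell_index k x \<in> haar_index k" by (auto simp: haar_index_def cell_index_def Suc_le_eq)
qed

lemma cell_index_unique:
  assumes "i \<in> haar_index k" "grid k x = (\<lambda>l. int (i l) - 1)"
  shows "i = cell_index k x" "x \<in> half_open_cube"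
proof -
  have i: "1 \<le> i l" "i l \<le> 2 ^ k" for l using assms(1) by (auto simp: haar_index_def)
  show "i = cell_index k x"
  proof
    fix l
    have "int (i l) - 1 = int (i l - 1)" using i(1)[of l] by simp
    then show "i l = cell_index k x l" using assms(2) i(1)[of l] by (simp add: cell_index_def)
  qed
  have "int (i l) \<le> 2 ^ k" for l using i(2)[of l] by (metis of_nat_le_iff of_nat_numeral of_nat_power)
  then have "int (i l) - 1 < 2 ^ k" "0 \<le> int (i l) - 1" for l
    using i(1)[of l] by (smt (verit), linarith)
  then have "grid k x l \<in> {0..<2 ^ k}" for l by (simp add: assms(2))
  then show "x \<in> half_open_cube" by (auto simp: half_open_cube_iff[of _ k])
qed

lemma index_witness:
  assumes "i \<in> haar_index k"
  obtains x where "grid k x = (\<lambda>l. int (i l) - 1)"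
  by (rule that[of "\<chi> l. (real (i l) - 1) / 2 ^ k"]) (auto simp: grid_def fun_eq_iff)

lemma haar_cell_cell:
  assumes "grid k x = (\<lambda>l. int (i l) - 1)"
  shows "haar_cell k i e = (\<lambda>y. indicator (cell k x) y * walsh k e y)"
  using assms by (auto simp: haar_cell_def cell_def indicator_def)

text \<open>
  Restricting to the half-open cube changes only the constant Haar function, and that on a null set;
  every Haar function then becomes constant on the cells of a dyadic grid.
\<close>

definition core :: "(real ^ 'd \<Rightarrow> real) \<Rightarrow> real ^ 'd \<Rightarrow> real" where
  "core h x = indicator half_open_cube x * h x"

lemma core_haar_cell: "i \<in> haar_index k \<Longrightarrow> core (haar_cell k i e) = haar_cell k i e"
  using cell_index_unique(2)[of i k] by (fastforce simp: core_def haar_cell_def indicator_def)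

lemma haar_cell_step: "i \<in> haar_index k \<Longrightarrow> step (Suc k) (haar_cell k i e)"
proof (rule stepI)
  fix x y :: "real ^ 'a" assume i: "i \<in> haar_index k" and xy: "grid (Suc k) x = grid (Suc k) y"
  have "grid k x = grid k y" by (rule grid_mono[OF _ xy]) simp
  moreover have "walsh k e x = walsh k e y" by (rule cellwiseD[OF cellwise_walsh xy])
  ultimately show "haar_cell k i e x = haar_cell k i e y" by (simp add: haar_cell_def)
qed (use cell_index_unique(2)[of i k] in \<open>fastforce simp: haar_cell_def\<close>)

lemma core_step: "h \<in> haar_block n \<Longrightarrow> step n (core h)"
proof (cases n)
  case 0
  then show "h \<in> haar_block n \<Longrightarrow> step n (core h)"
    using half_open_cube_subset grid_half_open_cube[of 0]
    by (intro stepI) (auto simp: core_def indicator_def)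
next
  case (Suc k)
  then show "h \<in> haar_block n \<Longrightarrow> step n (core h)"
    by (auto simp: haar_block_Suc core_haar_cell haar_cell_step)
qed

lemma walsh_coeff_local:
  assumes "\<And>y. y \<in> cell k x \<Longrightarrow> f y = g y"
  shows "walsh_coeff k e f x = walsh_coeff k e g x"
  unfolding walsh_coeff_def
  by (intro arg_cong[where f="\<lambda>t. 2 ^ (k * CARD('a)) * t"] Bochner_Integration.integral_cong refl)
     (use assms in \<open>auto simp: indicator_def\<close>)

lemma walsh_coeff_haar_cell:
  assumes "grid k x = (\<lambda>l. int (i l) - 1)"
  shows "walsh_coeff k e (haar_cell k i e') x = (if e = e' then 1 else 0)"
proof -
  have "walsh_coeff k e (haar_cell k i e') x = walsh_coeff k e (walsh k e') x"
    by (rule walsh_coeff_local) (simp add: haar_cell_cell[OF assms])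
  then show ?thesis using walsh_coeff_walsh_same[of k e x] walsh_coeff_walsh_other[of e e' k x] by auto
qed

text \<open>A nonzero value reveals the cell, and orthogonality of the characters reveals the
  type.\<close>

lemma haar_cell_inj: "inj_on (\<lambda>(i, e). haar_cell k i e) (haar_index k \<times> UNIV)"
proof (rule inj_onI, clarify)
  fix i i' :: "'d::finite \<Rightarrow> nat" and e e' :: "'d set"
  assume i: "i \<in> haar_index k" "i' \<in> haar_index k" and eq: "haar_cell k i e = haar_cell k i' e'"
  obtain x where x: "grid k x = (\<lambda>l. int (i l) - 1)" using index_witness[OF i(1)] by blast
  have "haar_cell k i e x \<noteq> 0" using walsh_cases[of k e x] by (auto simp: haar_cell_def x)
  then have "haar_cell k i' e' x \<noteq> 0" by (simp add: eq)
  then have x': "grid k x = (\<lambda>l. int (i' l) - 1)" by (auto simp: haar_cell_def split: if_splits)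
  have "i = i'" using cell_index_unique(1)[OF i(1) x] cell_index_unique(1)[OF i(2) x'] by simp
  moreover have "e = e'"
    using walsh_coeff_haar_cell[OF x, of e e] walsh_coeff_haar_cell[OF x', of e e'] eq by (simp split: if_splits)
  ultimately show "i = i' \<and> e = e'" by simp
qed

lemma integral_cellwise_haar:
  assumes g: "cellwise k g" and i: "i \<in> haar_index k" and e: "e \<noteq> {}"
  shows "(\<integral>y. g y * haar_cell k i e y \<partial>lborel) = 0"
proof -
  obtain x where x: "grid k x = (\<lambda>l. int (i l) - 1)" using index_witness[OF i] by blast
  have c: "cellwise k (indicator (cell k x) :: _ \<Rightarrow> real)"
    by (auto simp: cellwise_def cell_def indicator_def)
  have eq: "g y * haar_cell k i e y = g x * (indicator (cell k x) y * walsh k e y)" for y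
    using cellwiseD[OF g, of y x] by (auto simp: haar_cell_cell[OF x] indicator_def cell_def)
  show ?thesis
    unfolding eq using integral_cellwise_walsh[OF c integrable_indicator_cell e] by simp
qed

text \<open>A Haar function has mean zero on its cell, hence on every cell of a coarser grid.
  Together with \<open>avg_core_large\<close> this makes averaging a coordinate projection of the
  Haar system.\<close>

lemma avg_core_small:
  assumes "h \<in> haar_block n" "j < n"
  shows "avg j (core h) x = 0"
proof -
  obtain k where n: "n = Suc k" using assms(2) by (cases n) auto
  then obtain i e where h: "h = haar_cell k i e" "i \<in> haar_index k" "e \<noteq> {}"
    using assms(1) by (auto simp: haar_block_Suc)
  have c: "cellwise j (indicator (cell j x) :: _ \<Rightarrow> real)"
    by (auto simp: cellwise_def cell_def indicator_def)
  have "cellwise k (indicator (cell j x) :: _ \<Rightarrow> real)"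
    by (rule cellwise_mono[OF c]) (use n assms in simp)
  then show ?thesis
    using integral_cellwise_haar[OF _ h(2,3)] by (simp add: walsh_coeff_def h core_haar_cell)
qed

lemma avg_core_large: "h \<in> haar_block n \<Longrightarrow> n \<le> j \<Longrightarrow> avg j (core h) x = core h x"
  by (rule avg_cellwise[OF step_cellwise[OF step_mono[OF core_step]]])

text \<open>Subtraction is truncated on purpose: the functions of levels 0 and 1 are both supported
  on the whole cube.\<close>

lemma core_square_integral:
  fixes h :: "real ^ 'd \<Rightarrow> real"
  assumes "h \<in> haar_block n"
  shows "(\<integral>x. core h x * core h x \<partial>lborel) = 1 / 2 ^ ((n - 1) * CARD('d))"
proof (cases n)
  case 0
  then have "core h x * core h x = indicator half_open_cube x" for x
    using assms half_open_cube_subset by (auto simp: core_def indicator_def)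
  then show ?thesis using 0 by (simp add: measure_def emeasure_half_open_cube)
next
  case (Suc k)
  then obtain i e where h: "h = haar_cell k i e" "i \<in> haar_index k" using assms by (auto simp: haar_block_Suc)
  obtain x where x: "grid k x = (\<lambda>l. int (i l) - 1)" using index_witness[OF h(2)] by blast
  have "core h y * core h y = indicator (cell k x) y" for y
    unfolding h(1) core_haar_cell[OF h(2)] unfolding haar_cell_cell[OF x] by (simp add: indicator_def)
  then show ?thesis using Suc by (simp add: measure_def emeasure_cell)
qed

lemma haar_block_disjoint:
  assumes "h \<in> haar_block m" "h \<in> haar_block n"
  shows "m = n"
proof -
  have "\<not> m < n" if h: "h \<in> haar_block m" "h \<in> haar_block n" for m n
  proof
    assume "m < n"
    then have "core h x = 0" for x
      using avg_core_small[OF h(2), of m x] avg_core_large[OF h(1) order_refl, of x] by simp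
    then show False using core_square_integral[OF h(1)] by simp
  qed
  from this[OF assms] this[OF assms(2,1)] show ?thesis by simp
qed

text \<open>Across levels the coarser function is constant on the cell of the finer one. Within a
  level, two types on the same cell multiply to a nontrivial character, and different cells are
  disjoint.\<close>

lemma core_orthogonal:
  assumes "h \<in> haar_system" "h' \<in> haar_system" "h \<noteq> h'"
  shows "(\<integral>x. core h x * core h' x \<partial>lborel) = 0"
proof -
  obtain m n where mn: "h \<in> haar_block m" "h' \<in> haar_block n" using assms by (auto simp: haar_system_def)
  have less: "(\<integral>x. core h x * core h' x \<partial>lborel) = 0"
    if a: "h \<in> haar_block m" "h' \<in> haar_block n" "m < n" for h h' m n
  proof -
    obtain k where n: "n = Suc k" using a(3) by (cases n) auto
    then obtain i e where h: "h' = haar_cell k i e" "i \<in> haar_index k" "e \<noteq> {}"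
      using a(2) by (auto simp: haar_block_Suc)
    have "cellwise k (core h)"
      by (rule step_cellwise[OF step_mono[OF core_step[OF a(1)]]]) (use n a in simp)
    from integral_cellwise_haar[OF this h(2,3)] show ?thesis by (simp add: h core_haar_cell)
  qed
  consider "m < n" | "n < m" | "m = n" by linarith
  then show ?thesis
  proof cases
    case 1 then show ?thesis by (rule less[OF mn])
  next
    case 2 then show ?thesis using less[OF mn(2,1)] by (simp add: mult.commute)
  next
    case 3
    show ?thesis
    proof (cases n)
      case 0
      then show ?thesis using 3 mn assms by simp
    next
      case (Suc k)
      obtain i e where h: "h = haar_cell k i e" "i \<in> haar_index k" "e \<noteq> {}"
        using mn(1) 3 Suc by (auto simp: haar_block_Suc)
      obtain i' e' where h': "h' = haar_cell k i' e'" "i' \<in> haar_index k" "e' \<noteq> {}"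
        using mn(2) Suc by (auto simp: haar_block_Suc)
      show ?thesis
      proof (cases "i = i'")
        case True
        then have ne: "(e - e') \<union> (e' - e) \<noteq> {}" using assms h h' by auto
        have c: "cellwise k (\<lambda>_ :: real ^ 'a. 1 :: real)" by (simp add: cellwise_def)
        have "core h x * core h' x = 1 * haar_cell k i ((e - e') \<union> (e' - e)) x" for x
          unfolding h(1) h'(1) core_haar_cell[OF h(2)] core_haar_cell[OF h'(2)]
          by (simp add: haar_cell_def True walsh_mult)
        then show ?thesis using integral_cellwise_haar[OF c h(2) ne] by simp
      next
        case False
        then have "(\<lambda>l. int (i l) - 1) \<noteq> (\<lambda>l. int (i' l) - 1)" by (auto simp: fun_eq_iff)
        then have eq: "core h x * core h' x = 0" for x
          unfolding h(1) h'(1) core_haar_cell[OF h(2)] core_haar_cell[OF h'(2)]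
          by (auto simp: haar_cell_def)
        show ?thesis unfolding eq by simp
      qed
    qed
  qed
qed

section \<open>Haar coefficients and finite Haar projections\<close>

definition haar_coeff :: "(real ^ 'd \<Rightarrow> real) \<Rightarrow> (real ^ 'd \<Rightarrow> real) \<Rightarrow> real" where
  "haar_coeff f h = (\<integral>x. f x * core h x \<partial>lborel) / (\<integral>x. core h x * core h x \<partial>lborel)"

definition haar_part :: "(real ^ 'd \<Rightarrow> real) set \<Rightarrow> (real ^ 'd \<Rightarrow> real) \<Rightarrow> real ^ 'd \<Rightarrow> real" where
  "haar_part A f x = (\<Sum>h\<in>A. haar_coeff f h * core h x)"

definition haar_upto :: "nat \<Rightarrow> (real ^ 'd \<Rightarrow> real) set" where
  "haar_upto n = (\<Union>k\<le>n. haar_block k)"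

lemma finite_haar_upto: "finite (haar_upto n :: (real ^ 'd \<Rightarrow> real) set)"
  by (simp add: haar_upto_def finite_haar_block)

lemma haar_upto_subset: "haar_upto n \<subseteq> haar_system"
  by (auto simp: haar_upto_def haar_system_def)

lemma haar_system_measurable:
  assumes "h \<in> haar_system"
  shows "core h \<in> borel_measurable borel" "\<bar>core h x\<bar> \<le> 1"
proof -
  obtain n where n: "h \<in> haar_block n" using assms by (auto simp: haar_system_def)
  show "core h \<in> borel_measurable borel" by (rule step_measurable[OF core_step[OF n]])
  show "\<bar>core h x\<bar> \<le> 1"
  proof (cases n)
    case 0 then show ?thesis using n by (auto simp: core_def indicator_def)
  next
    case (Suc k)
    then obtain i e where h: "h = haar_cell k i e" "i \<in> haar_index k" using n by (auto simp: haar_block_Suc)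
    then show ?thesis unfolding h(1) core_haar_cell[OF h(2)] by (simp add: haar_cell_def)
  qed
qed

lemma integrable_mult_core:
  assumes "h \<in> haar_system" "integrable lborel f"
  shows "integrable lborel (\<lambda>x. f x * core h x)"
  using integrable_bounded_mult[OF assms(2) haar_system_measurable(2,1)[OF assms(1)]] by (simp add: mult.commute)

lemma core_integrable: "h \<in> haar_system \<Longrightarrow> integrable lborel (core h)"
  by (auto simp: haar_system_def intro: step_integrable core_step)

lemma core_square_pos: "h \<in> haar_system \<Longrightarrow> 0 < (\<integral>x. core h x * core h x \<partial>lborel)"
  by (auto simp: haar_system_def core_square_integral)

lemma haar_coeff_core:
  "h \<in> haar_system \<Longrightarrow> h' \<in> haar_system \<Longrightarrow> haar_coeff (core h') h = (if h = h' then 1 else 0)"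
  using core_orthogonal[of h' h] core_square_pos[of h] by (auto simp: haar_coeff_def)

lemma haar_coeff_diff:
  "h \<in> haar_system \<Longrightarrow> integrable lborel f \<Longrightarrow> integrable lborel g \<Longrightarrow>
    haar_coeff (\<lambda>x. f x - g x) h = haar_coeff f h - haar_coeff g h"
  by (simp add: haar_coeff_def left_diff_distrib integrable_mult_core diff_divide_distrib)

lemma haar_coeff_lincomb:
  assumes "finite A" "A \<subseteq> haar_system" "h \<in> haar_system"
  shows "haar_coeff (\<lambda>x. \<Sum>h\<in>A. c h * core h x) h = (if h \<in> A then c h else 0)"
proof -
  have i: "integrable lborel (\<lambda>x. c h' * core h' x * core h x)" if "h' \<in> A" for h'
    using integrable_mult_right[where c="c h'", OF integrable_mult_core[OF assms(3) core_integrable[of h']]] that assms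
    by (auto simp: mult.assoc)
  have "(\<integral>x. (\<Sum>h\<in>A. c h * core h x) * core h x \<partial>lborel)
      = (\<Sum>h'\<in>A. c h' * (\<integral>x. core h' x * core h x \<partial>lborel))"
    unfolding sum_distrib_right
    by (subst Bochner_Integration.integral_sum[OF i]) (auto simp: mult.assoc)
  then have "haar_coeff (\<lambda>x. \<Sum>h\<in>A. c h * core h x) h = (\<Sum>h'\<in>A. c h' * haar_coeff (core h') h)"
    by (simp add: haar_coeff_def sum_divide_distrib)
  also have "\<dots> = (\<Sum>h'\<in>A. if h' = h then c h' else 0)"
    using assms by (intro sum.cong) (auto simp: haar_coeff_core)
  also have "\<dots> = (if h \<in> A then c h else 0)" using assms(1) by (simp add: sum.delta)
  finally show ?thesis .
qed

lemma haar_coeff_cell: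
  fixes f :: "real ^ 'd \<Rightarrow> real"
  assumes i: "i \<in> haar_index k" and e: "e \<noteq> {}" and x: "grid k x = (\<lambda>l. int (i l) - 1)"
  shows "haar_coeff f (haar_cell k i e) = walsh_coeff k e f x"
proof -
  have h: "haar_cell k i e \<in> haar_block (Suc k)" using i e by (auto simp: haar_block_Suc)
  have "haar_coeff f (haar_cell k i e) = 2 ^ (k * CARD('d)) * (\<integral>y. f y * haar_cell k i e y \<partial>lborel)"
    by (simp add: haar_coeff_def core_square_integral[OF h]) (simp add: core_haar_cell[OF i])
  also have "\<dots> = walsh_coeff k e f x"
    unfolding walsh_coeff_def haar_cell_cell[OF x] by (simp add: mult_ac)
  finally show ?thesis .
qed

text \<open>An arbitrary set of Haar functions becomes a yes-or-no decision for each cell and type.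
  The decision is constant on cells of level k, that is, predictable, as a martingale transform
  requires.\<close>

definition selects :: "(real ^ 'd \<Rightarrow> real) set \<Rightarrow> nat \<Rightarrow> 'd set \<Rightarrow> real ^ 'd \<Rightarrow> bool" where
  "selects A k e x \<longleftrightarrow> haar_cell k (cell_index k x) e \<in> A"

lemma selects_cong: "grid k x = grid k y \<Longrightarrow> selects A k e x = selects A k e y"
proof -
  assume "grid k x = grid k y"
  then have "cell_index k x = cell_index k y" by (auto simp: cell_index_def)
  then show ?thesis by (simp add: selects_def)
qed

text \<open>At a given point a single cell of the level contributes, so the sum over the block
  collapses to one over types.\<close>

lemma haar_part_block:
  fixes f :: "real ^ 'd \<Rightarrow> real"
  assumes f: "\<And>x. x \<notin> half_open_cube \<Longrightarrow> f x = 0"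
  shows "haar_part (A \<inter> haar_block (Suc k)) f x
    = (\<Sum>e\<in>UNIV - {{}}. if selects A k e x then walsh_coeff k e f x * walsh k e x else 0)"
proof (cases "x \<in> half_open_cube")
  case False
  have "core h x = 0" for h :: "real ^ 'd \<Rightarrow> real" using False by (simp add: core_def)
  moreover have "walsh_coeff k e f x = 0" for e
    by (rule step_outside[OF walsh_coeff_step[OF f] False])
  then have "(if selects A k e x then walsh_coeff k e f x * walsh k e x else 0) = 0" for e by simp
  ultimately show ?thesis by (simp add: haar_part_def)
next
  case True
  note ci = cell_index_grid[OF True, of k]
  let ?H = "\<lambda>(i, e). haar_cell k i e"
  define T where "T = {(i, e). i \<in> haar_index k \<and> e \<noteq> {} \<and> haar_cell k i e \<in> A}"
  have img: "A \<inter> haar_block (Suc k) = ?H ` T"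
    by (auto simp: haar_block_Suc T_def)
  have inj: "inj_on ?H T" by (rule inj_on_subset[OF haar_cell_inj]) (auto simp: T_def)
  have finT: "finite T"
    by (rule finite_subset[of _ "haar_index k \<times> UNIV"]) (auto simp: T_def finite_haar_index)
  have "haar_part (A \<inter> haar_block (Suc k)) f x
     = (\<Sum>(i, e)\<in>T. haar_coeff f (haar_cell k i e) * core (haar_cell k i e) x)"
    unfolding haar_part_def img by (subst sum.reindex[OF inj]) (simp add: case_prod_beta)
  also have "\<dots> = (\<Sum>(i, e)\<in>T. if i = cell_index k x then walsh_coeff k e f x * walsh k e x else 0)"
  proof (rule sum.cong[OF refl], clarify)
    fix i e assume "(i, e) \<in> T"
    then have T: "i \<in> haar_index k" "e \<noteq> {}" by (auto simp: T_def)
    show "haar_coeff f (haar_cell k i e) * core (haar_cell k i e) x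
      = (if i = cell_index k x then walsh_coeff k e f x * walsh k e x else 0)"
    proof (cases "grid k x = (\<lambda>l. int (i l) - 1)")
      case g: True
      then have "i = cell_index k x" using cell_index_unique(1)[OF T(1)] by simp
      moreover have "core (haar_cell k i e) x = walsh k e x"
        unfolding core_haar_cell[OF T(1)] by (simp add: haar_cell_def g)
      ultimately show ?thesis using haar_coeff_cell[OF T g, of f] by simp
    next
      case g: False
      then have "i \<noteq> cell_index k x" using ci(2) by metis
      then show ?thesis by (simp add: core_haar_cell[OF T(1)] haar_cell_def g)
    qed
  qed
  also have "\<dots> = (\<Sum>(i, e)\<in>{cell_index k x} \<times> {e. e \<noteq> {} \<and> selects A k e x}. walsh_coeff k e f x * walsh k e x)"
    using finT ci(1)
    by (intro sum.mono_neutral_cong_right) (auto simp: T_def selects_def split: if_splits)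
  also have "\<dots> = (\<Sum>e\<in>{e. e \<noteq> {} \<and> selects A k e x}. walsh_coeff k e f x * walsh k e x)"
    by (subst sum.cartesian_product[symmetric]) simp
  also have "\<dots> = (\<Sum>e\<in>UNIV - {{}}. if selects A k e x then walsh_coeff k e f x * walsh k e x else 0)"
    by (intro sum.mono_neutral_cong_left) auto
  finally show ?thesis .
qed

lemma haar_part_Un:
  "finite A \<Longrightarrow> finite B \<Longrightarrow> A \<inter> B = {} \<Longrightarrow> haar_part (A \<union> B) f x = haar_part A f x + haar_part B f x"
  by (simp add: haar_part_def sum.union_disjoint)

lemma haar_part_block_0:
  fixes f :: "real ^ 'd \<Rightarrow> real"
  assumes f: "\<And>x. x \<notin> half_open_cube \<Longrightarrow> f x = 0"
  shows "haar_part (A \<inter> haar_block 0) f x = (if indicator unit_cube \<in> A then avg 0 f x else 0)"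
proof (cases "(indicator unit_cube :: real ^ 'd \<Rightarrow> real) \<in> A")
  case True
  let ?h = "indicator unit_cube :: real ^ 'd \<Rightarrow> real"
  have core: "core ?h y = indicator half_open_cube y" for y
    using half_open_cube_subset by (auto simp: core_def indicator_def)
  have fc: "f y * core ?h y = f y" for y using f[of y] by (auto simp: core indicator_def)
  have "(\<integral>y. core ?h y * core ?h y \<partial>lborel) = 1"
    using core_square_integral[of ?h 0] by simp
  then have "haar_coeff f ?h = (\<integral>y. f y \<partial>lborel)" unfolding haar_coeff_def fc by simp
  then have "haar_part (A \<inter> haar_block 0) f x = (\<integral>y. f y \<partial>lborel) * indicator half_open_cube x"
    using True by (simp add: haar_part_def core)
  also have "\<dots> = avg 0 f x"
  proof (cases "x \<in> half_open_cube")
    case x: True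
    then have "cell 0 x = half_open_cube"
      unfolding half_open_cube_eq_cell by (auto simp: cell_def)
    moreover have fi: "indicator half_open_cube y * f y = f y" for y using f[of y] by (auto simp: indicator_def)
    ultimately show ?thesis using x by (simp add: walsh_coeff_def del: mult_eq_0_iff) (simp only: fi)
  next
    case x: False
    then show ?thesis using step_outside[OF walsh_coeff_step[OF f]] by simp
  qed
  finally show ?thesis using True by simp
qed (simp add: haar_part_def)

lemma haar_part_levels:
  fixes f :: "real ^ 'd \<Rightarrow> real"
  assumes f: "\<And>x. x \<notin> half_open_cube \<Longrightarrow> f x = 0"
  shows "haar_part (A \<inter> haar_upto n) f x = (if indicator unit_cube \<in> A then avg 0 f x else 0)
    + (\<Sum>k<n. \<Sum>e\<in>UNIV - {{}}. if selects A k e x then walsh_coeff k e f x * walsh k e x else 0)"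
proof (induction n)
  case 0
  have "haar_upto 0 = (haar_block 0 :: (real ^ 'd \<Rightarrow> real) set)" by (auto simp: haar_upto_def)
  then show ?case using haar_part_block_0[where f=f, OF f, where A=A and x=x] by simp
next
  case (Suc n)
  have "A \<inter> haar_upto (Suc n) = (A \<inter> haar_upto n) \<union> (A \<inter> haar_block (Suc n))"
    by (auto simp: haar_upto_def atMost_Suc)
  moreover have "(A \<inter> haar_upto n) \<inter> (A \<inter> haar_block (Suc n)) = {}"
    using haar_block_disjoint by (fastforce simp: haar_upto_def)
  ultimately have "haar_part (A \<inter> haar_upto (Suc n)) f x
      = haar_part (A \<inter> haar_upto n) f x + haar_part (A \<inter> haar_block (Suc n)) f x"
    by (simp add: haar_part_Un finite_haar_upto finite_haar_block)
  also have "haar_part (A \<inter> haar_block (Suc n)) f x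
      = (\<Sum>e\<in>UNIV - {{}}. if selects A n e x then walsh_coeff n e f x * walsh n e x else 0)"
    by (rule haar_part_block) (rule f)
  finally show ?case unfolding Suc.IH by simp
qed

text \<open>If nothing is left out, the sums over types are the increments of the averages, and
  these telescope.\<close>

lemma haar_part_upto:
  fixes f :: "real ^ 'd \<Rightarrow> real"
  assumes f: "\<And>x. x \<notin> half_open_cube \<Longrightarrow> f x = 0" and int: "integrable lborel f"
  shows "haar_part (haar_upto n) f x = avg n f x"
proof -
  have "(\<Sum>k<n. \<Sum>e\<in>UNIV - {{}}. walsh_coeff k e f x * walsh k e x) = (\<Sum>k<n. avg (Suc k) f x - avg k f x)"
  proof (rule sum.cong[OF refl])
    fix k
    have "(\<Sum>e\<in>UNIV. walsh_coeff k e f x * walsh k e x)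
       = avg k f x + (\<Sum>e\<in>UNIV - {{}}. walsh_coeff k e f x * walsh k e x)"
      by (subst sum.remove[of _ "{}"]) auto
    then show "(\<Sum>e\<in>UNIV - {{}}. walsh_coeff k e f x * walsh k e x) = avg (Suc k) f x - avg k f x"
      unfolding avg_Suc[OF int] by simp
  qed
  also have "\<dots> = avg n f x - avg 0 f x" by (rule sum_lessThan_telescope)
  finally show ?thesis
    using haar_part_levels[where f=f, OF f, where A=UNIV and n=n and x=x] by (simp add: selects_def)
qed

lemma haar_coeff_avg:
  fixes f :: "real ^ 'd \<Rightarrow> real"
  assumes f: "\<And>x. x \<notin> half_open_cube \<Longrightarrow> f x = 0" "integrable lborel f" and h: "h \<in> haar_system"
  shows "haar_coeff (avg n f) h = (if h \<in> haar_upto n then haar_coeff f h else 0)"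
proof -
  have "avg n f = (\<lambda>x. \<Sum>h\<in>haar_upto n. haar_coeff f h * core h x)"
    using haar_part_upto[where f=f, OF f] by (auto simp: haar_part_def)
  then show ?thesis using haar_coeff_lincomb[OF finite_haar_upto haar_upto_subset h] by simp
qed

lemma haar_part_avg:
  fixes f :: "real ^ 'd \<Rightarrow> real"
  assumes f: "\<And>x. x \<notin> half_open_cube \<Longrightarrow> f x = 0" "integrable lborel f" and A: "finite A" "A \<subseteq> haar_system"
  shows "haar_part A (avg n f) x = haar_part (A \<inter> haar_upto n) f x"
  unfolding haar_part_def using A
  by (intro sum.mono_neutral_cong_right) (auto simp: haar_coeff_avg[where f=f, OF f] subset_iff)

lemma avg_haar_part:
  fixes f :: "real ^ 'd \<Rightarrow> real"
  assumes A: "finite A" "A \<subseteq> haar_system"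
  shows "avg n (haar_part A f) x = haar_part (A \<inter> haar_upto n) f x"
proof -
  have "avg n (haar_part A f) x = (\<Sum>h\<in>A. haar_coeff f h * avg n (core h) x)"
    unfolding haar_part_def[abs_def] using A
    by (subst walsh_coeff_sum) (auto simp: walsh_coeff_cmult intro!: integrable_mult_right core_integrable)
  also have "\<dots> = haar_part (A \<inter> haar_upto n) f x"
    unfolding haar_part_def
  proof (rule sum.mono_neutral_cong_right)
    show "\<forall>h\<in>A - A \<inter> haar_upto n. haar_coeff f h * avg n (core h) x = 0"
    proof
      fix h assume h: "h \<in> A - A \<inter> haar_upto n"
      then obtain m where m: "h \<in> haar_block m" using A by (auto simp: haar_system_def)
      then have "n < m" using h by (auto simp: haar_upto_def not_less[symmetric])
      then show "haar_coeff f h * avg n (core h) x = 0" using avg_core_small[OF m] by simp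
    qed
  qed (use A avg_core_large in \<open>fastforce simp: haar_upto_def\<close>)+
  finally show ?thesis .
qed

lemma haar_part_step:
  assumes "A \<subseteq> haar_upto n"
  shows "step n (haar_part A f)"
proof (rule stepI)
  have s: "step n (core h)" if "h \<in> A" for h
    using that assms core_step step_mono by (fastforce simp: haar_upto_def)
  fix x y :: "real ^ 'a" assume xy: "grid n x = grid n y"
  show "haar_part A f x = haar_part A f y"
    unfolding haar_part_def by (intro sum.cong refl arg_cong2[where f="(*)"] stepD[OF s xy])
qed (simp add: haar_part_def core_def)

lemma finite_haar_subset:
  fixes A :: "(real ^ 'd \<Rightarrow> real) set"
  assumes "finite A" "A \<subseteq> haar_system"
  obtains n where "A \<subseteq> haar_upto n"
proof -
  have "\<exists>n. A \<subseteq> haar_upto n"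
    using assms
  proof (induction A rule: finite_induct)
    case (insert h A)
    then obtain n m where n: "A \<subseteq> haar_upto n" "h \<in> haar_block m" by (auto simp: haar_system_def)
    have "insert h A \<subseteq> haar_upto (max n m)" using n by (fastforce simp: haar_upto_def)
    then show ?case by blast
  qed simp
  then show thesis using that by blast
qed

lemma haar_part_lp_cube:
  assumes "0 < p" "finite A" "A \<subseteq> haar_system"
  shows "lp_cube p (haar_part A f)"
proof -
  obtain n where "A \<subseteq> haar_upto n" by (rule finite_haar_subset[OF assms(2,3)])
  from step_lp_cube[OF haar_part_step[OF this] assms(1)] show ?thesis .
qed

lemma core_represents:
  assumes "0 < p" "h \<in> haar_system"
  shows "represents p (core h) h"
proof -
  obtain n where n: "h \<in> haar_block n" using assms by (auto simp: haar_system_def)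
  show ?thesis
    unfolding represents_def
  proof
    show "lp_cube p (core h)" by (rule step_lp_cube[OF core_step[OF n] assms(1)])
    show "AE x in lborel. x \<in> unit_cube \<longrightarrow> h x = core h x"
      using AE_half_open_cube by eventually_elim (simp add: core_def)
  qed
qed

section \<open>Bounds for partial Haar sums\<close>

lemma walsh_split:
  fixes G :: "real \<Rightarrow> real"
  shows "G (walsh k e x) = (G 1 + G (- 1)) / 2 + (G 1 - G (- 1)) / 2 * walsh k e x"
  using walsh_cases[of k e x] by (auto simp: field_simps)

lemma step_diff: "step k f \<Longrightarrow> step k g \<Longrightarrow> step k (\<lambda>x. f x - g x)"
  by (rule step_compose2) auto

lemma grid_SucD: "grid (Suc k) x = grid (Suc k) y \<Longrightarrow> grid k x = grid k y"
  by (rule grid_mono[of k "Suc k"]) simp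

lemma step_sum:
  fixes f :: "'i \<Rightarrow> real ^ 'd \<Rightarrow> real"
  assumes s: "\<And>i. i \<in> I \<Longrightarrow> step k (f i)"
  shows "step k (\<lambda>x. \<Sum>i\<in>I. f i x)"
proof (rule stepI)
  fix x y :: "real ^ 'd" assume xy: "grid k x = grid k y"
  show "(\<Sum>i\<in>I. f i x) = (\<Sum>i\<in>I. f i y)"
    by (intro sum.cong refl stepD[OF s xy])
qed (auto intro!: sum.neutral step_outside[OF s])

lemma step_mult_walsh:
  assumes "step k c"
  shows "step (Suc k) (\<lambda>x. c x * walsh k e x)"
proof (rule stepI)
  fix x y :: "real ^ 'a" assume xy: "grid (Suc k) x = grid (Suc k) y"
  have "c x = c y" by (rule stepD[OF step_mono[OF assms] xy]) simp
  moreover have "walsh k e x = walsh k e y" by (rule cellwiseD[OF cellwise_walsh xy])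
  ultimately show "c x * walsh k e x = c y * walsh k e y" by simp
qed (use step_outside[OF assms] in simp)

lemma step_selected:
  assumes "step k c" "\<And>x y. grid k x = grid k y \<Longrightarrow> s x = s y"
  shows "step k (\<lambda>x. if s x then c x else 0)"
proof (rule stepI)
  fix x y :: "real ^ 'a" assume xy: "grid k x = grid k y"
  have "c x = c y" by (rule stepD[OF assms(1) xy])
  then show "(if s x then c x else 0) = (if s y then c y else 0)" using assms(2)[OF xy] by simp
qed (use step_outside[OF assms(1)] in simp)

lemma integral_step_walsh:
  assumes "step k c" "e \<noteq> {}"
  shows "(\<integral>x. c x * walsh k e x \<partial>lborel) = 0"
  by (rule integral_cellwise_walsh[OF step_cellwise[OF assms(1)] step_integrable[OF assms(1)] assms(2)])

text \<open>A function of a sign is affine in it, so the last factor contains only the trivial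
  character and \<open>walsh k e\<close>. Multiplication by \<open>walsh k e'\<close> makes neither
  of them trivial. In martingale terms: the other characters keep mean zero after
  \<open>walsh k e\<close> has been revealed.\<close>

lemma integral_step_walsh_mult:
  fixes G :: "real ^ 'd \<Rightarrow> real \<Rightarrow> real"
  assumes c: "step k c" and G: "\<And>x y. grid k x = grid k y \<Longrightarrow> G x = G y" and e: "e' \<noteq> {}" "e' \<noteq> e"
  shows "(\<integral>x. c x * walsh k e' x * G x (walsh k e x) \<partial>lborel) = 0"
proof -
  define c1 c2 where "c1 x = c x * ((G x 1 + G x (- 1)) / 2)" and "c2 x = c x * ((G x 1 - G x (- 1)) / 2)" for x
  have v: "c x = c y" "G x = G y" if "grid k x = grid k y" for x y
    by (rule stepD[OF c that], rule G[OF that])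
  have c1: "step k c1"
  proof (rule stepI)
    fix x y :: "real ^ 'd" assume "grid k x = grid k y"
    then show "c1 x = c1 y" unfolding c1_def by (simp only: v[of x y])
  qed (simp add: c1_def step_outside[OF c])
  have c2: "step k c2"
  proof (rule stepI)
    fix x y :: "real ^ 'd" assume "grid k x = grid k y"
    then show "c2 x = c2 y" unfolding c2_def by (simp only: v[of x y])
  qed (simp add: c2_def step_outside[OF c])
  note s = c1 c2
  have ne: "(e' - e) \<union> (e - e') \<noteq> {}" using e by auto
  have "c x * walsh k e' x * G x (walsh k e x)
     = c1 x * walsh k e' x + c2 x * walsh k ((e' - e) \<union> (e - e')) x" for x
    by (subst walsh_split[of "G x"]) (simp add: c1_def c2_def walsh_mult[symmetric] algebra_simps)
  then have "(\<integral>x. c x * walsh k e' x * G x (walsh k e x) \<partial>lborel)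
     = (\<integral>x. c1 x * walsh k e' x + c2 x * walsh k ((e' - e) \<union> (e - e')) x \<partial>lborel)" by simp
  also have "\<dots> = (\<integral>x. c1 x * walsh k e' x \<partial>lborel) + (\<integral>x. c2 x * walsh k ((e' - e) \<union> (e - e')) x \<partial>lborel)"
    by (intro Bochner_Integration.integral_add step_integrable[OF step_mult_walsh] s)
  also have "\<dots> = 0" using integral_step_walsh[OF s(1) e(1)] integral_step_walsh[OF s(2) ne] by simp
  finally show ?thesis .
qed

text \<open>
  For a fixed type \<open>e\<close> the averages of \<open>f\<close> form a martingale along the refined filtration in which
  \<open>walsh k e\<close> is revealed before the remaining characters of level \<open>k\<close>; the selected type-\<open>e\<close> part
  is then a martingale transform. In the variables (remaining part, selected part) each increment
  moves one variable only, so separate concavity suffices.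
\<close>

lemma burkholder_transform:
  fixes f :: "real ^ 'd \<Rightarrow> real" and s :: "nat \<Rightarrow> real ^ 'd \<Rightarrow> bool"
  assumes p: "1 < p" and f: "\<And>x. x \<notin> half_open_cube \<Longrightarrow> f x = 0" "integrable lborel f" and e: "e \<noteq> {}"
    and s: "\<And>k x y. grid k x = grid k y \<Longrightarrow> s k x = s k y"
  defines "b \<equiv> \<lambda>n x. \<Sum>k<n. if s k x then walsh_coeff k e f x * walsh k e x else 0"
  shows "step n (b n)" and "(\<integral>x. burkholder p (avg n f x - b n x) (b n x) \<partial>lborel) \<le> 0"
proof -
  let ?w = "burkholder p"
  \<comment> \<open>A slope chosen once for each pair of values. It depends on the point only
    through functions that are constant on cells, so that all expressions formed with it are step
    functions.\<close>
  define dw where "dw a b = (SOME s. \<forall>h. ?w (a + h) b \<le> ?w a b + h * s)" for a b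
  have dw: "?w (a + h) b \<le> ?w a b + h * dw a b" for a b h
    using someI_ex[OF burkholder_slope[OF p, of a b]] by (simp add: dw_def)
  have dw': "?w a (b + h) \<le> ?w a b + h * dw b a" for a b h
    using dw[of b h a] by (simp add: burkholder_commute)
  have w0: "?w 0 0 = 0" by (simp add: burkholder_zero_left)
  let ?c = "\<lambda>k e. walsh_coeff k e f"
  have stc: "step k (?c k e')" for k e' by (rule walsh_coeff_step[OF f(1)])
  have stb: "step n (b n)" for n
    unfolding b_def
  proof (rule step_sum)
    fix k assume "k \<in> {..<n}"
    then have k: "Suc k \<le> n" by simp
    have "step (Suc k) (\<lambda>x. if s k x then ?c k e x * walsh k e x else 0)"
      by (rule step_selected[OF step_mult_walsh[OF stc] s[OF grid_SucD]])
    then show "step n (\<lambda>x. if s k x then ?c k e x * walsh k e x else 0)" by (rule step_mono[OF _ k])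
  qed
  then show "step n (b n)" .
  define a where "a n x = avg n f x - b n x" for n x
  have sta: "step n (a n)" for n unfolding a_def by (intro step_diff stc stb)
  have int: "integrable lborel (\<lambda>x. ?w (a n x) (b n x))" for n
    by (rule step_integrable[OF step_compose2[OF sta stb]]) (rule w0)
  have mono: "(\<integral>x. ?w (a (Suc n) x) (b (Suc n) x) \<partial>lborel) \<le> (\<integral>x. ?w (a n x) (b n x) \<partial>lborel)" for n
  proof -
    define C where "C = ?c n e"
    \<comment> \<open>The state once \<open>walsh n e\<close> alone is revealed: the second variable
      moves on selected cells, the first on the others. \<open>R\<close> is the remaining motion,
      entirely in the first variable; \<open>m1\<close> contains the slopes at the old state and
      \<open>G\<close> those at this intermediate one.\<close>
    define a' where "a' x \<sigma> = a n x + (if s n x then 0 else C x * \<sigma>)" for x \<sigma>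
    define b' where "b' x \<sigma> = b n x + (if s n x then C x * \<sigma> else 0)" for x \<sigma>
    define R where "R x = (\<Sum>e'\<in>UNIV - {{}, e}. ?c n e' x * walsh n e' x)" for x
    define m1 where "m1 x = C x * (if s n x then dw (b n x) (a n x) else dw (a n x) (b n x))" for x
    define G where "G x \<sigma> = dw (a' x \<sigma>) (b' x \<sigma>)" for x \<sigma>
    let ?W = "walsh n e"
    have bS: "b (Suc n) x = b' x (?W x)" for x by (simp add: b_def b'_def C_def)
    have aS: "a (Suc n) x = a' x (?W x) + R x" for x
    proof -
      have "avg (Suc n) f x = (\<Sum>e'\<in>UNIV. ?c n e' x * walsh n e' x)" by (rule avg_Suc[OF f(2)])
      also have "\<dots> = ?c n {} x * walsh n {} x + (\<Sum>e'\<in>UNIV - {{}}. ?c n e' x * walsh n e' x)"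
        by (rule sum.remove) auto
      also have "(\<Sum>e'\<in>UNIV - {{}}. ?c n e' x * walsh n e' x) = C x * ?W x + R x"
        using e unfolding R_def C_def by (subst sum.remove[of _ e]) (auto simp: Diff_insert2[symmetric])
      finally show ?thesis unfolding a_def bS by (simp add: a'_def b'_def a_def)
    qed
    have vals: "C x = C y" "a n x = a n y" "b n x = b n y" "s n x = s n y" if "grid n x = grid n y" for x y
      using stepD[OF stc that] stepD[OF sta that] stepD[OF stb that] s[OF that] by (auto simp: C_def)
    have Gc: "G x = G y" if "grid n x = grid n y" for x y
      using vals[OF that] by (auto simp: G_def a'_def b'_def fun_eq_iff)
    have out: "C x = 0" "a n x = 0" "b n x = 0" if "x \<notin> half_open_cube" for x
      using step_outside[OF stc that] step_outside[OF sta that] step_outside[OF stb that] by (auto simp: C_def)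
    have sm1: "step n m1"
    proof (rule stepI)
      fix x y :: "real ^ 'd" assume "grid n x = grid n y"
      note v = vals[OF this]
      show "m1 x = m1 y" unfolding m1_def v ..
    qed (simp add: m1_def out)
    have sR: "step (Suc n) (\<lambda>x. ?c n e' x * walsh n e' x * G x (?W x))" for e'
    proof (rule stepI)
      fix x y :: "real ^ 'd" assume xy: "grid (Suc n) x = grid (Suc n) y"
      have xy': "grid n x = grid n y" by (rule grid_mono[OF _ xy]) simp
      show "?c n e' x * walsh n e' x * G x (?W x) = ?c n e' y * walsh n e' y * G y (?W y)"
        unfolding stepD[OF stc xy'] cellwiseD[OF cellwise_walsh xy] Gc[OF xy'] ..
    qed (simp add: step_outside[OF stc])
    have pt: "?w (a (Suc n) x) (b (Suc n) x) \<le> ?w (a n x) (b n x)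
        + (m1 x * ?W x + (\<Sum>e'\<in>UNIV - {{}, e}. ?c n e' x * walsh n e' x * G x (?W x)))" for x
    proof -
      have "?w (a (Suc n) x) (b (Suc n) x) \<le> ?w (a' x (?W x)) (b' x (?W x)) + R x * G x (?W x)"
        unfolding aS bS G_def by (rule dw)
      also have "?w (a' x (?W x)) (b' x (?W x)) \<le> ?w (a n x) (b n x) + m1 x * ?W x"
        using dw[of "a n x" "C x * ?W x" "b n x"] dw'[of "a n x" "b n x" "C x * ?W x"]
        by (auto simp: a'_def b'_def m1_def mult_ac)
      finally show ?thesis by (simp add: R_def sum_distrib_right)
    qed
    have i1: "integrable lborel (\<lambda>x. m1 x * ?W x)" by (rule step_integrable[OF step_mult_walsh[OF sm1]])
    have i2: "integrable lborel (\<lambda>x. ?c n e' x * walsh n e' x * G x (?W x))" for e'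
      by (rule step_integrable[OF sR])
    have "(\<integral>x. ?w (a (Suc n) x) (b (Suc n) x) \<partial>lborel)
      \<le> (\<integral>x. ?w (a n x) (b n x) + (m1 x * ?W x + (\<Sum>e'\<in>UNIV - {{}, e}. ?c n e' x * walsh n e' x * G x (?W x))) \<partial>lborel)"
      using int i1 i2 pt
      by (intro integral_mono Bochner_Integration.integrable_add Bochner_Integration.integrable_sum) auto
    also have "\<dots> = (\<integral>x. ?w (a n x) (b n x) \<partial>lborel) + ((\<integral>x. m1 x * ?W x \<partial>lborel)
        + (\<Sum>e'\<in>UNIV - {{}, e}. (\<integral>x. ?c n e' x * walsh n e' x * G x (?W x) \<partial>lborel)))"
      using int i1 i2 by simp
    also have "(\<integral>x. m1 x * ?W x \<partial>lborel) = 0" by (rule integral_step_walsh[OF sm1 e])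
    also have "(\<Sum>e'\<in>UNIV - {{}, e}. (\<integral>x. ?c n e' x * walsh n e' x * G x (?W x) \<partial>lborel)) = 0"
      by (intro sum.neutral ballI integral_step_walsh_mult[OF stc Gc]) auto
    finally show ?thesis by simp
  qed
  have "(\<integral>x. ?w (a n x) (b n x) \<partial>lborel) \<le> 0"
  proof (induction n)
    case 0
    \<comment> \<open>The empty sum \<open>b 0\<close> is 0, and on that axis Burkholder's function
      is nonpositive.\<close>
    have "?w (a 0 x) (b 0 x) \<le> 0" for x
      by (simp add: b_def burkholder_zero_right mult_nonpos_nonneg)
    then have "0 \<le> (\<integral>x. - ?w (a 0 x) (b 0 x) \<partial>lborel)"
      by (intro Bochner_Integration.integral_nonneg) simp
    then show ?case by simp
  qed (use mono order_trans in blast)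
  then show "(\<integral>x. ?w (avg n f x - b n x) (b n x) \<partial>lborel) \<le> 0" by (simp add: a_def)
qed

text \<open>Integrating the lower bound of Burkholder's function against the nonpositivity of its
  integral bounds the transform by \<open>avg n f\<close>, which is a contraction of f. The constant
  obtained depends on p alone.\<close>

lemma transform_bound:
  assumes p: "1 < p"
  shows "\<exists>C\<ge>0. \<forall>(f :: real ^ 'd \<Rightarrow> real) s e n. lp_cube p f \<longrightarrow> e \<noteq> {} \<longrightarrow>
    (\<forall>k x y. grid k x = grid k y \<longrightarrow> s k x = s k y) \<longrightarrow>
    lp_norm lborel p (\<lambda>x. \<Sum>k<n. if s k x then walsh_coeff k e f x * walsh k e x else 0) \<le> C * lp_norm lborel p f"
proof -
  obtain A C where AC: "0 < A" "0 < C"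
    "\<And>a b. A * \<bar>b\<bar> powr p - C * \<bar>a + b\<bar> powr p \<le> burkholder p a b"
    using burkholder_lower_bound[OF p] by blast
  have p0: "0 < p" "1 \<le> p" using p by auto
  show ?thesis
  proof (intro exI[of _ "(C / A) powr (1 / p)"] conjI allI impI)
    fix f :: "real ^ 'd \<Rightarrow> real" and s :: "nat \<Rightarrow> real ^ 'd \<Rightarrow> bool" and e :: "'d set" and n
    assume f: "lp_cube p f" and e: "e \<noteq> {}" and s: "\<forall>k x y. grid k x = grid k y \<longrightarrow> s k x = s k y"
    define b where "b x = (\<Sum>k<n. if s k x then walsh_coeff k e f x * walsh k e x else 0)" for x
    have B: "step n b \<and> (\<integral>x. burkholder p (avg n f x - b x) (b x) \<partial>lborel) \<le> 0"
      using burkholder_transform[where f=f and s=s and n=n, OF p _ lp_cube_integrable[OF p0(2) f] e]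
        lp_cube_outside[OF f] s unfolding b_def[abs_def] by blast
    then have stb: "step n b" by simp
    have stX: "step n (avg n f)" by (rule walsh_coeff_step[OF lp_cube_outside[OF f]])
    have ib: "integrable lborel (\<lambda>x. \<bar>b x\<bar> powr p)" by (rule step_integrable[OF step_abs_powr[OF stb p0(1)]])
    have iX: "integrable lborel (\<lambda>x. \<bar>avg n f x\<bar> powr p)" by (rule step_integrable[OF step_abs_powr[OF stX p0(1)]])
    have iw: "integrable lborel (\<lambda>x. burkholder p (avg n f x - b x) (b x))"
      by (rule step_integrable[OF step_compose2[OF step_diff[OF stX stb] stb]]) (simp add: burkholder_zero_left)
    have "(\<integral>x. A * \<bar>b x\<bar> powr p - C * \<bar>avg n f x\<bar> powr p \<partial>lborel) \<le> (\<integral>x. burkholder p (avg n f x - b x) (b x) \<partial>lborel)"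
    proof (rule integral_mono)
      show "A * \<bar>b x\<bar> powr p - C * \<bar>avg n f x\<bar> powr p \<le> burkholder p (avg n f x - b x) (b x)" for x
        using AC(3)[of "b x" "avg n f x - b x"] by simp
    qed (use ib iX iw in auto)
    also have "\<dots> \<le> 0" using B by simp
    finally have "A * (\<integral>x. \<bar>b x\<bar> powr p \<partial>lborel) \<le> C * (\<integral>x. \<bar>avg n f x\<bar> powr p \<partial>lborel)"
      using ib iX by simp
    also have "\<dots> \<le> C * lp_norm lborel p f powr p"
      using AC lp_norm_avg_le[OF p0(2) f, of n] p0
      by (intro mult_left_mono) (auto simp: lp_norm_powr[symmetric] intro: powr_mono2)
    finally have "(\<integral>x. \<bar>b x\<bar> powr p \<partial>lborel) \<le> C / A * lp_norm lborel p f powr p"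
      using AC by (simp add: field_simps)
    also have "\<dots> = ((C / A) powr (1 / p) * lp_norm lborel p f) powr p"
      using AC p0 by (simp add: powr_mult powr_powr)
    finally show "lp_norm lborel p (\<lambda>x. \<Sum>k<n. if s k x then walsh_coeff k e f x * walsh k e x else 0)
       \<le> (C / A) powr (1 / p) * lp_norm lborel p f"
      using p0 unfolding b_def by (subst lp_norm_le_iff) auto
  qed auto
qed

text \<open>A projection is its level 0 term plus one transform for each nonempty type, and the
  number of types enters the constant.\<close>

lemma haar_part_bounded:
  assumes p: "1 < p"
  shows "\<exists>C\<ge>0. \<forall>(f :: real ^ 'd \<Rightarrow> real) A. lp_cube p f \<longrightarrow> finite A \<longrightarrow> A \<subseteq> haar_system \<longrightarrow>
    lp_norm lborel p (haar_part A f) \<le> C * lp_norm lborel p f"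
proof -
  obtain C where C: "0 \<le> C" "\<forall>(f :: real ^ 'd \<Rightarrow> real) s e n. lp_cube p f \<longrightarrow> e \<noteq> {} \<longrightarrow>
    (\<forall>k x y. grid k x = grid k y \<longrightarrow> s k x = s k y) \<longrightarrow>
    lp_norm lborel p (\<lambda>x. \<Sum>k<n. if s k x then walsh_coeff k e f x * walsh k e x else 0) \<le> C * lp_norm lborel p f"
    using transform_bound[OF p, where 'd='d] by (elim exE conjE)
  have p0: "0 < p" "1 \<le> p" using p by auto
  show ?thesis
  proof (intro exI[of _ "1 + card (UNIV - {{} :: 'd set}) * C"] conjI allI impI)
    fix f :: "real ^ 'd \<Rightarrow> real" and A :: "(real ^ 'd \<Rightarrow> real) set"
    assume f: "lp_cube p f" and A: "finite A" "A \<subseteq> haar_system"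
    let ?L = "lp_norm lborel p f"
    obtain n where n: "A \<subseteq> haar_upto n" using finite_haar_subset[OF A] .
    define T where "T e x = (\<Sum>k<n. if selects A k e x then walsh_coeff k e f x * walsh k e x else 0)" for e :: "'d set" and x :: "real ^ 'd"
    define Z where "Z x = (if indicator unit_cube \<in> A then avg 0 f x else 0)" for x :: "real ^ 'd"
    have T: "step n (T e)" for e
      unfolding T_def
    proof (rule step_sum)
      fix k assume "k \<in> {..<n}"
      then have k: "Suc k \<le> n" by simp
      have "step (Suc k) (\<lambda>x. if selects A k e x then walsh_coeff k e f x * walsh k e x else 0)"
        by (rule step_selected[OF step_mult_walsh[OF walsh_coeff_step[OF lp_cube_outside[OF f]]] selects_cong[OF grid_SucD]])
      then show "step n (\<lambda>x. if selects A k e x then walsh_coeff k e f x * walsh k e x else 0)"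
        by (rule step_mono[OF _ k])
    qed
    have "lp_cube p (avg 0 f)" by (rule lp_cube_walsh_coeff[OF p0(1) f])
    then have Z: "in_lp lborel p Z" "lp_norm lborel p Z \<le> ?L"
      unfolding Z_def[abs_def] using lp_norm_avg_le[OF p0(2) f, of 0] p0
      by (cases "(indicator unit_cube :: real ^ 'd \<Rightarrow> real) \<in> A"; auto simp: lp_cube_in_lp)+
    have "haar_part A f x = Z x + (\<Sum>e\<in>UNIV - {{}}. T e x)" for x
    proof -
      have "A \<inter> haar_upto n = A" using n by auto
      then show ?thesis
        using haar_part_levels[where f=f and A=A and n=n and x=x, OF lp_cube_outside[OF f]]
        unfolding Z_def T_def by (subst sum.swap) simp
    qed
    then have "lp_norm lborel p (haar_part A f) = lp_norm lborel p (\<lambda>x. Z x + (\<Sum>e\<in>UNIV - {{}}. T e x))"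
      by presburger
    also have "\<dots> \<le> lp_norm lborel p Z + lp_norm lborel p (\<lambda>x. \<Sum>e\<in>UNIV - {{}}. T e x)"
      by (intro lp_norm_triangle p0 Z in_lp_sum lp_cube_in_lp step_lp_cube[OF T])
    also have "lp_norm lborel p (\<lambda>x. \<Sum>e\<in>UNIV - {{}}. T e x) \<le> (\<Sum>e\<in>UNIV - {{}}. lp_norm lborel p (T e))"
      by (intro lp_norm_sum p0 lp_cube_in_lp step_lp_cube[OF T])
    also have "\<dots> \<le> (\<Sum>e\<in>UNIV - {{} :: 'd set}. C * ?L)"
      unfolding T_def by (intro sum_mono C(2)[rule_format, OF f _ selects_cong]) auto
    finally show "lp_norm lborel p (haar_part A f) \<le> (1 + card (UNIV - {{} :: 'd set}) * C) * ?L"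
      using Z(2) by (simp add: algebra_simps)
  qed (use C(1) in simp)
qed

section \<open>Partial sums with one incomplete level\<close>

lemma haar_part_between:
  fixes f :: "real ^ 'd \<Rightarrow> real"
  assumes f: "\<And>x. x \<notin> half_open_cube \<Longrightarrow> f x = 0" "integrable lborel f"
    and A: "haar_upto n \<subseteq> A" "A \<subseteq> haar_upto (Suc n)"
  shows "haar_part A f x = avg n f x
    + (\<Sum>e\<in>UNIV - {{}}. if selects A n e x then walsh_coeff n e f x * walsh n e x else 0)"
proof -
  have "A = haar_upto n \<union> (A \<inter> haar_block (Suc n))" using A by (auto simp: haar_upto_def atMost_Suc)
  moreover have "haar_upto n \<inter> (A \<inter> haar_block (Suc n)) = {}"
    using haar_block_disjoint by (fastforce simp: haar_upto_def)
  ultimately have "haar_part A f x = haar_part (haar_upto n) f x + haar_part (A \<inter> haar_block (Suc n)) f x"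
    using haar_part_Un[of "haar_upto n" "A \<inter> haar_block (Suc n)" f x]
    by (simp add: finite_haar_upto finite_haar_block)
  then show ?thesis using haar_part_upto[of f n x] haar_part_block[of f A n x] f by simp
qed

text \<open>Only one level is incomplete, and there the part of each type is dominated pointwise by
  a Walsh coefficient function, itself a contraction of f. No cancellation between levels is
  involved, so p = 1 is included.\<close>

lemma haar_part_blockwise_bounded:
  fixes f :: "real ^ 'd \<Rightarrow> real"
  assumes p: "1 \<le> p" and f: "lp_cube p f" and A: "haar_upto n \<subseteq> A" "A \<subseteq> haar_upto (Suc n)"
  shows "lp_norm lborel p (haar_part A f) \<le> (1 + card (UNIV - {{} :: 'd set})) * lp_norm lborel p f"
proof -
  let ?L = "lp_norm lborel p f"
  have p0: "0 < p" using p by auto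
  note fo = lp_cube_outside[OF f]
  define T where "T e x = (if selects A n e x then walsh_coeff n e f x * walsh n e x else 0)" for e x
  have T: "step (Suc n) (T e)" for e
    unfolding T_def
    by (rule step_selected[OF step_mult_walsh[OF walsh_coeff_step[OF fo]] selects_cong[OF grid_SucD]])
  have "haar_part A f x = avg n f x + (\<Sum>e\<in>UNIV - {{}}. T e x)" for x
    unfolding T_def by (rule haar_part_between) (use fo lp_cube_integrable[OF p f] A in auto)
  then have "lp_norm lborel p (haar_part A f) = lp_norm lborel p (\<lambda>x. avg n f x + (\<Sum>e\<in>UNIV - {{}}. T e x))"
    by presburger
  also have "\<dots> \<le> lp_norm lborel p (avg n f) + lp_norm lborel p (\<lambda>x. \<Sum>e\<in>UNIV - {{}}. T e x)"
    by (intro lp_norm_triangle p p0 in_lp_sum lp_cube_in_lp step_lp_cube[OF T] lp_cube_walsh_coeff f)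
  also have "lp_norm lborel p (avg n f) \<le> ?L" by (rule lp_norm_avg_le[OF p f])
  also have "lp_norm lborel p (\<lambda>x. \<Sum>e\<in>UNIV - {{}}. T e x) \<le> (\<Sum>e\<in>UNIV - {{}}. lp_norm lborel p (T e))"
    by (intro lp_norm_sum p p0 lp_cube_in_lp step_lp_cube[OF T])
  also have "\<dots> \<le> (\<Sum>e\<in>UNIV - {{} :: 'd set}. ?L)"
  proof (rule sum_mono)
    fix e :: "'d set"
    have "lp_norm lborel p (T e) \<le> lp_norm lborel p (walsh_coeff n e f)"
      using step_measurable[OF T]
      by (intro lp_norm_mono p0 lp_cube_in_lp lp_cube_walsh_coeff f) (auto simp: T_def abs_mult)
    also have "\<dots> \<le> ?L" by (rule lp_norm_walsh_coeff_le[OF p f])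
    finally show "lp_norm lborel p (T e) \<le> ?L" .
  qed
  finally show ?thesis by (simp add: algebra_simps)
qed

text \<open>Projections commute with averages, so for j > K the error of the residual at scale j is
  the residual of f - avg j f. For j \<le> K the average of the residual vanishes, and the residual
  of f is that of f - avg K f. The maximum unites the two cases.\<close>

lemma approx_err_haar_part:
  fixes f :: "real ^ 'd \<Rightarrow> real"
  assumes p: "1 \<le> p" and f: "lp_cube p f" and A: "finite A" "A \<subseteq> haar_system" "haar_upto K \<subseteq> A"
    and C: "\<And>g. lp_cube p g \<Longrightarrow> lp_norm lborel p (haar_part A g) \<le> C * lp_norm lborel p g"
  shows "approx_err p (\<lambda>x. f x - haar_part A f x) j \<le> (1 + C) * approx_err p f (max j K)"
    and "lp_norm lborel p (\<lambda>x. f x - haar_part A f x) \<le> (1 + C) * approx_err p f K"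
proof -
  have p0: "0 < p" using p by simp
  note fo = lp_cube_outside[OF f] lp_cube_integrable[OF p f]
  have lin: "haar_part A (\<lambda>x. f x - avg n f x) x = haar_part A f x - haar_part (A \<inter> haar_upto n) f x" for n x
  proof -
    have "haar_part A (\<lambda>x. f x - avg n f x) x = haar_part A f x - haar_part A (avg n f) x"
      unfolding haar_part_def sum_subtractf[symmetric] using A fo
      by (intro sum.cong) (auto simp: haar_coeff_diff step_integrable[OF walsh_coeff_step] left_diff_distrib subset_iff)
    then show ?thesis using haar_part_avg[of f A n x] fo A(1,2) by simp
  qed
  have bound: "lp_norm lborel p (\<lambda>x. (f x - avg n f x) - haar_part A (\<lambda>x. f x - avg n f x) x) \<le> (1 + C) * approx_err p f n" for n
  proof -
    have l: "lp_cube p (\<lambda>x. f x - avg n f x)" by (rule lp_cube_approx[OF p0 f])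
    have "lp_norm lborel p (\<lambda>x. (f x - avg n f x) - haar_part A (\<lambda>x. f x - avg n f x) x)
       \<le> lp_norm lborel p (\<lambda>x. f x - avg n f x) + lp_norm lborel p (haar_part A (\<lambda>x. f x - avg n f x))"
      by (intro lp_norm_triangle_diff p lp_cube_in_lp l haar_part_lp_cube[OF p0 A(1,2)])
    with C[OF l] show ?thesis by (simp add: approx_err_def algebra_simps)
  qed
  have AK: "A \<inter> haar_upto n = haar_upto n" if "n \<le> K" for n
    using A(3) that by (fastforce simp: haar_upto_def)
  have hu: "haar_part (haar_upto n) f x = avg n f x" for n x using haar_part_upto[of f n x] fo by simp
  have K: "f x - haar_part A f x = (f x - avg K f x) - haar_part A (\<lambda>x. f x - avg K f x) x" for x
    unfolding lin AK[OF order_refl] hu by simp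
  show K': "lp_norm lborel p (\<lambda>x. f x - haar_part A f x) \<le> (1 + C) * approx_err p f K"
    unfolding K by (rule bound)
  have av: "avg j (\<lambda>x. f x - haar_part A f x) x = avg j f x - haar_part (A \<inter> haar_upto j) f x" for x
    using lp_cube_integrable[OF p haar_part_lp_cube[OF p0 A(1,2)]]
    by (subst walsh_coeff_diff[OF fo(2)]) (auto simp: avg_haar_part[OF A(1,2)])
  show "approx_err p (\<lambda>x. f x - haar_part A f x) j \<le> (1 + C) * approx_err p f (max j K)"
  proof (cases "j \<le> K")
    case True
    then have "max j K = K" by simp
    then show ?thesis using K' unfolding approx_err_def av AK[OF True] hu by simp
  next
    case False
    then have "max j K = j" by simp
    have eq: "f x - haar_part A f x - (avg j f x - haar_part (A \<inter> haar_upto j) f x)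
      = (f x - avg j f x) - haar_part A (\<lambda>x. f x - avg j f x) x" for x unfolding lin by simp
    show ?thesis unfolding \<open>max j K = j\<close> using bound[of j] unfolding approx_err_def av eq .
  qed
qed

text \<open>A substitute for monotonicity of the errors: subtracting \<open>avg j f\<close> does not
  change the error at the finer scale k, and any error is at most twice the norm. It supplies the
  majorant in \<open>tail_max_tendsto\<close>.\<close>

lemma approx_err_double:
  fixes f :: "real ^ 'd \<Rightarrow> real"
  assumes p: "1 \<le> p" and f: "lp_cube p f" and "j \<le> k"
  shows "approx_err p f k \<le> 2 * approx_err p f j"
proof -
  have p0: "0 < p" using p by simp
  note fo = lp_cube_outside[OF f] lp_cube_integrable[OF p f]
  define g where "g x = f x - avg j f x" for x
  have g: "lp_cube p g" unfolding g_def by (rule lp_cube_approx[OF p0 f])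
  have "avg k (avg j f) x = avg j f x" for x
    by (rule avg_cellwise[OF cellwise_mono[OF walsh_coeff_cellwise assms(3)]])
  then have "g x - avg k g x = f x - avg k f x" for x
    unfolding g_def using step_integrable[OF walsh_coeff_step[OF fo(1)]]
    by (subst walsh_coeff_diff[OF fo(2)]) auto
  then have "approx_err p f k = approx_err p g k" by (simp add: approx_err_def)
  also have "\<dots> \<le> 2 * lp_norm lborel p g" by (rule approx_err_le[OF p g])
  finally show ?thesis by (simp add: g_def[abs_def] approx_err_def)
qed

text \<open>Continuity of the coefficient functionals: Haar functions are bounded by 1, and on a
  cube of measure 1 the L_1 norm is at most the L_p norm, which is where p \<ge> 1 enters.\<close>

lemma abs_integral_core_le:
  fixes f :: "real ^ 'd \<Rightarrow> real"
  assumes p: "1 \<le> p" and f: "lp_cube p f" and h: "h \<in> haar_system"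
  shows "\<bar>\<integral>x. f x * core h x \<partial>lborel\<bar> \<le> lp_norm lborel p f"
proof -
  have "\<bar>\<integral>x. f x * core h x \<partial>lborel\<bar> \<le> (\<integral>x. \<bar>f x * core h x\<bar> \<partial>lborel)" by (rule integral_abs_bound)
  also have "\<dots> \<le> (\<integral>x. \<bar>f x\<bar> \<partial>lborel)"
  proof (rule integral_mono)
    show "integrable lborel (\<lambda>x. \<bar>f x * core h x\<bar>)"
      using integrable_mult_core[OF h lp_cube_integrable[OF p f]] by (rule integrable_abs)
    show "integrable lborel (\<lambda>x. \<bar>f x\<bar>)" using lp_cube_integrable[OF p f] by (rule integrable_abs)
    show "\<bar>f x * core h x\<bar> \<le> \<bar>f x\<bar>" for x
      using haar_system_measurable(2)[OF h, of x] by (simp add: abs_mult mult_left_le)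
  qed
  finally have le: "\<bar>\<integral>x. f x * core h x \<partial>lborel\<bar> \<le> (\<integral>x. \<bar>f x\<bar> \<partial>lborel)" .
  have "\<bar>(\<integral>x. indicator half_open_cube x * \<bar>f x\<bar> \<partial>lborel) / 1\<bar> powr p
      \<le> (\<integral>x. indicator half_open_cube x * \<bar>\<bar>f x\<bar>\<bar> powr p \<partial>lborel) / 1"
    using lp_cube_integrable[OF p f] in_lp_integrable[OF lp_cube_in_lp[OF f]]
    by (intro integral_jensen_powr p) (auto simp: emeasure_half_open_cube)
  moreover have ind: "indicator half_open_cube x * \<bar>f x\<bar> = \<bar>f x\<bar>"
    "indicator half_open_cube x * \<bar>\<bar>f x\<bar>\<bar> powr p = \<bar>f x\<bar> powr p" for x
    using lp_cube_outside[OF f, of x] by (auto simp: indicator_def)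
  ultimately have "(\<integral>x. \<bar>f x\<bar> \<partial>lborel) powr p \<le> (\<integral>x. \<bar>f x\<bar> powr p \<partial>lborel)"
    unfolding ind by simp
  then have "(\<integral>x. \<bar>f x\<bar> \<partial>lborel) powr p \<le> lp_norm lborel p f powr p" using p by (simp add: lp_norm_powr)
  then have "(\<integral>x. \<bar>f x\<bar> \<partial>lborel) \<le> lp_norm lborel p f"
    using p powr_less_mono2[of p "lp_norm lborel p f" "\<integral>x. \<bar>f x\<bar> \<partial>lborel"] by force
  with le show ?thesis by simp
qed

section \<open>A criterion for Schauder bases\<close>

lemma haar_coeff_index:
  fixes h :: "nat \<Rightarrow> real ^ 'd \<Rightarrow> real"
  shows "inj h \<Longrightarrow> range h \<subseteq> haar_system \<Longrightarrow> haar_coeff (\<lambda>x. \<Sum>m<n. c m * core (h m) x) (h j) = (if j < n then c j else 0)"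
proof -
  assume h: "inj h" "range h \<subseteq> haar_system"
  have "(\<lambda>x. \<Sum>m<n. c m * core (h m) x) = (\<lambda>x. \<Sum>g\<in>h ` {..<n}. c (inv h g) * core g x)"
    using h by (intro ext, subst sum.reindex) (auto intro: inj_on_subset)
  then show ?thesis
    using h haar_coeff_lincomb[where A="h ` {..<n}" and h="h j" and c="\<lambda>g. c (inv h g)", OF finite_imageI[OF finite_lessThan]]
    by (auto simp: inj_image_mem_iff image_subset_iff)
qed

lemma haar_part_index:
  assumes "inj h"
  shows "haar_part (h ` {..<n}) f x = (\<Sum>m<n. haar_coeff f (h m) * core (h m) x)"
  unfolding haar_part_def by (subst sum.reindex) (auto intro: inj_on_subset[OF assms])

lemma besov_norm_nonneg: "0 \<le> besov_norm p q f"
  by (simp add: besov_norm_def)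

lemma lp_norm_le_besov_norm:
  assumes "0 < q"
  shows "lp_norm lborel p f \<le> besov_norm p q f"
proof -
  have "lp_norm lborel p f powr q \<le> besov_norm p q f powr q"
    using besov_norm_powr[OF assms, of p f] by simp
  then show ?thesis
    using assms powr_less_mono2[of q "besov_norm p q f" "lp_norm lborel p f"] besov_norm_nonneg[of p q f] by force
qed

lemma tendsto_besov_norm:
  assumes "0 < q" "(\<lambda>n. besov_norm p q (R n) powr q) \<longlonglongrightarrow> 0"
  shows "(\<lambda>n. besov_norm p q (R n)) \<longlonglongrightarrow> 0"
proof -
  have "(\<lambda>n. (besov_norm p q (R n) powr q) powr (1 / q)) \<longlonglongrightarrow> 0 powr (1 / q)"
    using assms by (intro tendsto_powr') auto
  then show ?thesis using assms by (simp add: powr_powr besov_norm_nonneg)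
qed

text \<open>The coefficient functionals are continuous and biorthogonal to the system. The j-th
  coefficient of the residual no longer changes once n > j, and it must tend to 0.\<close>

lemma haar_expansion_unique:
  fixes f :: "real ^ 'd \<Rightarrow> real"
  assumes p: "1 \<le> p" and q: "0 < q" and f: "lp_cube p f" and h: "inj h" "range h \<subseteq> haar_system"
    and lim: "(\<lambda>n. besov_norm p q (\<lambda>x. f x - (\<Sum>m<n. c m * core (h m) x))) \<longlonglongrightarrow> 0"
  shows "c j = haar_coeff f (h j)"
proof -
  have p0: "0 < p" using p by simp
  have hj: "h j \<in> haar_system" for j using h by auto
  define S where "S n x = (\<Sum>m<n. c m * core (h m) x)" for n x
  have S: "lp_cube p (S n)" for n
    unfolding S_def using hj representsD(1)[OF core_represents[OF p0]] by (intro lp_cube_sum lp_cube_cmult p0) auto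
  let ?s = "\<integral>x. core (h j) x * core (h j) x \<partial>lborel"
  have s: "0 < ?s" by (rule core_square_pos[OF hj])
  have le: "\<bar>haar_coeff f (h j) - c j\<bar> * ?s \<le> besov_norm p q (\<lambda>x. f x - S n x)" if "j < n" for n
  proof -
    have e: "haar_coeff (\<lambda>x. f x - S n x) (h j) = haar_coeff f (h j) - c j"
      using haar_coeff_index[OF h, of c n j] that
      by (subst haar_coeff_diff[OF hj lp_cube_integrable[OF p f] lp_cube_integrable[OF p S]]) (simp add: S_def[abs_def])
    have "(haar_coeff f (h j) - c j) * ?s = (\<integral>x. (f x - S n x) * core (h j) x \<partial>lborel)"
      using s by (subst e[symmetric]) (simp add: haar_coeff_def)
    moreover have "\<bar>haar_coeff f (h j) - c j\<bar> * ?s = \<bar>(haar_coeff f (h j) - c j) * ?s\<bar>"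
      using s by (simp only: abs_mult abs_of_pos)
    ultimately have "\<bar>haar_coeff f (h j) - c j\<bar> * ?s = \<bar>\<integral>x. (f x - S n x) * core (h j) x \<partial>lborel\<bar>"
      by (simp only:)
    also have "\<dots> \<le> lp_norm lborel p (\<lambda>x. f x - S n x)"
      by (rule abs_integral_core_le[OF p lp_cube_diff[OF p0 f S] hj])
    also have "\<dots> \<le> besov_norm p q (\<lambda>x. f x - S n x)" by (rule lp_norm_le_besov_norm[OF q])
    finally show ?thesis .
  qed
  have "\<bar>haar_coeff f (h j) - c j\<bar> * ?s \<le> 0"
    by (rule tendsto_lowerbound[OF lim[folded S_def]])
       (use le in \<open>auto intro!: eventually_sequentiallyI[of "Suc j"]\<close>)
  with s show ?thesis by (simp add: mult_le_0_iff)
qed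

text \<open>Tannery's theorem: each term equals \<open>E K powr q\<close> as soon as K \<ge> j and
  so tends to 0, while \<open>double\<close> gives the summable majorant
  \<open>2 powr q * E j powr q\<close>.\<close>

lemma tail_max_tendsto:
  fixes E :: "nat \<Rightarrow> real"
  assumes E0: "\<And>k. 0 \<le> E k" and double: "\<And>j k. j \<le> k \<Longrightarrow> E k \<le> 2 * E j" and q: "0 < q"
    and sum: "summable (\<lambda>k. E k powr q)"
  shows "(\<lambda>K. \<Sum>j. E (max j K) powr q) \<longlonglongrightarrow> 0" and "summable (\<lambda>j. E (max j K) powr q)"
proof -
  have bnd: "E (max j K) powr q \<le> 2 powr q * E j powr q" for j K
  proof -
    have "E (max j K) powr q \<le> (2 * E j) powr q" using E0 double[of j "max j K"] q by (intro powr_mono2) auto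
    then show ?thesis using E0 by (simp add: powr_mult)
  qed
  have s2: "summable (\<lambda>j. 2 powr q * E j powr q)" by (rule summable_mult[OF sum])
  show "summable (\<lambda>j. E (max j K) powr q)"
    by (rule summable_comparison_test'[OF s2]) (use bnd in auto)
  have "((\<lambda>K. \<Sum>j. E (max j K) powr q) \<longlongrightarrow> (\<Sum>j. 0)) sequentially"
  proof (rule tannerys_theorem[THEN conjunct2, THEN conjunct2])
    show "(\<lambda>K. E (max j K) powr q) \<longlonglongrightarrow> 0" for j
    proof (rule Lim_transform_eventually[OF summable_LIMSEQ_zero[OF sum]])
      show "\<forall>\<^sub>F K in sequentially. E K powr q = E (max j K) powr q"
        by (rule eventually_sequentiallyI[of j]) (simp add: max_def)
    qed
    show "\<forall>\<^sub>F (k, n) in sequentially \<times>\<^sub>F sequentially. norm (E (max k n) powr q) \<le> 2 powr q * E k powr q"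
      by (rule always_eventually) (use bnd in auto)
  qed (use s2 in auto)
  then show "(\<lambda>K. \<Sum>j. E (max j K) powr q) \<longlonglongrightarrow> 0" by simp
qed

lemma enumeration_covers:
  fixes h :: "nat \<Rightarrow> 'a"
  assumes "finite B" "B \<subseteq> range h"
  shows "\<exists>N. \<forall>n\<ge>N. B \<subseteq> h ` {..<n}"
proof -
  obtain M where M: "finite M" "B = h ` M" using assms finite_subset_image by metis
  then obtain N where "\<forall>m\<in>M. m < N" using finite_nat_set_iff_bounded by auto
  then show ?thesis using M by (intro exI[of _ N]) auto
qed

text \<open>Uniform bounds on L_p are turned into convergence in the Besov norm. Once a partial sum
  contains all levels up to K, its residual is controlled by \<open>D K\<close>, whatever else the
  sum contains, and every enumeration reaches that stage for every K.\<close>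

lemma haar_schauder_criterion:
  fixes h :: "nat \<Rightarrow> real ^ 'd \<Rightarrow> real"
  assumes p: "1 \<le> p" and q: "0 < q" and h: "bij_betw h UNIV haar_system"
    and C: "0 \<le> C" "\<And>n (g :: real ^ 'd \<Rightarrow> real). lp_cube p g \<Longrightarrow> lp_norm lborel p (haar_part (h ` {..<n}) g) \<le> C * lp_norm lborel p g"
  shows "schauder_basis (besov_space p q) (besov_quasinorm p q) h"
  unfolding schauder_basis_def
proof (intro conjI ballI)
  have p0: "0 < p" using p by simp
  have inj: "inj h" and ran: "range h = haar_system" using h by (auto simp: bij_betw_def)
  have hm: "h m \<in> haar_system" for m using ran by auto
  show "range h \<subseteq> besov_space p q"
  proof
    fix g assume "g \<in> range h"
    then have g: "g \<in> haar_system" using ran by simp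
    then obtain n where n: "g \<in> haar_block n" by (auto simp: haar_system_def)
    have "has_besov p q (core g)" using besov_norm_step[OF p0 q, where 'd='d] core_step[OF n] by blast
    then show "g \<in> besov_space p q" using represents_besov_space[OF p0 core_represents[OF p0 g]] by blast
  qed
  fix g :: "real ^ 'd \<Rightarrow> real" assume g: "g \<in> besov_space p q"
  then have "g \<in> Lp_space p" by (simp add: besov_space_def)
  then obtain f where rep: "represents p f g" using Lp_space_represents[OF p0] by blast
  have f: "lp_cube p f" by (rule representsD(1)[OF rep])
  have hb: "has_besov p q f" using g represents_besov_space[OF p0 rep] by blast
  have N: "besov_quasinorm p q (\<lambda>x. g x - (\<Sum>m<n. c m * h m x)) = besov_norm p q (\<lambda>x. f x - (\<Sum>m<n. c m * core (h m) x))" for c n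
    by (intro represents_besov_quasinorm p0 represents_diff rep represents_lincomb core_represents hm)
  define E where "E = approx_err p f"
  have sE: "summable (\<lambda>k. E k powr q)"
    unfolding E_def using besov_lower[OF p q, where 'd='d] f hb by blast
  obtain Cu where Cu: "\<And>f :: real ^ 'd \<Rightarrow> real. lp_cube p f \<Longrightarrow> summable (\<lambda>k. approx_err p f k powr q) \<Longrightarrow>
    besov_norm p q f powr q \<le> lp_norm lborel p f powr q + Cu * (\<Sum>k. approx_err p f k powr q)"
    using besov_upper[OF p q, where 'd='d] by blast
  let ?R = "\<lambda>n x. f x - haar_part (h ` {..<n}) f x"
  have E0: "0 \<le> E k" for k by (simp add: E_def)
  have dbl: "j \<le> k \<Longrightarrow> E k \<le> 2 * E j" for j k unfolding E_def by (rule approx_err_double[OF p f])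
  note tm = tail_max_tendsto[of E, OF E0 dbl q sE]
  \<comment> \<open>The q-th power of the norm bound for a residual: its L_p part at scale K plus
    the series of errors, both from \<open>approx_err_haar_part\<close>.\<close>
  define D where "D K = (1 + C) powr q * (E K powr q + \<bar>Cu\<bar> * (\<Sum>j. E (max j K) powr q))" for K
  have bound: "besov_norm p q (?R n) powr q \<le> D K" if cov: "haar_upto K \<subseteq> h ` {..<n}" for n K
  proof -
    have A: "finite (h ` {..<n})" "h ` {..<n} \<subseteq> haar_system" using hm by auto
    note ae = approx_err_haar_part[OF p f A cov C(2), folded E_def]
    have R: "lp_cube p (?R n)" by (intro lp_cube_diff haar_part_lp_cube p0 f A)
    have le: "approx_err p (?R n) j powr q \<le> (1 + C) powr q * E (max j K) powr q" for j
    proof -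
      have "approx_err p (?R n) j powr q \<le> ((1 + C) * E (max j K)) powr q"
        using ae(1)[of j] q by (intro powr_mono2) auto
      then show ?thesis using C E0 by (simp add: powr_mult)
    qed
    have sm: "summable (\<lambda>j. (1 + C) powr q * E (max j K) powr q)" by (rule summable_mult[OF tm(2)])
    have sR: "summable (\<lambda>j. approx_err p (?R n) j powr q)"
      by (rule summable_comparison_test'[OF sm]) (use le in auto)
    have "(\<Sum>j. approx_err p (?R n) j powr q) \<le> (\<Sum>j. (1 + C) powr q * E (max j K) powr q)"
      by (rule suminf_le[OF le sR sm])
    also have "\<dots> = (1 + C) powr q * (\<Sum>j. E (max j K) powr q)" by (rule suminf_mult[OF tm(2)])
    finally have 1: "(\<Sum>j. approx_err p (?R n) j powr q) \<le> (1 + C) powr q * (\<Sum>j. E (max j K) powr q)" .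
    have 2: "lp_norm lborel p (?R n) powr q \<le> (1 + C) powr q * E K powr q"
    proof -
      have "lp_norm lborel p (?R n) powr q \<le> ((1 + C) * E K) powr q"
        using ae(2) q by (intro powr_mono2) auto
      then show ?thesis using C E0 by (simp add: powr_mult)
    qed
    have "besov_norm p q (?R n) powr q \<le> lp_norm lborel p (?R n) powr q + Cu * (\<Sum>j. approx_err p (?R n) j powr q)"
      by (rule Cu[OF R sR])
    also have "\<dots> \<le> lp_norm lborel p (?R n) powr q + \<bar>Cu\<bar> * (\<Sum>j. approx_err p (?R n) j powr q)"
      using suminf_nonneg[OF sR] by (intro add_left_mono mult_right_mono) auto
    also have "\<dots> \<le> (1 + C) powr q * E K powr q + \<bar>Cu\<bar> * ((1 + C) powr q * (\<Sum>j. E (max j K) powr q))"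
      using 1 2 by (intro add_mono mult_left_mono) auto
    also have "\<dots> = D K" by (simp add: D_def algebra_simps)
    finally show ?thesis .
  qed
  have "D \<longlonglongrightarrow> (1 + C) powr q * (0 + \<bar>Cu\<bar> * 0)"
    unfolding D_def by (intro tendsto_intros summable_LIMSEQ_zero[OF sE] tm(1))
  then have D: "D \<longlonglongrightarrow> 0" by simp
  have "(\<lambda>n. besov_norm p q (?R n) powr q) \<longlonglongrightarrow> 0"
  proof (rule LIMSEQ_I)
    fix r :: real assume "0 < r"
    then obtain K where K: "norm (D K - 0) < r" using LIMSEQ_D[OF D] by blast
    obtain N where N: "\<forall>n\<ge>N. haar_upto K \<subseteq> h ` {..<n}"
      using enumeration_covers[OF finite_haar_upto, of K h] haar_upto_subset ran by metis
    have "norm (besov_norm p q (?R n) powr q - 0) < r" if "N \<le> n" for n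
      using bound[of K n] N that K by fastforce
    then show "\<exists>N. \<forall>n\<ge>N. norm (besov_norm p q (?R n) powr q - 0) < r" by blast
  qed
  then have lim: "(\<lambda>n. besov_norm p q (?R n)) \<longlonglongrightarrow> 0" by (rule tendsto_besov_norm[OF q])
  show "\<exists>!c. (\<lambda>n. besov_quasinorm p q (\<lambda>x. g x - (\<Sum>m<n. c m * h m x))) \<longlonglongrightarrow> 0"
  proof (rule ex1I[of _ "\<lambda>m. haar_coeff f (h m)"])
    show "(\<lambda>n. besov_quasinorm p q (\<lambda>x. g x - (\<Sum>m<n. haar_coeff f (h m) * h m x))) \<longlonglongrightarrow> 0"
      using lim unfolding N haar_part_index[OF inj] .
    fix c assume "(\<lambda>n. besov_quasinorm p q (\<lambda>x. g x - (\<Sum>m<n. c m * h m x))) \<longlonglongrightarrow> 0"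
    then have "(\<lambda>n. besov_norm p q (\<lambda>x. f x - (\<Sum>m<n. c m * core (h m) x))) \<longlonglongrightarrow> 0" unfolding N .
    from haar_expansion_unique[OF p q f inj _ this] ran show "c = (\<lambda>m. haar_coeff f (h m))" by auto
  qed
qed

section \<open>Levels of Haar functions and enumerations sorted by rank\<close>

lemma haar_block_nonempty: "haar_block k \<noteq> ({} :: (real ^ 'd \<Rightarrow> real) set)"
proof (cases k)
  case (Suc n)
  have "(\<lambda>_. 1, UNIV) \<in> haar_index n \<times> {e :: 'd set. e \<noteq> {}}" by (auto simp: haar_index_def)
  then show ?thesis unfolding Suc haar_block_Suc by blast
qed simp

definition haar_level :: "(real ^ 'd \<Rightarrow> real) \<Rightarrow> nat" where
  "haar_level h = (THE k. h \<in> haar_block k)"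

lemma haar_level_eq: "h \<in> haar_block k \<Longrightarrow> haar_level h = k"
  unfolding haar_level_def using haar_block_disjoint by blast

lemma haar_level_block: "h \<in> haar_system \<Longrightarrow> h \<in> haar_block (haar_level h)"
  by (auto simp: haar_system_def haar_level_eq)

lemma infinite_haar_system: "infinite (haar_system :: (real ^ 'd \<Rightarrow> real) set)"
proof
  assume fin: "finite (haar_system :: (real ^ 'd \<Rightarrow> real) set)"
  have "UNIV \<subseteq> haar_level ` (haar_system :: (real ^ 'd \<Rightarrow> real) set)"
  proof
    fix k :: nat
    obtain h :: "real ^ 'd \<Rightarrow> real" where "h \<in> haar_block k" using haar_block_nonempty by blast
    then show "k \<in> haar_level ` (haar_system :: (real ^ 'd \<Rightarrow> real) set)"
      by (intro image_eqI[of _ _ h]) (auto simp: haar_level_eq haar_system_def)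
  qed
  with fin show False by (meson finite_imageI finite_subset infinite_UNIV_nat)
qed

lemma haar_upto_iff: "h \<in> haar_upto n \<longleftrightarrow> h \<in> haar_system \<and> haar_level h \<le> n"
  by (auto simp: haar_upto_def haar_level_eq dest: haar_level_block) (auto simp: haar_system_def)

lemma haar_upto_le: "haar_upto m \<subseteq> (haar_upto n :: (real ^ 'd \<Rightarrow> real) set) \<Longrightarrow> m \<le> n"
proof -
  assume sub: "haar_upto m \<subseteq> (haar_upto n :: (real ^ 'd \<Rightarrow> real) set)"
  obtain h :: "real ^ 'd \<Rightarrow> real" where h: "h \<in> haar_block m" using haar_block_nonempty by blast
  then have "h \<in> haar_upto m" by (auto simp: haar_upto_def)
  with sub have "haar_level h \<le> n" by (auto simp: haar_upto_iff)
  then show ?thesis using haar_level_eq[OF h] by simp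
qed

text \<open>The code \<open>\<phi>\<close> places an element behind all those of smaller rank, which
  are finitely many; H is then listed in increasing order of the code.\<close>

lemma rank_enumeration:
  fixes r :: "'a \<Rightarrow> nat"
  assumes inf: "infinite H" and fin: "\<And>j. finite {x \<in> H. r x = j}"
  obtains h where "bij_betw h (UNIV :: nat set) H" "\<And>m n. m \<le> n \<Longrightarrow> r (h m) \<le> r (h n)"
proof -
  define F where "F j = {x \<in> H. r x = j}" for j
  have "\<exists>g. bij_betw g (F j) {0..<card (F j)}" for j
    using fin[of j] unfolding F_def by (rule ex_bij_betw_finite_nat)
  then obtain g where g: "\<And>j. bij_betw (g j) (F j) {0..<card (F j)}" by metis
  define S where "S n = (\<Sum>j<n. card (F j))" for n
  define \<phi> where "\<phi> x = S (r x) + g (r x) x" for x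
  have gl: "g (r x) x < card (F (r x))" if "x \<in> H" for x
    using bij_betwE[OF g[of "r x"]] that by (auto simp: F_def)
  have less: "\<phi> x < \<phi> y" if "x \<in> H" "r x < r y" for x y
  proof -
    have "\<phi> x < S (Suc (r x))" using gl[OF that(1)] by (simp add: \<phi>_def S_def)
    also have "\<dots> \<le> S (r y)" unfolding S_def using that by (intro sum_mono2) auto
    finally show ?thesis by (simp add: \<phi>_def)
  qed
  have inj: "inj_on \<phi> H"
  proof (rule inj_onI)
    fix x y assume xy: "x \<in> H" "y \<in> H" "\<phi> x = \<phi> y"
    then have r: "r x = r y" using less[of x y] less[of y x] by (metis linorder_neqE_nat less_irrefl)
    then have "g (r x) x = g (r x) y" using xy by (simp add: \<phi>_def)
    moreover have "x \<in> F (r x)" "y \<in> F (r x)" using xy r by (auto simp: F_def)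
    ultimately show "x = y" using g[of "r x"] by (auto simp: bij_betw_def dest: inj_onD)
  qed
  define T where "T = \<phi> ` H"
  have infT: "infinite T" using inf inj finite_imageD unfolding T_def by blast
  define h where "h = inv_into H \<phi> \<circ> enumerate T"
  have bT: "bij_betw (inv_into H \<phi>) T H"
    unfolding T_def by (rule bij_betw_inv_into) (simp add: bij_betw_def inj)
  have bh: "bij_betw h UNIV H"
    unfolding h_def by (rule bij_betw_trans[OF bij_enumerate[OF infT] bT])
  have \<phi>h: "\<phi> (h m) = enumerate T m" for m
    using enumerate_in_set[OF infT, of m] by (simp add: h_def T_def f_inv_into_f)
  have "r (h m) \<le> r (h n)" if "m \<le> n" for m n
  proof (rule ccontr)
    assume "\<not> r (h m) \<le> r (h n)"
    then have "\<phi> (h n) < \<phi> (h m)" using bh by (intro less) (auto simp: bij_betw_def)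
    then have "n < m" using enumerate_mono_iff[OF infT] by (simp add: \<phi>h)
    with that show False by simp
  qed
  with bh show thesis by (rule that)
qed

lemma level_enumeration:
  obtains h :: "nat \<Rightarrow> real ^ 'd \<Rightarrow> real" where "bij_betw h UNIV haar_system"
    "\<And>m n. m \<le> n \<Longrightarrow> haar_level (h m) \<le> haar_level (h n)"
proof (rule rank_enumeration[OF infinite_haar_system])
  fix j
  have "{h \<in> haar_system. haar_level h = j} \<subseteq> (haar_block j :: (real ^ 'd \<Rightarrow> real) set)"
    using haar_level_block by auto
  then show "finite {h \<in> haar_system. haar_level (h :: real ^ 'd \<Rightarrow> real) = j}"
    using finite_haar_block finite_subset by blast
qed (use that in blast)

text \<open>If the last function of the segment has level L, all lower levels are complete and no
  higher one has begun, so K = L - 1 works. For L = 0 the choice is K = 0.\<close>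

lemma level_initial_segment:
  fixes h :: "nat \<Rightarrow> real ^ 'd \<Rightarrow> real"
  assumes h: "bij_betw h UNIV haar_system" and mono: "\<And>m n. m \<le> n \<Longrightarrow> haar_level (h m) \<le> haar_level (h n)"
  shows "h ` {..<n} = {} \<or> (\<exists>K. haar_upto K \<subseteq> h ` {..<n} \<and> h ` {..<n} \<subseteq> haar_upto (Suc K))"
proof (cases n)
  case (Suc m)
  have hm: "h i \<in> haar_system" for i using h by (auto simp: bij_betw_def)
  define L where "L = haar_level (h m)"
  have up: "h ` {..<n} \<subseteq> haar_upto L"
    using mono hm Suc by (auto simp: haar_upto_iff L_def)
  have low: "g \<in> h ` {..<n}" if g: "g \<in> haar_system" "haar_level g < L \<or> g = h m" for g
  proof -
    obtain i where i: "g = h i" using h g(1) by (metis bij_betw_imp_surj_on imageE)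
    have "i \<le> m" using g(2)
    proof
      assume "haar_level g < L"
      then show ?thesis using mono[of m i] by (fastforce simp: i L_def not_le[symmetric])
    next
      assume "g = h m"
      then show ?thesis using h by (auto simp: i bij_betw_def inj_eq)
    qed
    then show ?thesis using i Suc by auto
  qed
  show ?thesis
  proof (cases L)
    case 0
    have "haar_upto 0 \<subseteq> h ` {..<n}"
    proof
      fix g :: "real ^ 'd \<Rightarrow> real" assume "g \<in> haar_upto 0"
      moreover have "h m \<in> haar_block 0" using haar_level_block[OF hm[of m]] 0 by (simp add: L_def)
      ultimately have "g = h m" by (auto simp: haar_upto_def)
      then show "g \<in> h ` {..<n}" using Suc by auto
    qed
    moreover have "h ` {..<n} \<subseteq> haar_upto (Suc 0)" using up 0 by (auto simp: haar_upto_iff)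
    ultimately show ?thesis by blast
  next
    case (Suc K)
    then have "haar_upto K \<subseteq> h ` {..<n}" using low by (auto simp: haar_upto_iff)
    then show ?thesis using up Suc by blast
  qed
qed simp

text \<open>The definition compares consecutive blocks only; distant ones are compared through a
  member of each block in between, all of which are nonempty.\<close>

lemma blockwise_ordering_level_mono:
  fixes h :: "nat \<Rightarrow> real ^ 'd \<Rightarrow> real"
  assumes "blockwise_ordering h" "m \<le> n"
  shows "haar_level (h m) \<le> haar_level (h n)"
proof (rule ccontr)
  have h: "bij_betw h UNIV haar_system"
    and next_block: "\<And>k m n. h m \<in> haar_block k \<Longrightarrow> h n \<in> haar_block (Suc k) \<Longrightarrow> m < n"
    using assms(1) by (auto simp: blockwise_ordering_def)
  have hm: "h i \<in> haar_block (haar_level (h i))" for i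
    using h by (intro haar_level_block) (auto simp: bij_betw_def)
  have less: "\<And>i j. h i \<in> haar_block a \<Longrightarrow> h j \<in> haar_block (a + Suc b) \<Longrightarrow> i < j" for a b
  proof (induction b)
    case 0 then show ?case using next_block by simp
  next
    case (Suc b)
    obtain g :: "real ^ 'd \<Rightarrow> real" where g: "g \<in> haar_block (a + Suc b)" using haar_block_nonempty by blast
    then have "g \<in> haar_system" by (auto simp: haar_system_def)
    then obtain l where l: "g = h l" using h by (metis bij_betw_imp_surj_on imageE)
    have "i < l" using Suc.IH[OF Suc.prems(1)] g l by simp
    moreover have "l < j" using next_block[of l "a + Suc b" j] g l Suc.prems(2) by simp
    ultimately show ?case by simp
  qed
  assume "\<not> haar_level (h m) \<le> haar_level (h n)"
  then obtain b where "haar_level (h m) = haar_level (h n) + Suc b"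
    by (metis add_Suc_right less_imp_Suc_add not_le)
  then have "n < m" using less[of n "haar_level (h n)" m b] hm[of n] hm[of m] by simp
  with assms(2) show False by simp
qed

section \<open>The case of small exponents\<close>

definition spike :: "nat \<Rightarrow> real ^ 'd \<Rightarrow> real" where
  "spike n x = 2 ^ (n * CARD('d)) * indicator (cell n 0) x"

lemma cell_zero_mono: "m \<le> n \<Longrightarrow> cell n 0 \<subseteq> cell m 0"
  unfolding cell_def using grid_mono by blast

lemma cell_zero_subset: "cell n (0 :: real ^ 'd) \<subseteq> half_open_cube"
proof
  fix x :: "real ^ 'd" assume "x \<in> cell n 0"
  then have "grid n x = grid n 0" by (simp add: cell_def)
  then show "x \<in> half_open_cube" using grid_half_open_cube[of n x 0] by (simp add: half_open_cube_def)
qed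

lemma spike_nonneg [simp]: "0 \<le> spike n x"
  by (simp add: spike_def)

lemma spike_outside: "x \<notin> cell n 0 \<Longrightarrow> spike n x = 0"
  by (simp add: spike_def)

lemma spike_step: "step n (spike n)"
proof (rule stepI)
  fix x y :: "real ^ 'a" assume "grid n x = grid n y"
  then show "spike n x = spike n y" by (simp add: spike_def cell_def indicator_def)
qed (use cell_zero_subset in \<open>auto intro: spike_outside\<close>)

lemma spike_integrable: "integrable lborel (spike n)"
  by (rule step_integrable[OF spike_step])

lemma spike_off_cube: "x \<notin> half_open_cube \<Longrightarrow> spike n x = 0"
  by (rule step_outside[OF spike_step])

lemma integral_spike: "(\<integral>x. spike n x \<partial>lborel) = 1"
  by (simp add: spike_def measure_def emeasure_cell)

lemma avg_concentrated:
  fixes f :: "real ^ 'd \<Rightarrow> real"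
  assumes "\<And>x. x \<notin> cell k 0 \<Longrightarrow> f x = 0"
  shows "avg k f x = (\<integral>x. f x \<partial>lborel) * spike k x"
proof (cases "x \<in> cell k 0")
  case True
  then have "cell k x = cell k 0" by (simp add: cell_def)
  then have eq: "indicator (cell k x) y * (walsh k {} y * f y) = f y" for y
    using assms[of y] by (auto simp: indicator_def)
  show ?thesis unfolding walsh_coeff_def eq using True by (simp add: spike_def)
next
  case False
  have eq: "indicator (cell k x) y * (walsh k {} y * f y) = 0" for y
  proof (cases "y \<in> cell k 0")
    case True
    then have "y \<notin> cell k x" using False by (auto simp: cell_def)
    then show ?thesis by simp
  qed (simp add: assms)
  show ?thesis unfolding walsh_coeff_def eq using False by (simp add: spike_def)
qed

lemma avg_spike: "avg k (spike n) x = spike (min k n) x"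
proof (cases "n \<le> k")
  case True
  then show ?thesis
    using avg_cellwise[OF step_cellwise[OF step_mono[OF spike_step True]], of x] by (simp add: min_def)
next
  case False
  then have "k \<le> n" by simp
  then have "y \<notin> cell k 0 \<Longrightarrow> spike n y = 0" for y using cell_zero_mono[of k n] spike_outside by blast
  from avg_concentrated[of k "spike n" x, OF this] show ?thesis
    using \<open>k \<le> n\<close> by (simp add: integral_spike min_def)
qed

text \<open>The sign of the exponent separates the cases: geometric decay for p < 1, constant norm 1
  for p = 1.\<close>

lemma lp_norm_spike:
  assumes "0 < p"
  shows "lp_norm lborel p (spike n :: real ^ 'd \<Rightarrow> real) = 2 powr (real (n * CARD('d)) * (1 - 1 / p))"
proof -
  have eq: "\<bar>spike n x\<bar> powr p = (2 ^ (n * CARD('d))) powr p * indicator (cell n 0) x" for x :: "real ^ 'd"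
    using assms by (simp add: spike_def indicator_def)
  have "(\<integral>x. \<bar>spike n (x :: real ^ 'd)\<bar> powr p \<partial>lborel) = (2 ^ (n * CARD('d))) powr p * (1 / 2 ^ (n * CARD('d)))"
    unfolding eq by (simp add: measure_def emeasure_cell)
  also have "\<dots> = 2 powr (real (n * CARD('d)) * p - real (n * CARD('d)))"
    by (simp add: powr_realpow[symmetric] powr_powr powr_diff)
  finally show ?thesis
    using assms unfolding lp_norm_def by (simp add: powr_powr diff_divide_distrib right_diff_distrib)
qed

text \<open>The Haar coefficient of the Dirac mass at the origin, equal to the coefficient of every
  sufficiently fine spike.\<close>

definition spike_coeff :: "(real ^ 'd \<Rightarrow> real) \<Rightarrow> real" where
  "spike_coeff h = core h 0 / (\<integral>x. core h x * core h x \<partial>lborel)"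

lemma haar_coeff_spike:
  fixes h :: "real ^ 'd \<Rightarrow> real"
  assumes "h \<in> haar_upto n"
  shows "haar_coeff (spike n) h = spike_coeff h"
proof -
  obtain k where "h \<in> haar_block k" "k \<le> n" using assms by (auto simp: haar_upto_def)
  then have s: "step n (core h)" using core_step step_mono by blast
  have eq: "spike n x * core h x = core h 0 * spike n x" for x
    using stepD[OF s, of x 0] by (auto simp: spike_def indicator_def cell_def)
  show ?thesis unfolding haar_coeff_def eq by (simp add: spike_coeff_def integral_spike)
qed

lemma spike_partial_sum:
  assumes "A \<subseteq> haar_upto n"
  shows "(\<Sum>h\<in>A. spike_coeff h * core h x) = haar_part A (spike n) x"
  unfolding haar_part_def using assms by (intro sum.cong refl) (simp add: haar_coeff_spike subset_iff)

text \<open>The complete levels give the average of the finer spike, which is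
  \<open>spike n\<close>. The incomplete level adds at most one term of each nonempty type,
  dominated by the same average.\<close>

lemma spike_partial_sum_bound:
  fixes x :: "real ^ 'd"
  assumes A: "haar_upto n \<subseteq> A" "A \<subseteq> haar_upto (Suc n)"
  shows "\<bar>haar_part A (spike (Suc n)) x\<bar> \<le> (1 + card (UNIV - {{} :: 'd set})) * spike n x"
proof -
  let ?T = "\<lambda>e. if selects A n e x then walsh_coeff n e (spike (Suc n)) x * walsh n e x else 0"
  have T: "\<bar>?T e\<bar> \<le> spike n x" for e
  proof -
    have "\<bar>walsh_coeff n e (spike (Suc n)) x\<bar> \<le> avg n (\<lambda>x. \<bar>spike (Suc n) x\<bar>) x"
      by (rule abs_walsh_coeff_le[OF spike_integrable])
    also have "\<dots> = spike n x" by (simp add: avg_spike)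
    finally show ?thesis by (simp add: abs_mult)
  qed
  have "haar_part A (spike (Suc n)) x = spike n x + (\<Sum>e\<in>UNIV - {{}}. ?T e)"
    using haar_part_between[OF spike_off_cube spike_integrable A, of "Suc n" x] by (simp add: avg_spike)
  also have "\<bar>\<dots>\<bar> \<le> \<bar>spike n x\<bar> + (\<Sum>e\<in>UNIV - {{}}. \<bar>?T e\<bar>)"
    by (intro order_trans[OF abs_triangle_ineq] add_left_mono sum_abs)
  also have "\<dots> \<le> \<bar>spike n x\<bar> + (\<Sum>e\<in>UNIV - {{} :: 'd set}. spike n x)"
    using T by (intro add_left_mono sum_mono)
  finally show ?thesis by (simp add: algebra_simps)
qed

lemma zero_in_besov_space:
  assumes "0 < p" "0 < q"
  shows "(\<lambda>_. 0) \<in> (besov_space p q :: (real ^ 'd \<Rightarrow> real) set)" and "besov_norm p q (\<lambda>_ :: real ^ 'd. 0) = 0"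
proof -
  have s: "step 0 (\<lambda>_ :: real ^ 'd. 0)" by (rule stepI) auto
  obtain C where C: "has_besov p q (\<lambda>_ :: real ^ 'd. 0)"
    "besov_norm p q (\<lambda>_ :: real ^ 'd. 0) powr q \<le> C * (real 0 + 1) * lp_norm lborel p (\<lambda>_ :: real ^ 'd. 0) powr q"
    using besov_norm_step[OF assms, where 'd='d] s by blast
  then show "(\<lambda>_. 0) \<in> (besov_space p q :: (real ^ 'd \<Rightarrow> real) set)"
    using represents_besov_space[OF assms(1) represents_refl[OF step_lp_cube[OF s assms(1)]]] by blast
  have "besov_norm p q (\<lambda>_ :: real ^ 'd. 0) powr q \<le> 0" using C(2) assms by simp
  then show "besov_norm p q (\<lambda>_ :: real ^ 'd. 0) = 0"
    by (metis powr_ge_zero order_antisym powr_eq_0_iff)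
qed

text \<open>
  For \<open>p < 1\<close> the Dirac mass at the origin has a Haar expansion whose partial sums tend to \<open>0\<close>,
  so \<open>0\<close> has two expansions.
\<close>

lemma haar_not_schauder_small_p:
  fixes h :: "nat \<Rightarrow> real ^ 'd \<Rightarrow> real"
  assumes p: "0 < p" "p < 1" and q: "0 < q" and h: "bij_betw h UNIV haar_system"
    and mono: "\<And>m n. m \<le> n \<Longrightarrow> haar_level (h m) \<le> haar_level (h n)"
  shows "\<not> schauder_basis (besov_space p q) (besov_quasinorm p q) h"
proof
  assume sb: "schauder_basis (besov_space p q) (besov_quasinorm p q) h"
  have inj: "inj h" and ran: "range h = haar_system" using h by (auto simp: bij_betw_def)
  have hm: "h m \<in> haar_system" for m using ran by auto
  have zero: "represents p (\<lambda>_ :: real ^ 'd. 0) (\<lambda>_. 0)"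
    by (intro represents_refl) (simp add: lp_cube_def p)
  have N: "besov_quasinorm p q (\<lambda>x. 0 - (\<Sum>m<n. c m * h m x)) = besov_norm p q (\<lambda>x. 0 - (\<Sum>m<n. c m * core (h m) x))" for c n
    by (intro represents_besov_quasinorm p represents_diff zero represents_lincomb core_represents hm)
  obtain C where C: "\<And>n g. step n (g :: real ^ 'd \<Rightarrow> real) \<Longrightarrow>
      besov_norm p q g powr q \<le> C * (real n + 1) * lp_norm lborel p g powr q"
    using besov_norm_step[OF p(1) q, where 'd='d] by blast
  define c where "c m = spike_coeff (h m)" for m
  define S where "S n x = 0 - (\<Sum>m<n. c m * core (h m) x)" for n x
  define M where "M = 1 + real (card (UNIV - {{} :: 'd set}))"
  define \<rho> where "\<rho> = 2 powr (CARD('d) * (1 - 1 / p) * q)"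
  \<comment> \<open>The factor K + 2 is the cost in \<open>besov_norm_step\<close> of a step
    function of level \<open>Suc K\<close>, and \<open>\<rho> ^ K\<close> is the q-th power of the
    L_p norm of \<open>spike K\<close>.\<close>
  define B where "B K = \<bar>C\<bar> * M powr q * ((real K + 2) * \<rho> ^ K)" for K
  have \<rho>: "0 < \<rho>" "\<rho> < 1"
  proof -
    have "1 - 1 / p < 0" using p by (simp add: field_simps)
    then have "CARD('d) * (1 - 1 / p) * q < 0" using q by (simp add: mult_less_0_iff)
    then show "0 < \<rho>" "\<rho> < 1" by (auto simp: \<rho>_def powr_less_one)
  qed
  have SA: "S n x = - (\<Sum>g\<in>h ` {..<n}. spike_coeff g * core g x)" for n x
    unfolding S_def c_def by (subst sum.reindex) (auto intro: inj_on_subset[OF inj])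
  have bound: "besov_norm p q (S n) powr q \<le> B K"
    if A: "haar_upto K \<subseteq> h ` {..<n}" "h ` {..<n} \<subseteq> haar_upto (Suc K)" for n K
  proof -
    have S: "S n = (\<lambda>x. - haar_part (h ` {..<n}) (spike (Suc K)) x)"
      unfolding SA[abs_def] spike_partial_sum[OF A(2)] ..
    have st: "step (Suc K) (S n)"
      unfolding S by (rule step_compose[OF haar_part_step[OF A(2)]]) simp
    have "lp_norm lborel p (S n) \<le> lp_norm lborel p (\<lambda>x :: real ^ 'd. M * spike K x)"
    proof (rule lp_norm_mono[OF p(1)])
      show "in_lp lborel p (\<lambda>x :: real ^ 'd. M * spike K x)"
        by (intro in_lp_cmult lp_cube_in_lp[OF step_lp_cube[OF spike_step p(1)]])
      show "AE x in lborel. \<bar>S n x\<bar> \<le> \<bar>M * spike K x\<bar>"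
        using spike_partial_sum_bound[OF A] by (intro AE_I2) (auto simp: S M_def abs_mult)
    qed (use step_measurable[OF st] in simp)
    also have "\<dots> = M * lp_norm lborel p (spike K :: real ^ 'd \<Rightarrow> real)" using p by (simp add: lp_norm_cmult M_def)
    finally have "lp_norm lborel p (S n) powr q \<le> (M * lp_norm lborel p (spike K :: real ^ 'd \<Rightarrow> real)) powr q"
      using q by (intro powr_mono2) auto
    also have "\<dots> = M powr q * \<rho> ^ K"
    proof -
      have "lp_norm lborel p (spike K :: real ^ 'd \<Rightarrow> real) powr q = \<rho> ^ K"
        unfolding lp_norm_spike[OF p(1)] \<rho>_def by (simp add: powr_powr powr_realpow[symmetric] mult_ac)
      then show ?thesis by (simp add: powr_mult M_def)
    qed
    finally have L: "lp_norm lborel p (S n) powr q \<le> M powr q * \<rho> ^ K" .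
    have "besov_norm p q (S n) powr q \<le> C * (real (Suc K) + 1) * lp_norm lborel p (S n) powr q" by (rule C[OF st])
    also have "\<dots> \<le> \<bar>C\<bar> * (real (Suc K) + 1) * (M powr q * \<rho> ^ K)"
      using L by (intro mult_mono) auto
    also have "\<dots> = B K" by (simp add: B_def)
    finally show ?thesis .
  qed
  have "(\<lambda>K. real K * \<rho> ^ K) \<longlonglongrightarrow> 0" using \<rho> by (intro powser_times_n_limit_0) auto
  moreover have "(\<lambda>K. \<rho> ^ K) \<longlonglongrightarrow> 0" using \<rho> by (intro LIMSEQ_power_zero) auto
  ultimately have "(\<lambda>K. \<bar>C\<bar> * M powr q * (real K * \<rho> ^ K + 2 * \<rho> ^ K)) \<longlonglongrightarrow> \<bar>C\<bar> * M powr q * (0 + 2 * 0)"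
    by (intro tendsto_mult tendsto_add tendsto_const)
  then have B0: "B \<longlonglongrightarrow> 0" unfolding B_def[abs_def] by (simp add: distrib_right)
  have "(\<lambda>n. besov_norm p q (S n) powr q) \<longlonglongrightarrow> 0"
  proof (rule LIMSEQ_I)
    fix r :: real assume "0 < r"
    then obtain K0 where K0: "\<forall>K\<ge>K0. norm (B K - 0) < r" using LIMSEQ_D[OF B0] by blast
    obtain N where N: "\<forall>n\<ge>N. haar_upto (Suc K0) \<subseteq> h ` {..<n}"
      using enumeration_covers[OF finite_haar_upto, of "Suc K0" h] haar_upto_subset ran by metis
    have "norm (besov_norm p q (S n) powr q - 0) < r" if "N \<le> n" for n
    proof -
      have cov: "haar_upto (Suc K0) \<subseteq> h ` {..<n}" using N that by blast
      have "haar_upto (Suc K0) \<noteq> ({} :: (real ^ 'd \<Rightarrow> real) set)"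
        using haar_block_nonempty by (fastforce simp: haar_upto_def)
      with cov level_initial_segment[OF h mono, of n] obtain K where
        K: "haar_upto K \<subseteq> h ` {..<n}" "h ` {..<n} \<subseteq> haar_upto (Suc K)" by blast
      have "Suc K0 \<le> Suc K" using haar_upto_le[OF order_trans[OF cov K(2)]] .
      then have "norm (B K - 0) < r" using K0 by simp
      then show ?thesis using bound[OF K] by simp
    qed
    then show "\<exists>N. \<forall>n\<ge>N. norm (besov_norm p q (S n) powr q - 0) < r" by blast
  qed
  then have "(\<lambda>n. besov_norm p q (S n)) \<longlonglongrightarrow> 0" by (rule tendsto_besov_norm[OF q])
  define represents_zero where "represents_zero c \<longleftrightarrow>
    (\<lambda>n. besov_quasinorm p q (\<lambda>x. 0 - (\<Sum>m<n. c m * h m x))) \<longlonglongrightarrow> 0" for c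
  from \<open>(\<lambda>n. besov_norm p q (S n)) \<longlonglongrightarrow> 0\<close> have 1: "represents_zero c"
    unfolding represents_zero_def N S_def[abs_def] .
  have 2: "represents_zero (\<lambda>_. 0)"
    unfolding represents_zero_def N using zero_in_besov_space(2)[OF p(1) q, where 'd='d] by simp
  have "\<exists>!c. represents_zero c"
    unfolding represents_zero_def
    by (rule bspec[OF conjunct2[OF sb[unfolded schauder_basis_def]] zero_in_besov_space(1)[OF p(1) q]])
  with 1 2 have c0: "c = (\<lambda>_. 0)" by blast
  \<comment> \<open>The constant function detects that this expansion of 0 is nontrivial: it is 1 at
    the origin, so its coefficient does not vanish.\<close>
  have "(indicator unit_cube :: real ^ 'd \<Rightarrow> real) \<in> haar_block 0" by simp
  then have one: "(indicator unit_cube :: real ^ 'd \<Rightarrow> real) \<in> haar_system" unfolding haar_system_def by blast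
  then obtain m where m: "indicator unit_cube = h m" using ran by (metis rangeE)
  have "core (h m) 0 = 1"
    using half_open_cube_subset unfolding m[symmetric] core_def
    by (auto simp: indicator_def half_open_cube_def unit_cube_def mem_box_cart)
  then have "c m \<noteq> 0" using core_square_pos[OF hm[of m]] by (simp add: c_def spike_coeff_def)
  with c0 show False by simp
qed

section \<open>Conditionality in the limiting case\<close>

lemma lp_norm_1: "lp_norm M 1 f = (\<integral>x. \<bar>f x\<bar> \<partial>M)"
  by (simp add: lp_norm_def)

lemma lp_cube_1I:
  "integrable lborel f \<Longrightarrow> (\<And>x. x \<notin> half_open_cube \<Longrightarrow> f x = 0) \<Longrightarrow> lp_cube 1 f"
  by (auto simp: lp_cube_def in_lp_def)

lemma spike_eventually_zero:
  fixes x :: "real ^ 'd"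
  assumes "x \<noteq> 0"
  shows "\<exists>N. \<forall>n\<ge>N. spike n x = 0"
proof -
  obtain l where l: "x $ l \<noteq> 0" using assms by (auto simp: vec_eq_iff)
  obtain N where N: "(1 / 2) ^ N < \<bar>x $ l\<bar>" using real_arch_pow_inv[of "\<bar>x $ l\<bar>" "1 / 2"] l by auto
  have "spike n x = 0" if "N \<le> n" for n
  proof (rule spike_outside, rule notI)
    assume "x \<in> cell n 0"
    then have "\<lfloor>2 ^ n * x $ l\<rfloor> = 0" by (auto simp: cell_def grid_def fun_eq_iff)
    then have t: "0 \<le> 2 ^ n * x $ l" "2 ^ n * x $ l < 1" by linarith+
    then have "0 \<le> x $ l" "x $ l < 1 / 2 ^ n"
      using mult_le_cancel_left_pos[of "2 ^ n" 0 "x $ l"] by (auto simp: field_simps)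
    moreover have "1 / (2::real) ^ n \<le> 1 / 2 ^ N" using that by (intro divide_left_mono power_increasing) auto
    ultimately show False using N by (simp add: power_one_over)
  qed
  then show ?thesis by blast
qed

text \<open>The type token carries the dimension, which cannot be read off from the sequence
  b.\<close>

locale spike_series =
  fixes b :: "nat \<Rightarrow> real" and dimension :: "'d::finite itself"
  assumes b_mono: "\<And>n. b (Suc n) \<le> b n" and b_lim: "b \<longlonglongrightarrow> 0"
begin

definition w :: "nat \<Rightarrow> real" where "w n = b n - b (Suc n)"

text \<open>The weights are differences of b so that the mass from level j on telescopes to
  \<open>b j\<close>; the increments of the averages of f then become \<open>b n\<close> times a
  difference of spikes. At the origin the series may diverge, which concerns a null set
  only.\<close>

definition f :: "real ^ 'd \<Rightarrow> real" where "f x = (\<Sum>n. w n * spike (Suc n) x)"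

definition head :: "nat \<Rightarrow> real ^ 'd \<Rightarrow> real" where "head j x = (\<Sum>n<j. w n * spike (Suc n) x)"

lemma w_nonneg: "0 \<le> w n"
  using b_mono by (simp add: w_def)

lemma w_sums: "w sums b 0"
  using telescope_sums'[OF b_lim] by (simp add: w_def[abs_def])

lemma b_nonneg: "0 \<le> b n"
  by (rule decseq_ge[OF _ b_lim]) (simp add: decseq_Suc_iff b_mono)

lemma f_summable: "x \<noteq> 0 \<Longrightarrow> summable (\<lambda>n. w n * spike (Suc n) x)"
proof -
  assume "x \<noteq> 0"
  then obtain N where "\<forall>n\<ge>N. spike n x = 0" using spike_eventually_zero by blast
  then show ?thesis by (intro summable_finite[of "{..<N}"]) auto
qed

lemma AE_nonzero: "AE x in lborel. x \<noteq> (0 :: real ^ 'd)"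
  by (rule AE_lborel_singleton)

lemma f_integral: "integrable lborel f" "(\<integral>x. f x \<partial>lborel) = b 0"
proof -
  have i: "integrable lborel (\<lambda>x :: real ^ 'd. w n * spike (Suc n) x)" for n
    by (intro integrable_mult_right spike_integrable)
  have nm: "norm (w n * spike (Suc n) x) = w n * spike (Suc n) x" for n and x :: "real ^ 'd"
    using w_nonneg by simp
  have s1: "AE x in lborel. summable (\<lambda>n. norm (w n * spike (Suc n) (x :: real ^ 'd)))"
    unfolding nm using AE_nonzero by eventually_elim (rule f_summable)
  have s2: "summable (\<lambda>n. \<integral>x. norm (w n * spike (Suc n) (x :: real ^ 'd)) \<partial>lborel)"
    unfolding nm using w_sums by (simp add: integral_spike sums_iff)
  show "integrable lborel f" unfolding f_def[abs_def] by (rule integrable_suminf[OF i s1 s2])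
  have "(\<integral>x. f x \<partial>lborel) = (\<Sum>n. \<integral>x. w n * spike (Suc n) (x :: real ^ 'd) \<partial>lborel)"
    unfolding f_def[abs_def] by (rule integral_suminf[OF i s1 s2])
  also have "\<dots> = b 0" using w_sums by (simp add: integral_spike sums_iff)
  finally show "(\<integral>x. f x \<partial>lborel) = b 0" .
qed

lemma f_outside: "x \<notin> half_open_cube \<Longrightarrow> f x = 0"
  by (simp add: f_def spike_off_cube)

lemma f_lp_cube: "lp_cube 1 f"
  by (rule lp_cube_1I[OF f_integral(1) f_outside])

lemma head_step: "step j (head j)"
  unfolding head_def[abs_def]
proof (rule step_sum)
  fix n assume "n \<in> {..<j}"
  then have "step j (spike (Suc n) :: real ^ 'd \<Rightarrow> real)" by (intro step_mono[OF spike_step]) simp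
  then show "step j (\<lambda>x :: real ^ 'd. w n * spike (Suc n) x)" by (rule step_compose) simp
qed

definition tail :: "nat \<Rightarrow> real ^ 'd \<Rightarrow> real" where "tail j x = f x - head j x"

lemma tail_integrable: "integrable lborel (tail j)"
  unfolding tail_def[abs_def] by (intro Bochner_Integration.integrable_diff f_integral step_integrable[OF head_step])

lemma tail_integral: "(\<integral>x. tail j x \<partial>lborel) = b j"
proof -
  have "(\<integral>x. head j x \<partial>lborel) = (\<Sum>n<j. w n)"
    unfolding head_def[abs_def]
    by (subst Bochner_Integration.integral_sum) (auto simp: integral_spike spike_integrable)
  also have "\<dots> = b 0 - b j" unfolding w_def by (rule sum_lessThan_telescope')
  finally show ?thesis
    unfolding tail_def[abs_def] using f_integral step_integrable[OF head_step] by simp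
qed

lemma tail_nonneg: "AE x in lborel. 0 \<le> tail j x"
  using AE_nonzero
proof eventually_elim
  case (elim x)
  have "head j x \<le> f x"
    unfolding head_def f_def by (rule sum_le_suminf[OF f_summable[OF elim]]) (auto simp: w_nonneg)
  then show ?case by (simp add: tail_def)
qed

lemma tail_outside: "x \<notin> cell j 0 \<Longrightarrow> tail j x = 0"
proof -
  assume x: "x \<notin> cell j 0"
  have z: "spike n x = 0" if "j \<le> n" for n using x cell_zero_mono[OF that] by (auto intro: spike_outside)
  have "f x = (\<Sum>n<j. w n * spike (Suc n) x)"
    unfolding f_def by (rule suminf_finite) (auto simp: z)
  then show ?thesis by (simp add: tail_def head_def)
qed

lemma tail_lp_cube: "lp_cube 1 (tail j)"
  using tail_outside cell_zero_subset by (intro lp_cube_1I tail_integrable) blast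

text \<open>The tail sits in one cell of level j, so that averaging retains nothing of it except its
  mass \<open>b j\<close>.\<close>

lemma avg_f: "avg j f x = head j x + b j * spike j x"
proof -
  have "avg j f x = avg j (\<lambda>y. head j y + tail j y) x" by (simp add: tail_def)
  also have "\<dots> = head j x + avg j (tail j) x"
    using avg_cellwise[OF step_cellwise[OF head_step]]
    by (subst walsh_coeff_add[OF step_integrable[OF head_step] tail_integrable]) auto
  also have "avg j (tail j) x = b j * spike j x"
    by (subst avg_concentrated[OF tail_outside]) (simp_all add: tail_integral)
  finally show ?thesis .
qed

lemma approx_err_f: "approx_err 1 f j \<le> 2 * b j"
proof -
  have "approx_err 1 f j = lp_norm lborel 1 (\<lambda>x. tail j x - b j * spike j x)"
    unfolding approx_err_def avg_f by (simp add: tail_def algebra_simps)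
  also have "\<dots> \<le> lp_norm lborel 1 (tail j) + lp_norm lborel 1 (\<lambda>x :: real ^ 'd. b j * spike j x)"
    by (intro lp_norm_triangle_diff lp_cube_in_lp tail_lp_cube lp_cube_cmult step_lp_cube[OF spike_step]) auto
  also have "lp_norm lborel 1 (tail j) = b j"
  proof -
    have "(\<integral>x. \<bar>tail j x\<bar> \<partial>lborel) = (\<integral>x. tail j x \<partial>lborel)"
    proof (rule integral_cong_AE)
      show "AE x in lborel. \<bar>tail j x\<bar> = tail j x"
        using tail_nonneg[of j] by eventually_elim simp
    qed (use tail_integrable[of j] in auto)
    then show ?thesis by (simp add: lp_norm_1 tail_integral)
  qed
  also have "lp_norm lborel 1 (\<lambda>x :: real ^ 'd. b j * spike j x) = b j"
    using b_nonneg by (simp add: lp_norm_1 abs_mult integral_spike)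
  finally show ?thesis by simp
qed

lemma avg_diff_f: "avg (Suc n) f x - avg n f x = b n * (spike (Suc n) x - spike n x)"
  unfolding avg_f head_def by (simp add: w_def algebra_simps)

end

text \<open>The ring between two consecutive cells at the origin belongs to index m if its outer
  cell has level m + 1. On it the m-th difference is positive, the earlier ones are nonnegative, and
  the later ones vanish since m + 1 is not in P. The height times the volume of the ring is (1 - 1 /
  2^d)^2, at least 1/4, and the rings are disjoint.\<close>

lemma spike_diff_lower:
  fixes b :: "nat \<Rightarrow> real"
  assumes P: "finite P" "\<And>m. m \<in> P \<Longrightarrow> even m" and b: "\<And>n. 0 \<le> b n"
  shows "(\<Sum>m\<in>P. b m) / 4 \<le> (\<integral>x. \<bar>\<Sum>n\<in>P. b n * (spike (Suc n) x - spike n (x :: real ^ 'd))\<bar> \<partial>lborel)"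
proof -
  let ?D = "2 ^ CARD('d) :: real"
  define ring where "ring m x = indicator (cell (Suc m) 0) x - (indicator (cell (Suc (Suc m)) 0) x :: real)" for m and x :: "real ^ 'd"
  define r where "r m = ?D ^ Suc m - ?D ^ m" for m
  have D2: "2 \<le> ?D" by (simp add: self_le_power)
  have r0: "0 \<le> r m" for m using D2 by (simp add: r_def)
  have pw: "2 ^ (n * CARD('d)) = ?D ^ n" for n by (simp add: power_mult mult.commute flip: power_mult)
  have sp: "spike n x = ?D ^ n * indicator (cell n 0) x" for n and x :: "real ^ 'd"
    unfolding spike_def pw ..
  have mc: "measure lborel (cell n (0 :: real ^ 'd)) = 1 / ?D ^ n" for n
    unfolding pw[symmetric] by (simp add: measure_def emeasure_cell)
  have iring: "integrable lborel (ring m)" for m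
    unfolding ring_def[abs_def] by (intro Bochner_Integration.integrable_diff integrable_indicator_cell)
  have int_ring: "(\<integral>x. ring m x \<partial>lborel) = 1 / ?D ^ Suc m - 1 / ?D ^ Suc (Suc m)" for m
    unfolding ring_def[abs_def]
    by (subst Bochner_Integration.integral_diff[OF integrable_indicator_cell integrable_indicator_cell])
       (simp add: mc del: power_Suc)
  have quarter: "1 / 4 \<le> r m * (1 / ?D ^ Suc m - 1 / ?D ^ Suc (Suc m))" for m
  proof -
    have "r m * (1 / ?D ^ Suc m - 1 / ?D ^ Suc (Suc m)) = (1 - 1 / ?D) * (1 - 1 / ?D)"
      unfolding r_def by (simp add: field_simps)
    moreover have "1 / 2 \<le> 1 - 1 / ?D" using D2 by (simp add: field_simps)
    ultimately show ?thesis using mult_mono[of "1 / 2" "1 - 1 / ?D" "1 / 2" "1 - 1 / ?D"] by simp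
  qed
  define G where "G x = (\<Sum>n\<in>P. b n * (spike (Suc n) x - spike n x))" for x :: "real ^ 'd"
  have pt: "(\<Sum>m\<in>P. b m * r m * ring m x) \<le> \<bar>G x\<bar>" for x
  proof (cases "\<exists>m\<in>P. ring m x \<noteq> 0")
    case False
    then have "(\<Sum>m\<in>P. b m * r m * ring m x) = 0" by (intro sum.neutral) auto
    then show ?thesis by simp
  next
    case True
    then obtain k where k: "k \<in> P" "ring k x \<noteq> 0" by blast
    have sub: "cell (Suc (Suc k)) (0 :: real ^ 'd) \<subseteq> cell (Suc k) 0" by (rule cell_zero_mono) simp
    then have x: "x \<in> cell (Suc k) 0" "x \<notin> cell (Suc (Suc k)) 0" "ring k x = 1"
      using k(2) by (cases "x \<in> cell (Suc k) 0"; cases "x \<in> cell (Suc (Suc k)) 0"; auto simp: ring_def)+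
    have inn: "x \<in> cell n 0 \<longleftrightarrow> n \<le> Suc k" for n
    proof
      assume "x \<in> cell n 0"
      then show "n \<le> Suc k" using x(2) cell_zero_mono[of "Suc (Suc k)" n] by (meson not_less_eq_eq subsetD)
    next
      assume "n \<le> Suc k"
      then show "x \<in> cell n 0" using x(1) cell_zero_mono by blast
    qed
    \<comment> \<open>Parity excludes n = \<open>Suc k\<close>, the only index whose difference is
      negative on this ring.\<close>
    have sd: "spike (Suc n) x - spike n x = (if n \<le> k then r n else 0)" if "n \<in> P" for n
    proof -
      have "n \<noteq> Suc k" using P(2)[OF that] P(2)[OF k(1)] by auto
      then show ?thesis by (auto simp: sp indicator_def inn r_def simp del: power_Suc)
    qed
    have "(\<Sum>m\<in>P. b m * r m * ring m x) = (\<Sum>m\<in>{k}. b m * r m * ring m x)"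
      using P(1) k(1) by (intro sum.mono_neutral_right) (auto simp: ring_def indicator_def inn)
    also have "\<dots> = b k * (spike (Suc k) x - spike k x)" using x(3) sd[OF k(1)] by simp
    also have "\<dots> \<le> G x"
      unfolding G_def using P(1) k(1) b r0 sd by (intro member_le_sum) auto
    finally show ?thesis by simp
  qed
  have "(\<Sum>m\<in>P. b m) / 4 = (\<Sum>m\<in>P. b m * (1 / 4))" by (simp add: sum_divide_distrib)
  also have "\<dots> \<le> (\<Sum>m\<in>P. b m * (r m * (1 / ?D ^ Suc m - 1 / ?D ^ Suc (Suc m))))"
    using quarter b by (intro sum_mono mult_left_mono) auto
  also have "\<dots> = (\<integral>x. (\<Sum>m\<in>P. b m * r m * ring m x) \<partial>lborel)"
    using iring by (subst Bochner_Integration.integral_sum) (auto simp: int_ring mult.assoc)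
  also have "\<dots> \<le> (\<integral>x. \<bar>G x\<bar> \<partial>lborel)"
    using pt iring spike_integrable unfolding G_def[abs_def]
    by (intro integral_mono integrable_abs Bochner_Integration.integrable_sum integrable_mult_right Bochner_Integration.integrable_diff) auto
  finally show ?thesis by (simp add: G_def)
qed

section \<open>An ordering that reaches the even levels first\<close>

definition dyadic_size :: "nat \<Rightarrow> nat" where
  "dyadic_size n = (LEAST k. n < 2 ^ k)"

lemma dyadic_size_le_iff: "dyadic_size n \<le> k \<longleftrightarrow> n < 2 ^ k"
proof
  have ex: "n < 2 ^ n" by simp
  assume "dyadic_size n \<le> k"
  then have "(2::nat) ^ dyadic_size n \<le> 2 ^ k" by (intro power_increasing) auto
  moreover have "n < 2 ^ dyadic_size n" unfolding dyadic_size_def using ex by (rule LeastI)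
  ultimately show "n < 2 ^ k" by (rule order.strict_trans2[rotated])
qed (simp add: dyadic_size_def Least_le)

text \<open>
  The levels \<open>Suc n\<close> with \<open>2 ^ k \<le> n < 2 ^ Suc k\<close> are enumerated with the even \<open>n\<close> first.
\<close>

definition even_first_rank :: "(real ^ 'd \<Rightarrow> real) \<Rightarrow> nat" where
  "even_first_rank h = (case haar_level h of 0 \<Rightarrow> 0
     | Suc n \<Rightarrow> 2 * dyadic_size n + (if even n then 1 else 2))"

lemma even_first_rank_finite: "finite {h \<in> haar_system. even_first_rank (h :: real ^ 'd \<Rightarrow> real) < v}"
proof (rule finite_subset[OF _ finite_haar_upto])
  show "{h \<in> haar_system. even_first_rank (h :: real ^ 'd \<Rightarrow> real) < v} \<subseteq> haar_upto (2 ^ v)"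
  proof clarify
    fix h :: "real ^ 'd \<Rightarrow> real" assume h: "h \<in> haar_system" "even_first_rank h < v"
    have "haar_level h \<le> 2 ^ v"
    proof (cases "haar_level h")
      case (Suc n)
      then have "dyadic_size n \<le> v" using h(2) by (simp add: even_first_rank_def)
      then show ?thesis using Suc by (simp add: dyadic_size_le_iff Suc_le_eq)
    qed simp
    then show "h \<in> haar_upto (2 ^ v)" using h(1) by (simp add: haar_upto_iff)
  qed
qed

lemma mono_rank_initial_segment:
  fixes r :: "'a \<Rightarrow> nat"
  assumes h: "bij_betw h (UNIV :: nat set) H" and mono: "\<And>m n. m \<le> n \<Longrightarrow> r (h m) \<le> r (h n)"
    and inf: "infinite H" and fin: "finite {g \<in> H. r g < v}"
  obtains N where "h ` {..<N} = {g \<in> H. r g < v}"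
proof -
  have ran: "range h = H" using h by (auto simp: bij_betw_def)
  have "\<exists>m. \<not> r (h m) < v"
  proof (rule ccontr)
    assume "\<not> ?thesis"
    then have "H \<subseteq> {g \<in> H. r g < v}" using ran by auto
    with fin inf show False using finite_subset by blast
  qed
  then have L: "\<not> r (h (LEAST m. \<not> r (h m) < v)) < v" by (rule LeastI_ex)
  define N where "N = (LEAST m. \<not> r (h m) < v)"
  have lt: "r (h m) < v \<longleftrightarrow> m < N" for m
    using L mono[of N m] not_less_Least[of m "\<lambda>m. \<not> r (h m) < v"] unfolding N_def[symmetric]
    by (metis le_less_trans not_le)
  show thesis
  proof (rule that)
    show "h ` {..<N} = {g \<in> H. r g < v}" using ran lt by auto
  qed
qed

lemma haar_part_blocks:
  fixes f :: "real ^ 'd \<Rightarrow> real"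
  assumes f: "\<And>x. x \<notin> half_open_cube \<Longrightarrow> f x = 0" "integrable lborel f" and "finite P"
  shows "haar_part (\<Union>n\<in>P. haar_block (Suc n)) f x = (\<Sum>n\<in>P. avg (Suc n) f x - avg n f x)"
proof -
  have "haar_part (\<Union>n\<in>P. haar_block (Suc n)) f x = (\<Sum>n\<in>P. haar_part (haar_block (Suc n)) f x)"
    unfolding haar_part_def
  proof (rule sum.UNION_disjoint[OF assms(3)])
    show "\<forall>i\<in>P. \<forall>j\<in>P. i \<noteq> j \<longrightarrow> haar_block (Suc i) \<inter> haar_block (Suc j) = ({} :: (real ^ 'd \<Rightarrow> real) set)"
      using haar_block_disjoint by fastforce
  qed (simp add: finite_haar_block)
  also have "\<dots> = (\<Sum>n\<in>P. avg (Suc n) f x - avg n f x)"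
  proof (rule sum.cong[OF refl])
    fix n
    have "haar_upto (Suc n) = haar_upto n \<union> (haar_block (Suc n) :: (real ^ 'd \<Rightarrow> real) set)"
      by (auto simp: haar_upto_def atMost_Suc)
    moreover have "haar_upto n \<inter> (haar_block (Suc n) :: (real ^ 'd \<Rightarrow> real) set) = {}"
      using haar_block_disjoint by (fastforce simp: haar_upto_def)
    ultimately have "haar_part (haar_upto (Suc n)) f x = haar_part (haar_upto n) f x + haar_part (haar_block (Suc n)) f x"
      by (simp add: haar_part_Un finite_haar_upto finite_haar_block)
    then show "haar_part (haar_block (Suc n)) f x = avg (Suc n) f x - avg n f x"
      using haar_part_upto[of f "Suc n" x] haar_part_upto[of f n x] f by simp
  qed
  finally show ?thesis .
qed

lemma avg_spike_diff:
  "avg j (\<lambda>x. spike (Suc n) x - spike n x) x = (if n < j then spike (Suc n) x - spike n x else 0)"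
  by (subst walsh_coeff_diff[OF spike_integrable spike_integrable], cases "n < j")
     (simp_all add: avg_spike min_absorb1 min_absorb2)

text \<open>The even numbers 2 i with 3 s \<le> i < 4 s lie in the range and above 6 s, hence above
  j; there are s of them, each contributing at least \<open>b (8 * s)\<close>.\<close>

lemma sum_even_lower:
  fixes b :: "nat \<Rightarrow> real"
  assumes b: "\<And>m n. m \<le> n \<Longrightarrow> b n \<le> b m" "\<And>n. 0 \<le> b n" and j: "j \<le> 6 * s"
  shows "real s * b (8 * s) \<le> (\<Sum>m\<in>{n. even n \<and> 4 * s \<le> n \<and> n < 8 * s \<and> j \<le> n}. b m)"
proof -
  have "real s * b (8 * s) = (\<Sum>i\<in>{3 * s..<4 * s}. b (8 * s))" by simp
  also have "\<dots> \<le> (\<Sum>i\<in>{3 * s..<4 * s}. b (2 * i))" using b(1) by (intro sum_mono) auto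
  also have "\<dots> = (\<Sum>m\<in>(\<lambda>i. 2 * i) ` {3 * s..<4 * s}. b m)" by (subst sum.reindex) (auto simp: inj_on_def)
  also have "\<dots> \<le> (\<Sum>m\<in>{n. even n \<and> 4 * s \<le> n \<and> n < 8 * s \<and> j \<le> n}. b m)"
    using b(2) j by (intro sum_mono2) auto
  finally show ?thesis .
qed

text \<open>A Cauchy argument: two residuals far out in the expansion are both small, but they
  differ by the even increments of a dyadic range of levels, whose errors at s different scales are
  at least s b(8 s) / 4.\<close>

lemma haar_divergent_ordering_p1:
  assumes q: "0 < q"
  obtains h :: "nat \<Rightarrow> real ^ 'd \<Rightarrow> real" where "bij_betw h UNIV haar_system"
    "\<not> schauder_basis (besov_space 1 q) (besov_quasinorm 1 q) h"
proof -
  have fin: "finite {h \<in> haar_system. even_first_rank (h :: real ^ 'd \<Rightarrow> real) = v}" for v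
    by (rule finite_subset[OF _ even_first_rank_finite[of "Suc v"]]) auto
  obtain h :: "nat \<Rightarrow> real ^ 'd \<Rightarrow> real" where h: "bij_betw h UNIV haar_system"
    and mono: "\<And>m n. m \<le> n \<Longrightarrow> even_first_rank (h m) \<le> even_first_rank (h n)"
    by (rule rank_enumeration[where r=even_first_rank, OF infinite_haar_system fin]) (rule that)
  have inj: "inj h" and ran: "range h = haar_system" using h by (auto simp: bij_betw_def)
  have hm: "h m \<in> haar_system" for m using ran by auto
  \<comment> \<open>Membership of f needs \<beta> q > 1, divergence needs 1 + (1 - \<beta>) q \<ge>
    0. Here \<beta> q is 1 + q / 2, and the second quantity is q / 2.\<close>
  define \<beta> where "\<beta> = 1 / q + 1 / 2"
  define b where "b n = (real n + 1) powr (- \<beta>)" for n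
  have \<beta>: "0 < \<beta>" using q by (simp add: \<beta>_def add_pos_pos)
  have b_anti: "b n \<le> b m" if "m \<le> n" for m n
    unfolding b_def using that \<beta> by (intro powr_mono2') auto
  have b_pos: "0 < b n" for n by (simp add: b_def)
  have "filterlim (\<lambda>n. real n + 1) at_top sequentially"
    using filterlim_compose[OF filterlim_real_sequentially filterlim_Suc] by (simp add: add.commute)
  then have b_lim: "b \<longlonglongrightarrow> 0"
    unfolding b_def[abs_def] using \<beta> by (intro tendsto_neg_powr) auto
  interpret spike_series b "TYPE('d)"
    by unfold_locales (auto intro: b_anti b_lim)
  let ?E = "approx_err 1 :: (real ^ 'd \<Rightarrow> real) \<Rightarrow> nat \<Rightarrow> real"
  have sumE: "summable (\<lambda>j. ?E f j powr q)"
  proof (rule summable_comparison_test')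
    have "summable (\<lambda>n. real (Suc n) powr (- \<beta> * q))"
      using q by (subst summable_Suc_iff, subst summable_real_powr_iff) (simp add: \<beta>_def field_simps)
    then show "summable (\<lambda>n. 2 powr q * real (Suc n) powr (- \<beta> * q))" by (rule summable_mult)
    fix j
    have "?E f j powr q \<le> (2 * b j) powr q" using approx_err_f q by (intro powr_mono2) auto
    then show "norm (?E f j powr q) \<le> 2 powr q * real (Suc j) powr (- \<beta> * q)"
      by (simp add: b_def powr_mult powr_powr add.commute)
  qed
  have up: "has_besov 1 q g" if "lp_cube 1 g" "summable (\<lambda>j. ?E g j powr q)" for g :: "real ^ 'd \<Rightarrow> real"
    using besov_upper[OF order_refl q, where 'd='d] that by blast
  obtain Cl where "\<forall>g :: real ^ 'd \<Rightarrow> real. lp_cube 1 g \<longrightarrow> has_besov 1 q g \<longrightarrow>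
      summable (\<lambda>j. ?E g j powr q) \<and> (\<Sum>j. ?E g j powr q) \<le> Cl * besov_norm 1 q g powr q"
    using besov_lower[OF order_refl q, where 'd='d] by (elim exE)
  then have Cl: "(\<Sum>j. ?E g j powr q) \<le> Cl * besov_norm 1 q g powr q" "summable (\<lambda>j. ?E g j powr q)"
    if "lp_cube 1 g" "has_besov 1 q g" for g :: "real ^ 'd \<Rightarrow> real"
    using that by simp_all
  have fB: "f \<in> besov_space 1 q"
    using represents_besov_space[OF zero_less_one represents_refl[OF f_lp_cube]] up[OF f_lp_cube sumE] by blast
  define R where "R n x = f x - haar_part (h ` {..<n}) f x" for n x
  have A: "finite (h ` {..<n})" "h ` {..<n} \<subseteq> haar_system" for n using hm by auto
  have R_lp: "lp_cube 1 (R n)" for n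
    unfolding R_def by (intro lp_cube_diff f_lp_cube haar_part_lp_cube A) auto
  have R_besov: "has_besov 1 q (R n)" for n
  proof (rule up[OF R_lp])
    \<comment> \<open>From the highest level in the partial sum onwards, averaging leaves that sum
      unchanged, so the errors of the residual are those of f.\<close>
    obtain L where L: "h ` {..<n} \<subseteq> haar_upto L" using finite_haar_subset[OF A] .
    have "?E (R n) j = ?E f j" if "L \<le> j" for j
    proof -
      have "haar_upto L \<subseteq> (haar_upto j :: (real ^ 'd \<Rightarrow> real) set)" using that by (auto simp: haar_upto_iff)
      then have sub: "h ` {..<n} \<inter> haar_upto j = h ` {..<n}" using L by auto
      have "avg j (R n) x = avg j f x - haar_part (h ` {..<n}) f x" for x
        unfolding R_def using avg_haar_part[OF A, of j n f x]
        by (subst walsh_coeff_diff[OF f_integral(1) lp_cube_integrable[OF order_refl haar_part_lp_cube[OF zero_less_one A]]])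
           (simp add: sub)
      then show ?thesis unfolding approx_err_def by (simp add: R_def)
    qed
    then have "\<forall>\<^sub>F j in sequentially. ?E (R n) j powr q = ?E f j powr q"
      by (intro eventually_sequentiallyI[of L]) simp
    from summable_cong[OF this] sumE show "summable (\<lambda>j. ?E (R n) j powr q)" by simp
  qed
  \<comment> \<open>The 9 comes from 8 s + 1 \<le> 9 s inside b, the 4 from
    \<open>spike_diff_lower\<close>.\<close>
  define c0 where "c0 = (9 powr (- \<beta>) / 4) powr q"
  have c0: "0 < c0" by (simp add: c0_def)
  have "\<not> schauder_basis (besov_space 1 q) (besov_quasinorm 1 q) h"
  proof
    assume "schauder_basis (besov_space 1 q) (besov_quasinorm 1 q) h"
    then obtain c where c: "(\<lambda>n. besov_quasinorm 1 q (\<lambda>x. f x - (\<Sum>m<n. c m * h m x))) \<longlonglongrightarrow> 0"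
      using fB unfolding schauder_basis_def by blast
    have "besov_quasinorm 1 q (\<lambda>x. f x - (\<Sum>m<n. c m * h m x)) = besov_norm 1 q (\<lambda>x. f x - (\<Sum>m<n. c m * core (h m) x))" for n
      by (intro represents_besov_quasinorm represents_diff represents_lincomb core_represents hm represents_refl f_lp_cube) auto
    with c have c': "(\<lambda>n. besov_norm 1 q (\<lambda>x. f x - (\<Sum>m<n. c m * core (h m) x))) \<longlonglongrightarrow> 0" by simp
    have "c j = haar_coeff f (h j)" for j
      using haar_expansion_unique[OF order_refl q f_lp_cube inj _ c'] ran by simp
    then have "(\<Sum>m<n. c m * core (h m) x) = haar_part (h ` {..<n}) f x" for n x
      by (simp add: haar_part_index[OF inj])
    with c' have lim: "(\<lambda>n. besov_norm 1 q (R n)) \<longlonglongrightarrow> 0" by (simp add: R_def[abs_def])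
    have "(\<lambda>n. 2 powr q * (2 * (\<bar>Cl\<bar> * besov_norm 1 q (R n) powr q))) \<longlonglongrightarrow> 2 powr q * (2 * (\<bar>Cl\<bar> * 0 powr q))"
      using q by (intro tendsto_mult tendsto_const tendsto_powr'[OF lim tendsto_const]) (auto simp: besov_norm_nonneg)
    then have "(\<lambda>n. 2 powr q * (2 * (\<bar>Cl\<bar> * besov_norm 1 q (R n) powr q))) \<longlonglongrightarrow> 0" by simp
    \<comment> \<open>The inner factor 2 reserves half of \<open>c0\<close> for each of the two
      residuals compared below.\<close>
    from order_tendstoD(2)[OF this c0] obtain N0 where
      N0: "\<And>n. N0 \<le> n \<Longrightarrow> 2 powr q * (2 * (\<bar>Cl\<bar> * besov_norm 1 q (R n) powr q)) < c0"
      unfolding eventually_sequentially by blast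
    \<comment> \<open>A crude bound for the ranks of the first \<open>N0\<close> functions; an
      initial segment that takes in all ranks below v therefore has length at least
      \<open>N0\<close>.\<close>
    define k where "k = (\<Sum>m<N0. even_first_rank (h m))"
    define s where "s = (2::nat) ^ k"
    have s1: "1 \<le> s" by (simp add: s_def)
    \<comment> \<open>The rank shared by the levels \<open>Suc n\<close> with n even and
      \<open>4 * s \<le> n < 8 * s\<close>, for which \<open>dyadic_size n = k + 3\<close>. The
      segments \<open>N1\<close> and \<open>N2\<close> stop just before and just after it.\<close>
    define v where "v = 2 * (k + 3) + 1"
    have seg: "\<exists>N. h ` {..<N} = {g \<in> haar_system. even_first_rank g < u}" for u
      by (rule mono_rank_initial_segment[where r=even_first_rank, OF h mono infinite_haar_system even_first_rank_finite[of u]]) auto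
    obtain N1 where N1: "h ` {..<N1} = {g \<in> haar_system. even_first_rank g < v}" using seg by blast
    obtain N2 where N2: "h ` {..<N2} = {g \<in> haar_system. even_first_rank g < Suc v}" using seg by blast
    have large: "N0 \<le> N" if "h ` {..<N} = {g \<in> haar_system. even_first_rank g < u}" "v \<le> u" for N u
    proof (rule ccontr)
      assume "\<not> N0 \<le> N"
      then have "even_first_rank (h N) \<le> k" unfolding k_def by (intro member_le_sum) auto
      then have "h N \<in> h ` {..<N}" unfolding that(1) using that(2) hm by (simp add: v_def)
      then show False using inj by (auto simp: inj_eq)
    qed
    define P where "P = {n. even n \<and> 4 * s \<le> n \<and> n < 8 * s}"
    have finP: "finite P" unfolding P_def by (rule finite_subset[of _ "{..<8 * s}"]) auto
    have rank: "even_first_rank g = v \<longleftrightarrow> g \<in> (\<Union>n\<in>P. haar_block (Suc n))" if g: "g \<in> haar_system" for g :: "real ^ 'd \<Rightarrow> real"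
    proof -
      have lv: "g \<in> haar_block n \<longleftrightarrow> haar_level g = n" for n
        using haar_level_block[OF g] haar_level_eq by auto
      have ds: "dyadic_size n = k + 3 \<longleftrightarrow> 4 * s \<le> n \<and> n < 8 * s" for n
      proof -
        have "dyadic_size n = k + 3 \<longleftrightarrow> dyadic_size n \<le> k + 3 \<and> \<not> dyadic_size n \<le> k + 2" by auto
        then show ?thesis unfolding dyadic_size_le_iff s_def by (auto simp: power_add not_less)
      qed
      have "even_first_rank g = v \<longleftrightarrow> (\<exists>n. haar_level g = Suc n \<and> even n \<and> dyadic_size n = k + 3)"
        unfolding even_first_rank_def v_def by (cases "haar_level g") (auto, presburger+)
      also have "\<dots> \<longleftrightarrow> g \<in> (\<Union>n\<in>P. haar_block (Suc n))"
        unfolding ds by (auto simp: lv P_def)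
      finally show ?thesis .
    qed
    have blocks: "(\<Union>n\<in>P. haar_block (Suc n)) \<subseteq> (haar_system :: (real ^ 'd \<Rightarrow> real) set)"
      by (auto simp: haar_system_def)
    have "h ` {..<N2} = h ` {..<N1} \<union> (\<Union>n\<in>P. haar_block (Suc n))"
      unfolding N1 N2 using rank blocks by (auto simp: less_Suc_eq)
    moreover have "h ` {..<N1} \<inter> (\<Union>n\<in>P. haar_block (Suc n)) = {}"
      unfolding N1 using rank by auto
    ultimately have diff: "R N1 x - R N2 x = (\<Sum>n\<in>P. b n * (spike (Suc n) x - spike n x))" for x
      using haar_part_Un[of "h ` {..<N1}" "\<Union>n\<in>P. haar_block (Suc n)" f x]
        haar_part_blocks[of f P x, OF f_outside f_integral(1) finP] finP
      by (simp add: R_def avg_diff_f finite_haar_block)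
    define F where "F x = (\<Sum>n\<in>P. b n * (spike (Suc n) x - spike n x))" for x :: "real ^ 'd"
    have Eup: "?E F j \<le> ?E (R N1) j + ?E (R N2) j" for j
    proof -
      have F: "F = (\<lambda>x. R N1 x - R N2 x)" using diff by (auto simp: F_def)
      have "(\<lambda>x. F x - avg j F x) = (\<lambda>x. (R N1 x - avg j (R N1) x) - (R N2 x - avg j (R N2) x))"
        unfolding F by (subst walsh_coeff_diff) (auto intro!: lp_cube_integrable[OF order_refl R_lp])
      then show ?thesis
        unfolding approx_err_def
        using lp_norm_triangle_diff[OF order_refl lp_cube_in_lp[OF lp_cube_approx[OF zero_less_one R_lp]]
           lp_cube_in_lp[OF lp_cube_approx[OF zero_less_one R_lp]], of N1 j N2 j] by simp
    qed
    \<comment> \<open>\<open>avg j\<close> preserves the differences with n < j and annihilates the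
      others, so the error of \<open>F\<close> at scale j is the sum over the even n \<ge> j. For j
      \<le> 6 s at least s of them remain.\<close>
    have Elow: "real s * b (8 * s) / 4 \<le> ?E F j" if j: "j \<le> 6 * s" for j
    proof -
      define Pj where "Pj = {n. even n \<and> 4 * s \<le> n \<and> n < 8 * s \<and> j \<le> n}"
      have Pj: "Pj \<subseteq> P" "finite Pj" using finP finite_subset by (auto simp: Pj_def P_def)
      have av: "avg j F x = (\<Sum>n\<in>P. b n * avg j (\<lambda>x. spike (Suc n) x - spike n x) x)" for x
        unfolding F_def[abs_def]
        by (subst walsh_coeff_sum) (auto simp: walsh_coeff_cmult intro!: spike_integrable)
      have "F x - avg j F x = (\<Sum>n\<in>P. if n < j then 0 else b n * (spike (Suc n) x - spike n x))" for x
        unfolding av avg_spike_diff unfolding F_def sum_subtractf[symmetric] by (intro sum.cong) auto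
      also have "(\<Sum>n\<in>P. if n < j then 0 else b n * (spike (Suc n) x - spike n x))
          = (\<Sum>n\<in>Pj. b n * (spike (Suc n) x - spike n x))" for x :: "real ^ 'd"
        using finP by (intro sum.mono_neutral_cong_right) (auto simp: Pj_def P_def)
      finally have "?E F j = (\<integral>x. \<bar>\<Sum>n\<in>Pj. b n * (spike (Suc n) x - spike n (x :: real ^ 'd))\<bar> \<partial>lborel)"
        by (simp add: approx_err_def lp_norm_1)
      moreover have "(\<Sum>m\<in>Pj. b m) / 4 \<le> \<dots>"
        using Pj b_nonneg by (intro spike_diff_lower) (auto simp: Pj_def)
      moreover have "real s * b (8 * s) \<le> (\<Sum>m\<in>Pj. b m)"
        unfolding Pj_def by (intro sum_even_lower b_anti b_nonneg j)
      ultimately show ?thesis by simp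
    qed
    have low: "c0 \<le> (\<Sum>j<6 * s. ?E F j powr q)"
    proof -
      let ?s = "real s"
      have "9 powr (- \<beta>) * ?s powr (- \<beta>) = (9 * ?s) powr (- \<beta>)" by (simp add: powr_mult)
      also have "\<dots> \<le> b (8 * s)"
        unfolding b_def using s1 \<beta> by (intro powr_mono2') auto
      finally have le: "?s * (9 powr (- \<beta>) * ?s powr (- \<beta>)) / 4 \<le> ?s * b (8 * s) / 4"
        using s1 by (intro divide_right_mono mult_left_mono) auto
      have "(?s * (9 powr (- \<beta>) * ?s powr (- \<beta>)) / 4) powr q \<le> ?E F j powr q" if "j < 6 * s" for j
        using order_trans[OF le Elow[of j]] that q by (intro powr_mono2) auto
      moreover have "?s * (9 powr (- \<beta>) * ?s powr (- \<beta>)) / 4 = (9 powr (- \<beta>) / 4) * ?s powr (1 - \<beta>)"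
        using s1 by (simp add: powr_diff powr_minus field_simps)
      moreover have "((9 powr (- \<beta>) / 4) * ?s powr (1 - \<beta>)) powr q = c0 * ?s powr ((1 - \<beta>) * q)"
        unfolding c0_def by (subst powr_mult) (simp_all add: powr_powr)
      ultimately have e: "c0 * ?s powr ((1 - \<beta>) * q) \<le> ?E F j powr q" if "j < 6 * s" for j
        using that by (simp only:)
      \<comment> \<open>Adding up s scales brings the exponent of s to 1 + (1 - \<beta>) q = q / 2,
        so the sum stays above \<open>c0\<close> however large s is.\<close>
      have "c0 * 1 \<le> c0 * (?s * ?s powr ((1 - \<beta>) * q))"
      proof (rule mult_left_mono)
        have "?s * ?s powr ((1 - \<beta>) * q) = ?s powr (1 + (1 - \<beta>) * q)"
          using s1 by (simp add: powr_add)
        also have "\<dots> \<ge> 1"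
          using s1 q by (intro ge_one_powr_ge_zero) (auto simp: \<beta>_def field_simps)
        finally show "1 \<le> ?s * ?s powr ((1 - \<beta>) * q)" .
      qed (use c0 in simp)
      also have "\<dots> = (\<Sum>j<s. c0 * ?s powr ((1 - \<beta>) * q))" by simp
      also have "\<dots> \<le> (\<Sum>j<s. ?E F j powr q)" using e by (intro sum_mono) auto
      also have "\<dots> \<le> (\<Sum>j<6 * s. ?E F j powr q)" by (intro sum_mono2) auto
      finally show ?thesis by simp
    qed
    have RC: "(\<Sum>j<6 * s. ?E (R N) j powr q) \<le> \<bar>Cl\<bar> * besov_norm 1 q (R N) powr q" for N
    proof -
      have "(\<Sum>j<6 * s. ?E (R N) j powr q) \<le> (\<Sum>j. ?E (R N) j powr q)"
        by (intro sum_le_suminf Cl(2) R_lp R_besov) auto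
      also have "\<dots> \<le> Cl * besov_norm 1 q (R N) powr q" by (rule Cl(1)[OF R_lp R_besov])
      also have "\<dots> \<le> \<bar>Cl\<bar> * besov_norm 1 q (R N) powr q" by (intro mult_right_mono) auto
      finally show ?thesis .
    qed
    have "(\<Sum>j<6 * s. ?E F j powr q) \<le> (\<Sum>j<6 * s. 2 powr q * (?E (R N1) j powr q + ?E (R N2) j powr q))"
    proof (rule sum_mono)
      fix j
      have "?E F j powr q \<le> \<bar>?E (R N1) j + ?E (R N2) j\<bar> powr q" using Eup[of j] q by (intro powr_mono2) auto
      also have "\<dots> \<le> 2 powr q * (\<bar>?E (R N1) j\<bar> powr q + \<bar>?E (R N2) j\<bar> powr q)" by (rule powr_abs_add_le[OF q])
      finally show "?E F j powr q \<le> 2 powr q * (?E (R N1) j powr q + ?E (R N2) j powr q)" by simp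
    qed
    also have "\<dots> = 2 powr q * ((\<Sum>j<6 * s. ?E (R N1) j powr q) + (\<Sum>j<6 * s. ?E (R N2) j powr q))"
      by (simp only: sum_distrib_left[symmetric] sum.distrib)
    also have "\<dots> \<le> 2 powr q * (\<bar>Cl\<bar> * besov_norm 1 q (R N1) powr q + \<bar>Cl\<bar> * besov_norm 1 q (R N2) powr q)"
      by (intro mult_left_mono add_mono RC) auto
    also have "\<dots> < c0"
      using N0[OF large[OF N1]] N0[OF large[OF N2]] by (simp add: distrib_left)
    finally show False using low by simp
  qed
  with h show thesis by (rule that)
qed

section \<open>Rearrangements and the assembly of the cases\<close>

lemma enumerations_rearrange:
  fixes h h' :: "nat \<Rightarrow> 'a"
  assumes "bij_betw h UNIV H" "bij_betw h' UNIV H"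
  obtains \<pi> where "bij \<pi>" "h \<circ> \<pi> = h'"
proof (rule that[of "inv_into UNIV h \<circ> h'"])
  show "bij (inv_into UNIV h \<circ> h')"
    by (rule bij_betw_trans[OF assms(2) bij_betw_inv_into[OF assms(1)]])
  show "h \<circ> (inv_into UNIV h \<circ> h') = h'"
  proof
    fix x
    have "h' x \<in> range h" using assms by (auto simp: bij_betw_def)
    then show "(h \<circ> (inv_into UNIV h \<circ> h')) x = h' x" by (simp add: f_inv_into_f)
  qed
qed

text \<open>Any two enumerations differ by a permutation, so one bad enumeration refutes all: the
  one with even levels first for p = 1, and already the level order for p < 1.\<close>

lemma haar_not_unconditional:
  fixes h :: "nat \<Rightarrow> real ^ 'd \<Rightarrow> real"
  assumes p: "0 < p" "p \<le> 1" and q: "0 < q" and h: "bij_betw h UNIV haar_system"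
  shows "\<not> unconditional_schauder_basis (besov_space p q) (besov_quasinorm p q) h"
proof -
  obtain h' :: "nat \<Rightarrow> real ^ 'd \<Rightarrow> real" where h': "bij_betw h' UNIV haar_system"
    "\<not> schauder_basis (besov_space p q) (besov_quasinorm p q) h'"
  proof (cases "p = 1")
    case True
    then show thesis using haar_divergent_ordering_p1[OF q] that by metis
  next
    case False
    obtain g :: "nat \<Rightarrow> real ^ 'd \<Rightarrow> real" where g: "bij_betw g UNIV haar_system"
      "\<And>m n. m \<le> n \<Longrightarrow> haar_level (g m) \<le> haar_level (g n)"
      by (rule level_enumeration) (rule that)
    show thesis by (rule that[OF g(1) haar_not_schauder_small_p[OF p(1) _ q g]]) (use False p in simp)
  qed
  obtain \<pi> where "bij \<pi>" "h \<circ> \<pi> = h'" using enumerations_rearrange[OF h h'(1)] .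
  with h'(2) show ?thesis unfolding unconditional_schauder_basis_def by blast
qed

lemma haar_unconditional:
  fixes h :: "nat \<Rightarrow> real ^ 'd \<Rightarrow> real"
  assumes p: "1 < p" and q: "0 < q" and h: "bij_betw h UNIV haar_system"
  shows "unconditional_schauder_basis (besov_space p q) (besov_quasinorm p q) h"
  unfolding unconditional_schauder_basis_def
proof (intro allI impI)
  fix \<pi> :: "nat \<Rightarrow> nat" assume "bij \<pi>"
  then have b: "bij_betw (h \<circ> \<pi>) UNIV haar_system" using h by (rule bij_betw_trans)
  then have sub: "(h \<circ> \<pi>) ` {..<n} \<subseteq> haar_system" for n by (auto simp: bij_betw_def)
  obtain C where C: "0 \<le> C" "\<forall>(f :: real ^ 'd \<Rightarrow> real) A. lp_cube p f \<longrightarrow> finite A \<longrightarrow> A \<subseteq> haar_system \<longrightarrow>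
      lp_norm lborel p (haar_part A f) \<le> C * lp_norm lborel p f"
    using haar_part_bounded[OF p, where 'd='d] by (elim exE conjE)
  show "schauder_basis (besov_space p q) (besov_quasinorm p q) (h \<circ> \<pi>)"
  proof (rule haar_schauder_criterion[OF _ q b C(1)])
    show "lp_norm lborel p (haar_part ((h \<circ> \<pi>) ` {..<n}) g) \<le> C * lp_norm lborel p g"
      if "lp_cube p g" for n and g :: "real ^ 'd \<Rightarrow> real"
      by (rule C(2)[rule_format, OF that _ sub]) simp
  qed (use p in simp)
qed

lemma haar_blockwise_schauder:
  fixes h :: "nat \<Rightarrow> real ^ 'd \<Rightarrow> real"
  assumes p: "1 \<le> p" and q: "0 < q" and h: "blockwise_ordering h"
  shows "schauder_basis (besov_space p q) (besov_quasinorm p q) h"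
proof (rule haar_schauder_criterion[OF p q])
  show b: "bij_betw h UNIV haar_system" using h by (simp add: blockwise_ordering_def)
  let ?C = "1 + real (card (UNIV - {{} :: 'd set}))"
  show "0 \<le> ?C" by simp
  fix n and g :: "real ^ 'd \<Rightarrow> real" assume g: "lp_cube p g"
  consider "h ` {..<n} = {}" | K where "haar_upto K \<subseteq> h ` {..<n}" "h ` {..<n} \<subseteq> haar_upto (Suc K)"
    using level_initial_segment[OF b blockwise_ordering_level_mono[OF h], of n] by blast
  then show "lp_norm lborel p (haar_part (h ` {..<n}) g) \<le> ?C * lp_norm lborel p g"
  proof cases
    case 1
    then have "haar_part (h ` {..<n}) g = (\<lambda>_. 0)" by (auto simp: haar_part_def)
    then show ?thesis using p by simp
  next
    case 2
    then show ?thesis using haar_part_blockwise_bounded[OF p g] by simp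
  qed
qed

theorem theorem5:
  fixes p q :: real
  assumes "0 < p" and "0 < q"
  shows "(unconditional_basis_system (besov_space p q) (besov_quasinorm p q)
            (haar_system :: (real ^ 'd \<Rightarrow> real) set) \<longleftrightarrow> 1 < p) \<and>
         (p = 1 \<longrightarrow>
            (\<forall>h :: nat \<Rightarrow> real ^ 'd \<Rightarrow> real. blockwise_ordering h \<longrightarrow>
               schauder_basis (besov_space p q) (besov_quasinorm p q) h \<and>
               \<not> unconditional_schauder_basis (besov_space p q) (besov_quasinorm p q) h))"
proof (intro conjI impI allI)
  show "unconditional_basis_system (besov_space p q) (besov_quasinorm p q)
            (haar_system :: (real ^ 'd \<Rightarrow> real) set) \<longleftrightarrow> 1 < p"
  proof
    assume "unconditional_basis_system (besov_space p q) (besov_quasinorm p q)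
            (haar_system :: (real ^ 'd \<Rightarrow> real) set)"
    then show "1 < p"
      using haar_not_unconditional[OF assms(1) _ assms(2), where 'd='d]
      unfolding unconditional_basis_system_def by (meson not_le)
  next
    assume "1 < p"
    obtain h :: "nat \<Rightarrow> real ^ 'd \<Rightarrow> real" where h: "bij_betw h UNIV haar_system"
      using level_enumeration by metis
    from haar_unconditional[OF \<open>1 < p\<close> assms(2) h] h
    show "unconditional_basis_system (besov_space p q) (besov_quasinorm p q)
            (haar_system :: (real ^ 'd \<Rightarrow> real) set)"
      unfolding unconditional_basis_system_def by blast
  qed
next
  fix h :: "nat \<Rightarrow> real ^ 'd \<Rightarrow> real"
  assume "p = 1" and h: "blockwise_ordering h"
  then show "schauder_basis (besov_space p q) (besov_quasinorm p q) h"
    using haar_blockwise_schauder[OF _ assms(2) h, of p] by simp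
  show "\<not> unconditional_schauder_basis (besov_space p q) (besov_quasinorm p q) h"
    using h \<open>p = 1\<close> by (intro haar_not_unconditional assms) (auto simp: blockwise_ordering_def)
qed

end
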